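(* Let $X$ be a compact metric space and $T\colon X\to X$ continuous. If $(\Gamma_n)_{n\in\mathbb N}$ is a GIKN sequence of $T$-periodic orbits and $\mu_n$ denotes the ergodic measure supported on $\Gamma_n$ for $n\in\mathbb N$, then for any choice of $x_n\in\Gamma_n$ the sequence $(x_n)_{n=1}^\infty$ is $\overline{\mathit{fk}}$-Cauchy and $(\mu_n)_{n=1}^\infty$ $\overline{\mathit{fk}}$-converges to some $T$-invariant measure $\mu$. In particular, a royal measure is a $\overline{\mathit{fk}}$-limit of periodic measures.
   Context: Let $\rho$ be the metric of $X$. $X^\infty$ is the set of $X$-valued sequences indexed by $\mathbb N\cup\{0\}$; the trajectory of $x\in X$ is $\underline{x}_T=(T^j(x))_{j\ge0}\in X^\infty$. Good approximation: a $T$-periodic orbit $\Gamma$ is a $(\gamma,\kappa)$-good approximation of a $T$-periodic orbit $\Lambda$ if there are a subset $\Delta\subset\Gamma$ with $|\Delta|/|\Gamma|\ge\kappa$ and a constant-to-one surjection $\psi\colon\Delta\to\Lambda$ (all fibres have the same cardinality) such that $\rho(T^j(y),T^j(\psi(y)))<\gamma$ for every $y\in\Delta$ and $0\le j<|\Lambda|$. GIKN sequence: a sequence $(\Gamma_n)_{n\in\mathbb N}$ of $T$-periodic orbits with $|\Gamma_n|\nearrow\infty$ for which there are positive real sequences $(\gamma_n)$, $(\kappa_n)$ with: for each $n\ge1$, $\Gamma_{n+1}$ is a $(\gamma_n,\kappa_n)$-good approximation of $\Gamma_n$; $\sum_n\gamma_n<\infty$; $\prod_n\kappa_n>0$. A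 measure is royal if it is the weak$^*$ limit of the ergodic measures $\mu_n$ supported on the orbits $\Gamma_n$ of a GIKN sequence. A periodic measure is the uniform (ergodic) measure on a periodic orbit. Feldman–Katok pseudometric: for $\underline x=(x_j),\underline z=(z_j)\in X^\infty$, $\delta>0$, $n\in\mathbb N$, an $(n,\delta)$-match is an order-preserving bijection $\pi\colon\mathcal D(\pi)\to\mathcal R(\pi)$ with $\mathcal D(\pi),\mathcal R(\pi)\subset\{0,\dots,n-1\}$ (possibly empty) and $\rho(x_i,z_{\pi(i)})<\delta$ for all $i\in\mathcal D(\pi)$; $|\pi|=|\mathcal D(\pi)|$. Put $\bar f_{n,\delta}(\underline x,\underline z)=1-\frac1n\max\{|\pi|:\pi\text{ is an }(n,\delta)\text{-match}\}$, $\bar f_\delta(\underline x,\underline z)=\limsup_{n\to\infty}\bar f_{n,\delta}(\underline x,\underline z)$, and $\overline{\mathit{fk}}(\underline x,\underline z)=\inf\{\delta>0:\bar f_\delta(\underline x,\underline z)<\delta\}$. For $x,z\in X$, $\overline{\mathit{fk}}(x,z)=\overline{\mathit{fk}}(\underline x_T,\underline z_T)$; "$\overline{\mathit{fk}}$-Cauchy" refers to this pseudometric on $X$. A sequence $\underline x\in X^\infty$ is generic for a Borel probability measure $\mu$ if $\frac1n\sum_{j=0}^{n-1}\delta_{x_j}\to\mu$ weak$^*$; a point $x$ is generic for $\mu$ if $\underline x_T$ is. A quasi-orbit is $\underline z\in X^\infty$ such that $\{n\ge0:z_{n+1}\ne T(z_n)\}$ has upper asymptotic density $0$. A sequence $(\mu_n)$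 of $T$-invariant measures $\overline{\mathit{fk}}$-converges to a $T$-invariant measure $\mu$ if there are quasi-orbits $\underline x^{(n)}$ generic for $\mu_n$ and a quasi-orbit $\underline z$ generic for $\mu$ with $\overline{\mathit{fk}}(\underline z,\underline x^{(n)})\to0$. A measure $\mu$ is a $\overline{\mathit{fk}}$-limit of $(\mu_n)$ if there is a $\overline{\mathit{fk}}$-Cauchy sequence of points $x^{(n)}\in X$ generic for $\mu_n$ and a quasi-orbit $\underline z$ generic for $\mu$ with $\overline{\mathit{fk}}(\underline z,\underline x^{(n)}_T)\to0$. *)

theory Defs
  imports "HOL-Probability.Probability"
begin

text \<open>
  The compact metric space \<open>X\<close> is a type of class \<open>metric_space\<close> whose universe is compact;
  compactness is a hypothesis of the theorem and is not built into the definitions. Sequences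
  of orbits, points and measures indexed by the positive integers are indexed by \<open>nat\<close> starting
  at \<open>0\<close>, so the \<open>n\<close>-th object below is the \<open>(n+1)\<close>-st one of the informal text.
\<close>

section \<open>Measures\<close>

definition borel_prob :: "'a::metric_space measure \<Rightarrow> bool" where
  "borel_prob \<mu> \<longleftrightarrow> prob_space \<mu> \<and> sets \<mu> = sets borel"

definition invariant_measure :: "('a::metric_space \<Rightarrow> 'a) \<Rightarrow> 'a measure \<Rightarrow> bool" where
  "invariant_measure T \<mu> \<longleftrightarrow> borel_prob \<mu> \<and> distr \<mu> borel T = \<mu>"

text \<open>On a compact space all continuous real functions are bounded, so these test functions are
  exactly the elements of \<open>C(X)\<close>.\<close>

definition weak_star_tendsto ::
    "(nat \<Rightarrow> 'a::metric_space measure) \<Rightarrow> 'a measure \<Rightarrow> bool" where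
  "weak_star_tendsto M \<mu> \<longleftrightarrow>
     (\<forall>f :: 'a \<Rightarrow> real. continuous_on UNIV f \<longrightarrow>
        (\<lambda>n. integral\<^sup>L (M n) f) \<longlonglongrightarrow> integral\<^sup>L \<mu> f)"

section \<open>Periodic orbits and the GIKN construction\<close>

definition trajectory :: "('a \<Rightarrow> 'a) \<Rightarrow> 'a \<Rightarrow> nat \<Rightarrow> 'a" where
  "trajectory T x j = (T ^^ j) x"

definition periodic_orbit :: "('a \<Rightarrow> 'a) \<Rightarrow> 'a set \<Rightarrow> bool" where
  "periodic_orbit T \<Gamma> \<longleftrightarrow> (\<exists>x p. p > 0 \<and> (T ^^ p) x = x \<and> \<Gamma> = range (trajectory T x))"

text \<open>The uniform distribution on a finite set \<open>\<Gamma>\<close>, as a Borel measure on the whole space.\<close>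

definition orbit_measure :: "'a::metric_space set \<Rightarrow> 'a measure" where
  "orbit_measure \<Gamma> = distr (uniform_count_measure \<Gamma>) borel (\<lambda>x. x)"

definition periodic_measure :: "('a::metric_space \<Rightarrow> 'a) \<Rightarrow> 'a measure \<Rightarrow> bool" where
  "periodic_measure T \<mu> \<longleftrightarrow> (\<exists>\<Gamma>. periodic_orbit T \<Gamma> \<and> \<mu> = orbit_measure \<Gamma>)"

definition good_approximation ::
    "('a::metric_space \<Rightarrow> 'a) \<Rightarrow> real \<Rightarrow> real \<Rightarrow> 'a set \<Rightarrow> 'a set \<Rightarrow> bool" where
  "good_approximation T \<gamma> \<kappa> \<Gamma> \<Lambda> \<longleftrightarrow>
     (\<exists>\<Delta> \<psi>. \<Delta> \<subseteq> \<Gamma> \<and> real (card \<Delta>) / real (card \<Gamma>) \<ge> \<kappa> \<and>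
        \<psi> ` \<Delta> = \<Lambda> \<and>
        (\<exists>c. \<forall>x\<in>\<Lambda>. card {y \<in> \<Delta>. \<psi> y = x} = c) \<and>
        (\<forall>y\<in>\<Delta>. \<forall>j<card \<Lambda>. dist ((T ^^ j) y) ((T ^^ j) (\<psi> y)) < \<gamma>))"

text \<open>
  Since all \<open>\<kappa> n\<close> are positive, \<open>convergent_prod \<kappa>\<close> says that the partial products converge to a
  nonzero limit; without it \<open>prodinf \<kappa>\<close> would be unspecified for a product diverging to \<open>0\<close>.
\<close>

definition GIKN_sequence :: "('a::metric_space \<Rightarrow> 'a) \<Rightarrow> (nat \<Rightarrow> 'a set) \<Rightarrow> bool" where
  "GIKN_sequence T \<Gamma> \<longleftrightarrow>
     (\<forall>n. periodic_orbit T (\<Gamma> n)) \<and>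
     incseq (\<lambda>n. card (\<Gamma> n)) \<and> filterlim (\<lambda>n. card (\<Gamma> n)) at_top sequentially \<and>
     (\<exists>\<gamma> \<kappa> :: nat \<Rightarrow> real.
        (\<forall>n. \<gamma> n > 0) \<and> (\<forall>n. \<kappa> n > 0) \<and>
        (\<forall>n. good_approximation T (\<gamma> n) (\<kappa> n) (\<Gamma> (Suc n)) (\<Gamma> n)) \<and>
        summable \<gamma> \<and> convergent_prod \<kappa> \<and> prodinf \<kappa> > 0)"

definition royal_measure :: "('a::metric_space \<Rightarrow> 'a) \<Rightarrow> 'a measure \<Rightarrow> bool" where
  "royal_measure T \<mu> \<longleftrightarrow> borel_prob \<mu> \<and>
     (\<exists>\<Gamma>. GIKN_sequence T \<Gamma> \<and> weak_star_tendsto (\<lambda>n. orbit_measure (\<Gamma> n)) \<mu>)"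

section \<open>The Feldman--Katok pseudometric\<close>

definition is_match ::
    "nat \<Rightarrow> real \<Rightarrow> (nat \<Rightarrow> 'a::metric_space) \<Rightarrow> (nat \<Rightarrow> 'a) \<Rightarrow>
     nat set \<Rightarrow> nat set \<Rightarrow> (nat \<Rightarrow> nat) \<Rightarrow> bool" where
  "is_match n \<delta> x z D R \<pi> \<longleftrightarrow>
     D \<subseteq> {..<n} \<and> R \<subseteq> {..<n} \<and> bij_betw \<pi> D R \<and> strict_mono_on D \<pi> \<and>
     (\<forall>i\<in>D. dist (x i) (z (\<pi> i)) < \<delta>)"

definition fbar_n ::
    "nat \<Rightarrow> real \<Rightarrow> (nat \<Rightarrow> 'a::metric_space) \<Rightarrow> (nat \<Rightarrow> 'a) \<Rightarrow> real" where
  "fbar_n n \<delta> x z = 1 - 1 / real n * real (Max {card D | D R \<pi>. is_match n \<delta> x z D R \<pi>})"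

definition fbar :: "real \<Rightarrow> (nat \<Rightarrow> 'a::metric_space) \<Rightarrow> (nat \<Rightarrow> 'a) \<Rightarrow> ereal" where
  "fbar \<delta> x z = limsup (\<lambda>n. ereal (fbar_n n \<delta> x z))"

definition fk :: "(nat \<Rightarrow> 'a::metric_space) \<Rightarrow> (nat \<Rightarrow> 'a) \<Rightarrow> real" where
  "fk x z = Inf {\<delta>. \<delta> > 0 \<and> fbar \<delta> x z < ereal \<delta>}"

definition fk_point :: "('a::metric_space \<Rightarrow> 'a) \<Rightarrow> 'a \<Rightarrow> 'a \<Rightarrow> real" where
  "fk_point T x z = fk (trajectory T x) (trajectory T z)"

definition fk_Cauchy :: "('a::metric_space \<Rightarrow> 'a) \<Rightarrow> (nat \<Rightarrow> 'a) \<Rightarrow> bool" where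
  "fk_Cauchy T x \<longleftrightarrow> (\<forall>\<epsilon>>0. \<exists>N. \<forall>m\<ge>N. \<forall>n\<ge>N. fk_point T (x m) (x n) < \<epsilon>)"

section \<open>Generic sequences, quasi-orbits and convergence of measures\<close>

text \<open>The measure \<open>1/n * (\<delta>(x 0) + ... + \<delta>(x (n - 1)))\<close>, as the image of the uniform measure on
  the index set; see \<open>emeasure_empirical_measure\<close>.\<close>

definition empirical_measure :: "(nat \<Rightarrow> 'a::metric_space) \<Rightarrow> nat \<Rightarrow> 'a measure" where
  "empirical_measure x n = distr (uniform_count_measure {..<n}) borel x"

definition generic :: "(nat \<Rightarrow> 'a::metric_space) \<Rightarrow> 'a measure \<Rightarrow> bool" where
  "generic x \<mu> \<longleftrightarrow> borel_prob \<mu> \<and> weak_star_tendsto (empirical_measure x) \<mu>"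

definition generic_point :: "('a::metric_space \<Rightarrow> 'a) \<Rightarrow> 'a \<Rightarrow> 'a measure \<Rightarrow> bool" where
  "generic_point T x \<mu> \<longleftrightarrow> generic (trajectory T x) \<mu>"

definition upper_density :: "nat set \<Rightarrow> ereal" where
  "upper_density A = limsup (\<lambda>n. ereal (real (card (A \<inter> {..<n})) / real n))"

definition quasi_orbit :: "('a \<Rightarrow> 'a) \<Rightarrow> (nat \<Rightarrow> 'a) \<Rightarrow> bool" where
  "quasi_orbit T z \<longleftrightarrow> upper_density {n. z (Suc n) \<noteq> T (z n)} = 0"

definition fk_converges ::
    "('a::metric_space \<Rightarrow> 'a) \<Rightarrow> (nat \<Rightarrow> 'a measure) \<Rightarrow> 'a measure \<Rightarrow> bool" where
  "fk_converges T M \<mu> \<longleftrightarrow>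
     (\<forall>n. invariant_measure T (M n)) \<and> invariant_measure T \<mu> \<and>
     (\<exists>(x :: nat \<Rightarrow> nat \<Rightarrow> 'a) z.
        (\<forall>n. quasi_orbit T (x n) \<and> generic (x n) (M n)) \<and>
        quasi_orbit T z \<and> generic z \<mu> \<and>
        (\<lambda>n. fk z (x n)) \<longlonglongrightarrow> 0)"

definition fk_limit ::
    "('a::metric_space \<Rightarrow> 'a) \<Rightarrow> (nat \<Rightarrow> 'a measure) \<Rightarrow> 'a measure \<Rightarrow> bool" where
  "fk_limit T M \<mu> \<longleftrightarrow>
     (\<exists>(x :: nat \<Rightarrow> 'a) z.
        fk_Cauchy T x \<and> (\<forall>n. generic_point T (x n) (M n)) \<and>
        quasi_orbit T z \<and> generic z \<mu> \<and>
        (\<lambda>n. fk z (trajectory T (x n))) \<longlonglongrightarrow> 0)"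

section \<open>Sanity checks\<close>

lemma emeasure_empirical_measure:
  assumes "A \<in> sets borel"
  shows "emeasure (empirical_measure x n) A = ennreal (real (card {j. j < n \<and> x j \<in> A}) / real n)"
proof -
  have "x -` A \<inter> {..<n} = {j. j < n \<and> x j \<in> A}" by auto
  moreover have "x \<in> measurable (uniform_count_measure {..<n}) borel"
    by (auto simp: measurable_def space_uniform_count_measure sets_uniform_count_measure)
  ultimately show ?thesis
    using assms unfolding empirical_measure_def
    by (subst emeasure_distr)
       (simp_all add: space_uniform_count_measure, subst emeasure_uniform_count_measure, auto)
qed

lemma emeasure_orbit_measure:
  assumes "A \<in> sets borel" and "finite \<Gamma>"
  shows "emeasure (orbit_measure \<Gamma>) A = ennreal (real (card (A \<inter> \<Gamma>)) / real (card \<Gamma>))"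
proof -
  have "(\<lambda>x. x) \<in> measurable (uniform_count_measure \<Gamma>) borel"
    by (auto simp: measurable_def space_uniform_count_measure sets_uniform_count_measure)
  then show ?thesis
    using assms unfolding orbit_measure_def
    by (subst emeasure_distr)
       (auto simp: space_uniform_count_measure emeasure_uniform_count_measure)
qed

end

theory Submission
  imports Defs
begin

text \<open>
  A good approximation of a good approximation is a good approximation, with the \<open>\<gamma>\<close> added and the
  \<open>\<kappa>\<close> multiplied. Hence it suffices to bound the Feldman--Katok distance for one approximation of
  \<open>\<Lambda>\<close> by \<open>\<Gamma>\<close> by a quantity tending to \<open>0\<close> as \<open>\<gamma> \<rightarrow> 0\<close>, \<open>\<kappa> \<rightarrow> 1\<close>, \<open>|\<Lambda>| \<rightarrow> \<infinity>\<close>; no summable rate is needed.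

  Nothing prevents \<open>\<gamma>\<close> from exceeding the distances between points of \<open>\<Lambda>\<close>, so the segments of \<open>\<Gamma>\<close>
  that follow \<open>\<Lambda>\<close> from a given point may overlap. Instead, sample the phase along \<open>\<Gamma>\<close> in steps of length
  \<open>\<tau>\<close>, small against \<open>p = |\<Lambda>|\<close>. If the phase jumps by \<open>e\<close> in a step, then the shift of \<open>\<Lambda>\<close> by \<open>e\<close> is
  \<open>2\<gamma>\<close>-close to the identity outside an arc of length \<open>\<tau>\<close> at the current phase. Jumps much smaller than
  \<open>\<tau>\<close> can be followed at little cost, and jumps whose shift is close to the identity everywhere can be
  ignored. The shifts of two other, bad jumps commute, which forces two of any three bad jumps to
  occur at neighbouring phases; so there are at most \<open>8\<tau>\<close> bad phases, and as \<open>\<psi>\<close> is constant-to-one, bad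
  jumps are so rare that they can be ignored too, realigning the phase once in many periods.

  The quasi-orbit generic for the limit runs through longer and longer pieces of the periodic orbits.
  The limit measure is the law of the almost sure limit of a random sequence of points of the orbits,
  coupled by the maps \<open>\<psi>\<close>.
\<close>

section \<open>Phase jumps\<close>

text \<open>The order of choices makes the estimate possible. The precision \<delta> fixes
  \<open>I\<close>, hence the number \<open>E\<close> of sampling steps per period and the number
  \<open>I * E\<close> of steps per block; neither depends on \<open>p\<close>. Only then is
  \<gamma> taken small: outside the spoilt arcs each ignored jump displaces a point by at most a
  fixed multiple of \<gamma>, and a block contains boundedly many of them. So blocks must not
  consist of too many steps, yet must last for many periods, since every realignment may waste one.

  Where \<gamma> does not separate the points of \<Lambda>, the phase is not determined by
  \<open>y\<close>: two phases that both shadow \<open>y\<close> for a while differ by a shift that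
  nearly preserves part of the periodic sequence. The jumps are treated as such partial
  near-symmetries.

  For the limit measure the coupling uses both rates: \<open>\<gamma> n\<close> bounds the
  displacement from one orbit to the next, and \<open>1 - \<kappa> n\<close> the probability of a
  larger one. Both are summable, so the whole sequence of orbit measures converges, without passing
  to a subsequence.\<close>

definition order_matching :: "('b::linorder \<times> 'c::linorder) set \<Rightarrow> bool" where
  "order_matching Q \<longleftrightarrow> (\<forall>(i, j)\<in>Q. \<forall>(i', j')\<in>Q. i < i' \<longleftrightarrow> j < j')"

text \<open>\<open>x\<close> is indexed by integers so that shifts may be negative, and the phase
  \<open>\<phi> t\<close> matters only modulo \<open>p\<close>. The last assumption links the
  thresholds: \<open>I\<close> steps, each larger than \<sigma>, cross any arc of length
  \<tau>.\<close>

locale shadowing =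
  fixes x :: "int \<Rightarrow> 'a::metric_space" and y :: "nat \<Rightarrow> 'a" and p :: int
    and \<Delta> :: "nat set" and \<phi> :: "nat \<Rightarrow> int" and \<gamma> :: real and \<tau> \<sigma> I :: nat
  assumes p_pos: "p > 0"
    and periodic: "x (k + p) = x k"
    and shadow: "t \<in> \<Delta> \<Longrightarrow> int j < p \<Longrightarrow> dist (y (t + j)) (x (\<phi> t + int j)) < \<gamma>"
    and \<gamma>_pos: "\<gamma> > 0"
    and \<tau>_le: "2 * int \<tau> \<le> p"
    and \<tau>_less: "\<tau> < (\<sigma> + 1) * I"
begin

definition jump :: "nat \<Rightarrow> int" where
  "jump t = \<phi> (t + \<tau>) - \<phi> t - int \<tau>"

definition in_arc :: "int \<Rightarrow> int \<Rightarrow> bool" where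
  "in_arc a \<theta> \<longleftrightarrow> (\<theta> - a) mod p < int \<tau>"

definition slow :: "int \<Rightarrow> bool" where
  "slow e \<longleftrightarrow> (\<exists>r. \<bar>r\<bar> \<le> int \<sigma> \<and> p dvd e - r)"

text \<open>The constant is what \<open>shifted_arcs_meet\<close> produces: two paths of at most
  \<open>I\<close> steps of size \<open>2 * \<gamma>\<close> each, and one more such step between
  their ends.\<close>

definition free :: "int \<Rightarrow> bool" where
  "free e \<longleftrightarrow> (\<forall>\<theta>. dist (x (\<theta> + e)) (x \<theta>) < (4 * real I + 2) * \<gamma>)"

definition shift_off_arc :: "int \<Rightarrow> int \<Rightarrow> bool" where
  "shift_off_arc a e \<longleftrightarrow> (\<forall>\<theta>. \<not> in_arc a \<theta> \<longrightarrow> dist (x (\<theta> + e)) (x \<theta>) < 2 * \<gamma>)"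

definition bad :: "nat \<Rightarrow> bool" where
  "bad t \<longleftrightarrow> t \<in> \<Delta> \<and> t + \<tau> \<in> \<Delta> \<and> \<not> slow (jump t) \<and> \<not> free (jump t)"

lemma periodic_mult: "x (k + p * m) = x k"
proof (induction m rule: int_induct[where k = 0])
  case base then show ?case by simp
next
  case (step1 i) then show ?case using periodic[of "k + p * i"] by (simp add: algebra_simps)
next
  case (step2 i) then show ?case using periodic[of "k + p * (i - 1)"] by (simp add: algebra_simps)
qed

lemma x_cong: "p dvd k - l \<Longrightarrow> x k = x l"
  by (metis (no_types, opaque_lifting) add.commute diff_add_cancel dvdE periodic_mult)

text \<open>For \<open>\<tau> \<le> j < p\<close> the point \<open>y (t + j)\<close> is shadowed
  twice: from time \<open>t\<close> at the phase \<open>\<phi> t + j\<close>, and from time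
  \<open>t + \<tau>\<close> at that phase plus the jump. The exceptional arc consists of the first
  \<tau> positions, which the second shadowing misses.\<close>

lemma shift_off_arc_jump:
  assumes "t \<in> \<Delta>" "t + \<tau> \<in> \<Delta>"
  shows "shift_off_arc (\<phi> t) (jump t)"
  unfolding shift_off_arc_def
proof (intro allI impI)
  fix \<theta> assume "\<not> in_arc (\<phi> t) \<theta>"
  define j where "j = nat ((\<theta> - \<phi> t) mod p)"
  have j: "int j = (\<theta> - \<phi> t) mod p" "int \<tau> \<le> int j" "int j < p"
    using \<open>\<not> in_arc (\<phi> t) \<theta>\<close> p_pos unfolding in_arc_def j_def by auto
  have dvd: "p dvd \<theta> - (\<phi> t + int j)"
    using j(1) by (metis diff_diff_eq dvd_minus_mod)
  have 1: "dist (y (t + j)) (x \<theta>) < \<gamma>"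
    using shadow[OF assms(1) j(3)] x_cong[OF dvd] by simp
  have "dist (y (t + \<tau> + (j - \<tau>))) (x (\<phi> (t + \<tau>) + int (j - \<tau>))) < \<gamma>"
    using j by (intro shadow[OF assms(2)]) auto
  moreover have "x (\<phi> (t + \<tau>) + int (j - \<tau>)) = x (\<theta> + jump t)"
  proof (rule x_cong)
    have "\<phi> (t + \<tau>) + int (j - \<tau>) - (\<theta> + jump t) = - (\<theta> - (\<phi> t + int j))"
      using j by (simp add: jump_def)
    then show "p dvd \<phi> (t + \<tau>) + int (j - \<tau>) - (\<theta> + jump t)" using dvd by (metis dvd_minus_iff)
  qed
  moreover have "t + \<tau> + (j - \<tau>) = t + j" using j by simp
  ultimately have "dist (y (t + j)) (x (\<theta> + jump t)) < \<gamma>" by simp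
  with 1 show "dist (x (\<theta> + jump t)) (x \<theta>) < 2 * \<gamma>"
    using dist_triangle3[of "x (\<theta> + jump t)" "x \<theta>" "y (t + j)"] by simp
qed

text \<open>If the arc were not left, the residues \<open>u i\<close> would lie in an interval of
  length \<open>\<tau> \<le> p / 2\<close>, so consecutive differences, which agree modulo
  \<open>p\<close>, would be equal. Their common value \<open>d\<close> represents \<open>e\<close>,
  so it exceeds \<sigma> in absolute value, and \<open>I\<close> such steps are longer than the
  arc.\<close>

lemma leaves_arc:
  assumes "\<not> slow e"
  shows "\<exists>i\<le>I. \<not> in_arc a (\<theta> + int i * e)"
proof (rule ccontr)
  assume "\<not> ?thesis"
  then have arc: "in_arc a (\<theta> + int i * e)" if "i \<le> I" for i using that by blast
  define u where "u i = (\<theta> + int i * e - a) mod p" for i :: nat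
  have u: "0 \<le> u i" "u i < int \<tau>" if "i \<le> I" for i
    using arc[OF that] p_pos unfolding u_def in_arc_def by auto
  have dvd: "p dvd e - (u (Suc i) - u i)" for i
  proof -
    have "e - (u (Suc i) - u i) = ((\<theta> + int (Suc i) * e - a) - u (Suc i)) - ((\<theta> + int i * e - a) - u i)"
      by (simp add: algebra_simps)
    then show ?thesis unfolding u_def by (metis dvd_diff dvd_minus_mod)
  qed
  have I_pos: "I > 0" using \<tau>_less by (cases I) auto
  define d where "d = u 1 - u 0"
  have step: "u (Suc i) - u i = d" if "i < I" for i
  proof -
    have "p dvd (u (Suc i) - u i) - d"
      using dvd_diff[OF dvd[of 0] dvd[of i]] by (simp add: d_def algebra_simps)
    moreover have "\<bar>(u (Suc i) - u i) - d\<bar> < p"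
      using u[of "Suc i"] u[of i] u[of 0] u[of 1] that I_pos \<tau>_le unfolding d_def by simp
    ultimately have "(u (Suc i) - u i) - d = 0"
      using dvd_imp_le_int[of "(u (Suc i) - u i) - d" p] p_pos by linarith
    then show ?thesis by simp
  qed
  have lin: "u i = u 0 + int i * d" if "i \<le> I" for i
    using that
  proof (induction i)
    case (Suc i)
    then show ?case using step[of i] by (simp add: algebra_simps)
  qed simp
  have "\<bar>int I * d\<bar> < int \<tau>" using lin[of I] u[of I] u[of 0] by linarith
  moreover have "\<bar>d\<bar> \<ge> int \<sigma> + 1"
  proof (rule ccontr)
    assume "\<not> ?thesis"
    then have "slow e" using dvd[of 0] unfolding slow_def d_def by (intro exI[of _ "u 1 - u 0"]) simp
    then show False using assms by simp
  qed
  then have "int I * (int \<sigma> + 1) \<le> \<bar>int I * d\<bar>" by (simp add: abs_mult mult_left_mono)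
  moreover have "int \<tau> < (int \<sigma> + 1) * int I"
    using \<tau>_less by (metis of_nat_1 of_nat_add of_nat_less_iff of_nat_mult)
  ultimately show False by (simp add: mult.commute)
qed

text \<open>The two shifts commute; a point where the first one is far from the identity is transported
  by the second one to a point where it is not.\<close>
lemma shifted_arcs_meet:
  assumes a: "shift_off_arc a e" and b: "shift_off_arc b e'"
    and "\<not> free e" "\<not> slow e'" and disj: "\<And>\<theta>. in_arc a \<theta> \<Longrightarrow> \<not> in_arc b \<theta>"
  shows "\<exists>\<theta>. in_arc a \<theta> \<and> in_arc b (\<theta> + e)"
proof (rule ccontr)
  assume "\<not> ?thesis"
  then have disj': "\<not> in_arc b (\<theta> + e)" if "in_arc a \<theta>" for \<theta> using that by blast
  obtain \<theta> where \<theta>: "dist (x (\<theta> + e)) (x \<theta>) \<ge> (4 * real I + 2) * \<gamma>"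
    using \<open>\<not> free e\<close> unfolding free_def by (auto simp: not_less)
  \<comment> \<open>The first exit from the arc at \<open>a\<close> under repeated shifts by
    \<open>e'\<close>. Before it, both the path from \<theta> and its translate by \<open>e\<close>
    avoid the arc at \<open>b\<close>, so each shift changes the values of \<open>x\<close> along
    both by less than \<open>2 * \<gamma>\<close>; at the exit the shift by \<open>e\<close> itself
    is harmless.\<close>
  define n where "n = (LEAST i. \<not> in_arc a (\<theta> + int i * e'))"
  obtain i where i: "i \<le> I" "\<not> in_arc a (\<theta> + int i * e')" using leaves_arc[OF \<open>\<not> slow e'\<close>] by blast
  have n: "\<not> in_arc a (\<theta> + int n * e')" "n \<le> I"
    using LeastI[of "\<lambda>i. \<not> in_arc a (\<theta> + int i * e')", OF i(2)]
      Least_le[of "\<lambda>i. \<not> in_arc a (\<theta> + int i * e')", OF i(2)] i(1) unfolding n_def by auto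
  have before: "in_arc a (\<theta> + int l * e')" if "l < n" for l
    using not_less_Least that unfolding n_def by blast
  have 1: "dist (x (\<theta> + int l * e')) (x \<theta>) \<le> 2 * real l * \<gamma>" if "l \<le> n" for l
    using that
  proof (induction l)
    case (Suc l)
    have "dist (x (\<theta> + int l * e' + e')) (x (\<theta> + int l * e')) < 2 * \<gamma>"
      using b disj[OF before[of l]] Suc.prems unfolding shift_off_arc_def by auto
    moreover have "\<theta> + int (Suc l) * e' = \<theta> + int l * e' + e'" by (simp add: algebra_simps)
    ultimately show ?case
      using Suc dist_triangle[of "x (\<theta> + int (Suc l) * e')" "x \<theta>" "x (\<theta> + int l * e')"]
      by (simp add: algebra_simps)
  qed auto
  have 2: "dist (x (\<theta> + int l * e' + e)) (x (\<theta> + e)) \<le> 2 * real l * \<gamma>" if "l \<le> n" for l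
    using that
  proof (induction l)
    case (Suc l)
    have "dist (x (\<theta> + int l * e' + e + e')) (x (\<theta> + int l * e' + e)) < 2 * \<gamma>"
      using b disj'[OF before[of l]] Suc.prems unfolding shift_off_arc_def by auto
    moreover have "\<theta> + int (Suc l) * e' + e = \<theta> + int l * e' + e + e'" by (simp add: algebra_simps)
    ultimately show ?case
      using Suc dist_triangle[of "x (\<theta> + int (Suc l) * e' + e)" "x (\<theta> + e)" "x (\<theta> + int l * e' + e)"]
      by (simp add: algebra_simps)
  qed auto
  have 3: "dist (x (\<theta> + int n * e' + e)) (x (\<theta> + int n * e')) < 2 * \<gamma>"
    using a n unfolding shift_off_arc_def by blast
  have "dist (x (\<theta> + e)) (x \<theta>) < 2 * real n * \<gamma> + 2 * \<gamma> + 2 * real n * \<gamma>"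
    using 1[of n] 2[of n] 3
      dist_triangle[of "x (\<theta> + e)" "x \<theta>" "x (\<theta> + int n * e')"]
      dist_triangle[of "x (\<theta> + e)" "x (\<theta> + int n * e')" "x (\<theta> + int n * e' + e)"]
    using dist_commute[of "x (\<theta> + e)" "x (\<theta> + int n * e' + e)"]
      dist_commute[of "x (\<theta> + int n * e' + e)" "x (\<theta> + int n * e')"] by linarith
  also have "\<dots> = (4 * real n + 2) * \<gamma>" by (simp add: algebra_simps)
  also have "\<dots> \<le> (4 * real I + 2) * \<gamma>" using n \<gamma>_pos by (intro mult_right_mono) auto
  finally show False using \<theta> by simp
qed

section \<open>Clustering of the bad phases\<close>

definition near :: "int \<Rightarrow> int \<Rightarrow> bool" where
  "near a b \<longleftrightarrow> (\<exists>k. \<bar>a - b + k * p\<bar> < 2 * int \<tau>)"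

lemma in_arc_iff: "in_arc a \<theta> \<longleftrightarrow> (\<exists>k j. \<theta> = a + j + k * p \<and> 0 \<le> j \<and> j < int \<tau>)"
proof
  assume "in_arc a \<theta>"
  moreover have "\<theta> = a + (\<theta> - a) mod p + (\<theta> - a) div p * p"
    by (metis add.assoc add_diff_cancel_left' diff_add_cancel mod_div_mult_eq)
  ultimately show "\<exists>k j. \<theta> = a + j + k * p \<and> 0 \<le> j \<and> j < int \<tau>"
    unfolding in_arc_def using p_pos by (metis pos_mod_sign)
next
  assume "\<exists>k j. \<theta> = a + j + k * p \<and> 0 \<le> j \<and> j < int \<tau>"
  then obtain k j where "\<theta> = a + j + k * p" "0 \<le> j" "j < int \<tau>" by blast
  then show "in_arc a \<theta>" unfolding in_arc_def using \<tau>_le by (simp add: add.commute mod_pos_pos_trivial)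
qed

lemma arcs_meet_near: "in_arc a \<theta> \<Longrightarrow> in_arc b \<theta> \<Longrightarrow> near a b"
proof -
  assume "in_arc a \<theta>" "in_arc b \<theta>"
  then obtain k j k' j' where *: "\<theta> = a + j + k * p" "0 \<le> j" "j < int \<tau>"
      "\<theta> = b + j' + k' * p" "0 \<le> j'" "j' < int \<tau>" unfolding in_arc_iff by blast
  then have "a - b + (k - k') * p = j' - j" by (simp add: algebra_simps)
  then show ?thesis unfolding near_def using * by (intro exI[of _ "k - k'"]) linarith
qed

text \<open>If the phase of \<open>t\<close> is far from the other two, then by
  \<open>shifted_arcs_meet\<close> the arc at \<open>\<phi> t\<close>, moved by
  \<open>jump t\<close>, meets the arcs at both other phases. Two arcs met by a third differ in
  position by less than \<open>2 * \<tau>\<close>, which explains the threshold in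
  \<open>near\<close>.\<close>

lemma bad_near:
  assumes "bad t" "bad t'" "bad t''"
  shows "near (\<phi> t) (\<phi> t') \<or> near (\<phi> t) (\<phi> t'') \<or> near (\<phi> t') (\<phi> t'')"
proof (rule ccontr)
  assume far: "\<not> ?thesis"
  have sh: "shift_off_arc (\<phi> s) (jump s)" if "bad s" for s
    using that shift_off_arc_jump unfolding bad_def by blast
  have "\<exists>\<theta>. in_arc (\<phi> t) \<theta> \<and> in_arc (\<phi> s) (\<theta> + jump t)" if "bad s" "\<not> near (\<phi> t) (\<phi> s)" for s
    using that assms(1) arcs_meet_near
    by (intro shifted_arcs_meet[OF sh sh, of t s]) (auto simp: bad_def)
  with assms far obtain \<theta> \<theta>' where
    *: "in_arc (\<phi> t) \<theta>" "in_arc (\<phi> t') (\<theta> + jump t)" "in_arc (\<phi> t) \<theta>'" "in_arc (\<phi> t'') (\<theta>' + jump t)"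
    by meson
  then obtain k1 j1 k2 j2 k3 j3 k4 j4 where
    "\<theta> = \<phi> t + j1 + k1 * p" "\<theta> + jump t = \<phi> t' + j2 + k2 * p"
    "\<theta>' = \<phi> t + j3 + k3 * p" "\<theta>' + jump t = \<phi> t'' + j4 + k4 * p"
    and j: "0 \<le> j1" "j1 < int \<tau>" "0 \<le> j2" "j2 < int \<tau>" "0 \<le> j3" "j3 < int \<tau>" "0 \<le> j4" "j4 < int \<tau>"
    unfolding in_arc_iff by metis
  then have "\<phi> t' - \<phi> t'' + (k2 - k4 - k1 + k3) * p = j1 - j2 - j3 + j4" by (simp add: algebra_simps)
  then have "near (\<phi> t') (\<phi> t'')" unfolding near_def
    using j by (intro exI[of _ "k2 - k4 - k1 + k3"]) linarith
  then show False using far by blast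
qed

lemma card_near: "finite {r. 0 \<le> r \<and> r < p \<and> near a r}" "card {r. 0 \<le> r \<and> r < p \<and> near a r} \<le> 4 * \<tau>"
proof -
  have sub: "{r. 0 \<le> r \<and> r < p \<and> near a r} \<subseteq> (\<lambda>k. (a + k) mod p) ` {- 2 * int \<tau>..<2 * int \<tau>}"
  proof
    fix r assume "r \<in> {r. 0 \<le> r \<and> r < p \<and> near a r}"
    then obtain k where r: "0 \<le> r" "r < p" "\<bar>a - r + k * p\<bar> < 2 * int \<tau>" unfolding near_def by blast
    define d where "d = r - a - k * p"
    have "(a + d) mod p = (r + (- k) * p) mod p" unfolding d_def by (simp add: algebra_simps)
    also have "\<dots> = r" using r by (simp only: mod_mult_self1) simp
    finally have "r = (a + d) mod p" by simp
    moreover have "d \<in> {- 2 * int \<tau>..<2 * int \<tau>}" using r unfolding d_def by auto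
    ultimately show "r \<in> (\<lambda>k. (a + k) mod p) ` {- 2 * int \<tau>..<2 * int \<tau>}" by blast
  qed
  then show "finite {r. 0 \<le> r \<and> r < p \<and> near a r}" by (rule finite_subset) simp
  have "card {r. 0 \<le> r \<and> r < p \<and> near a r} \<le> card ((\<lambda>k. (a + k) mod p) ` {- 2 * int \<tau>..<2 * int \<tau>})"
    by (intro card_mono sub) simp
  also have "\<dots> \<le> card {- 2 * int \<tau>..<2 * int \<tau>}" by (rule card_image_le) simp
  finally show "card {r. 0 \<le> r \<and> r < p \<and> near a r} \<le> 4 * \<tau>" by simp
qed

lemma near_mod: "near a b \<Longrightarrow> near a (b mod p)"
proof -
  assume "near a b"
  then obtain k where k: "\<bar>a - b + k * p\<bar> < 2 * int \<tau>" unfolding near_def by blast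
  have "a - b mod p + (k - b div p) * p = a - (b div p * p + b mod p) + k * p" by (simp add: algebra_simps)
  also have "\<dots> = a - b + k * p" by simp
  finally show ?thesis using k unfolding near_def by metis
qed

text \<open>Two bad phases that are not near each other, if there are any, have neighbourhoods
  covering all bad phases; otherwise one neighbourhood does. Each has at most
  \<open>4 * \<tau>\<close> residues.\<close>

lemma card_bad_phases: "finite ((\<lambda>t. \<phi> t mod p) ` Collect bad)" "card ((\<lambda>t. \<phi> t mod p) ` Collect bad) \<le> 8 * \<tau>"
proof -
  let ?N = "\<lambda>t. {r. 0 \<le> r \<and> r < p \<and> near (\<phi> t) r}"
  have "\<exists>t t'. (\<lambda>t. \<phi> t mod p) ` Collect bad \<subseteq> ?N t \<union> ?N t'"
  proof (cases "\<exists>t t'. bad t \<and> bad t' \<and> \<not> near (\<phi> t) (\<phi> t')")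
    case True
    then obtain t t' where "bad t" "bad t'" "\<not> near (\<phi> t) (\<phi> t')" by blast
    then have "(\<lambda>t. \<phi> t mod p) ` Collect bad \<subseteq> ?N t \<union> ?N t'"
      using bad_near[of t t'] near_mod p_pos by (force simp: image_subset_iff)
    then show ?thesis by blast
  next
    case False
    show ?thesis
    proof (cases "\<exists>t. bad t")
      case True
      then obtain t where "bad t" by blast
      then have "(\<lambda>t. \<phi> t mod p) ` Collect bad \<subseteq> ?N t"
        using False near_mod p_pos by (force simp: image_subset_iff)
      then show ?thesis by blast
    next
      case False
      then show ?thesis by blast
    qed
  qed
  then obtain t t' where sub: "(\<lambda>t. \<phi> t mod p) ` Collect bad \<subseteq> ?N t \<union> ?N t'" by blast
  have fin: "finite (?N t \<union> ?N t')" using card_near(1) by simp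
  show "finite ((\<lambda>t. \<phi> t mod p) ` Collect bad)" using sub fin by (rule finite_subset)
  have "card ((\<lambda>t. \<phi> t mod p) ` Collect bad) \<le> card (?N t \<union> ?N t')" using sub fin by (rule card_mono[rotated])
  also have "\<dots> \<le> card (?N t) + card (?N t')" by (rule card_Un_le)
  also have "\<dots> \<le> 8 * \<tau>" using card_near(2)[of "\<phi> t"] card_near(2)[of "\<phi> t'"] by simp
  finally show "card ((\<lambda>t. \<phi> t mod p) ` Collect bad) \<le> 8 * \<tau>" .
qed

end

section \<open>Matchings\<close>

text \<open>The index types differ because naturals are matched with integers. In linear orders the
  equivalence in \<open>order_matching\<close> makes \<open>Q\<close> the graph of an injective
  partial map. The bound \<open>k\<close> is real and may be negative, so that error terms can be
  subtracted freely.\<close>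

definition has_match ::
    "real \<Rightarrow> ('b::linorder \<Rightarrow> 'a::metric_space) \<Rightarrow> ('c::linorder \<Rightarrow> 'a) \<Rightarrow> 'b set \<Rightarrow> 'c set \<Rightarrow> real \<Rightarrow> bool" where
  "has_match \<delta> u v A B k \<longleftrightarrow>
     (\<exists>Q. Q \<subseteq> A \<times> B \<and> order_matching Q \<and> (\<forall>(i, j)\<in>Q. dist (u i) (v j) < \<delta>) \<and> k \<le> real (card Q))"

lemma has_match_empty: "k \<le> 0 \<Longrightarrow> has_match \<delta> u v A B k"
  unfolding has_match_def order_matching_def by (rule exI[of _ "{}"]) simp

lemma has_match_mono:
  assumes "has_match \<delta> u v A B k" "\<delta> \<le> \<delta>'" "A \<subseteq> A'" "B \<subseteq> B'" "k' \<le> k"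
  shows "has_match \<delta>' u v A' B' k'"
proof -
  obtain Q where "Q \<subseteq> A \<times> B" "order_matching Q" "\<forall>(i, j)\<in>Q. dist (u i) (v j) < \<delta>" "k \<le> real (card Q)"
    using assms(1) unfolding has_match_def by blast
  then show ?thesis unfolding has_match_def using assms(2-) by (intro exI[of _ Q]) fastforce
qed

lemma has_match_Un:
  assumes 1: "has_match \<delta> u v A B k" and 2: "has_match \<delta> u v A' B' k'"
    and fin: "finite A" "finite B" "finite A'" "finite B'"
    and A: "\<And>i i'. i \<in> A \<Longrightarrow> i' \<in> A' \<Longrightarrow> i < i'" and B: "\<And>j j'. j \<in> B \<Longrightarrow> j' \<in> B' \<Longrightarrow> j < j'"
  shows "has_match \<delta> u v (A \<union> A') (B \<union> B') (k + k')"
proof -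
  obtain Q where Q: "Q \<subseteq> A \<times> B" "order_matching Q" "\<forall>(i, j)\<in>Q. dist (u i) (v j) < \<delta>" "k \<le> real (card Q)"
    using 1 unfolding has_match_def by blast
  obtain Q' where Q': "Q' \<subseteq> A' \<times> B'" "order_matching Q'" "\<forall>(i, j)\<in>Q'. dist (u i) (v j) < \<delta>" "k' \<le> real (card Q')"
    using 2 unfolding has_match_def by blast
  have finQ: "finite Q" "finite Q'" using Q(1) Q'(1) fin by (meson finite_SigmaI finite_subset)+
  have "Q \<inter> Q' = {}" using Q(1) Q'(1) A by fastforce
  then have "card (Q \<union> Q') = card Q + card Q'" using finQ by (simp add: card_Un_disjoint)
  moreover have "order_matching (Q \<union> Q')"
    unfolding order_matching_def
  proof (intro ballI, clarify)
    fix i j i' j' assume *: "(i, j) \<in> Q \<union> Q'" "(i', j') \<in> Q \<union> Q'"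
    consider "(i, j) \<in> Q" "(i', j') \<in> Q" | "(i, j) \<in> Q'" "(i', j') \<in> Q'"
      | "(i, j) \<in> Q" "(i', j') \<in> Q'" | "(i, j) \<in> Q'" "(i', j') \<in> Q" using * by blast
    then show "i < i' \<longleftrightarrow> j < j'"
    proof cases
      case 1 then show ?thesis using Q(2) unfolding order_matching_def by blast
    next
      case 2 then show ?thesis using Q'(2) unfolding order_matching_def by blast
    next
      case 3 then have "i < i'" "j < j'" using Q(1) Q'(1) A B by blast+
      then show ?thesis by simp
    next
      case 4 then have "i' < i" "j' < j" using Q(1) Q'(1) A B by blast+
      then show ?thesis by (metis order.asym)
    qed
  qed
  ultimately show ?thesis
    unfolding has_match_def using Q Q' by (intro exI[of _ "Q \<union> Q'"]) auto
qed

lemma has_match_sym: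
  assumes "has_match \<delta> u v A B k"
  shows "has_match \<delta> v u B A k"
proof -
  obtain Q where Q: "Q \<subseteq> A \<times> B" "order_matching Q" "\<forall>(i, j)\<in>Q. dist (u i) (v j) < \<delta>" "k \<le> real (card Q)"
    using assms unfolding has_match_def by blast
  have "order_matching (Q\<inverse>)" using Q(2) unfolding order_matching_def by fastforce
  moreover have "\<forall>(i, j)\<in>Q\<inverse>. dist (v i) (u j) < \<delta>" using Q(3) by (auto simp: dist_commute)
  moreover have "card (Q\<inverse>) = card Q" by (rule card_inverse)
  ultimately show ?thesis unfolding has_match_def using Q(1,4) by (intro exI[of _ "Q\<inverse>"]) auto
qed

text \<open>Scan \<open>u\<close> from the left: at a good index match a block and advance by
  \<open>N\<close> in \<open>u\<close> and by \<open>N'\<close> in \<open>v\<close>; at any other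
  index advance by one in \<open>u\<close> only. Both moves preserve
  \<open>m * N' \<le> l * N\<close>. The subtracted \<open>N\<close> pays for a remainder too short
  for a block.\<close>

lemma greedy_match:
  fixes u :: "nat \<Rightarrow> 'a::metric_space" and v :: "int \<Rightarrow> 'a"
  assumes block: "\<And>a b. good a \<Longrightarrow> has_match \<delta> u v {a..<a + N} {b..<b + int N'} k"
    and k: "0 \<le> k" and N: "N > 0" and len: "m * N' \<le> l * N"
  shows "has_match \<delta> u v {a..<a + m} {b..<b + int l}
    (k / N * (real m - real (card {t\<in>{a..<a + m}. \<not> good t}) - N))"
  using len
proof (induction m arbitrary: a b l rule: less_induct)
  case (less m)
  define c where "c a m = real (card {t\<in>{a..<a + m}. \<not> good t})" for a m :: nat
  have c_split: "c a (m + m') = c a m + c (a + m) m'" for a m m'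
  proof -
    have "{t\<in>{a..<a + (m + m')}. \<not> good t} = {t\<in>{a..<a + m}. \<not> good t} \<union> {t\<in>{a + m..<a + m + m'}. \<not> good t}"
      by auto
    moreover have "{t\<in>{a..<a + m}. \<not> good t} \<inter> {t\<in>{a + m..<a + m + m'}. \<not> good t} = {}" by auto
    ultimately show ?thesis unfolding c_def by (simp add: card_Un_disjoint)
  qed
  have c_nn: "c a m \<ge> 0" for a m unfolding c_def by simp
  show ?case
  proof (cases "m < N")
    case True
    then have "real m - c a m - N \<le> 0" using c_nn[of a m] by simp
    then have "k / N * (real m - c a m - N) \<le> 0" using k N by (intro mult_nonneg_nonpos) auto
    then show ?thesis using has_match_empty unfolding c_def by blast
  next
    case False
    show ?thesis
    proof (cases "good a")
      case True
      have "N * N' \<le> m * N'" using False by (intro mult_right_mono) auto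
      also note less.prems
      finally have "N' * N \<le> l * N" by (simp only: mult.commute)
      then have l: "N' \<le> l" using N by simp
      have "(m - N) * N' \<le> (l - N') * N"
        unfolding diff_mult_distrib using less.prems by (simp only: mult.commute[of N N'] diff_le_mono)
      from less.IH[OF _ this, of "a + N" "b + int N'"] N False
      have "has_match \<delta> u v {a + N..<a + m} {b + int N'..<b + int l}
          (k / N * (real (m - N) - c (a + N) (m - N) - N))" using l by (simp add: c_def)
      from has_match_Un[OF block[OF True, of b] this]
      have "has_match \<delta> u v ({a..<a + N} \<union> {a + N..<a + m}) ({b..<b + int N'} \<union> {b + int N'..<b + int l})
          (k + k / N * (real (m - N) - c (a + N) (m - N) - N))" by simp
      moreover have "k / N * (real m - c a m - N) \<le> k + k / N * (real (m - N) - c (a + N) (m - N) - N)"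
      proof -
        have "c a m \<ge> c (a + N) (m - N)" using c_split[of a N "m - N"] c_nn[of a N] False by simp
        then have "k / N * (real m - c a m - N) \<le> k / N * (N + (real (m - N) - c (a + N) (m - N) - N))"
          using k False by (intro mult_left_mono) auto
        also have "\<dots> = k + k / N * (real (m - N) - c (a + N) (m - N) - N)"
          using N by (simp add: field_simps)
        finally show ?thesis .
      qed
      ultimately show ?thesis
        using False l unfolding c_def by (elim has_match_mono) auto
    next
      case bad: False
      have "(m - 1) * N' \<le> l * N"
        using less.prems by (meson diff_le_self le_trans mult_le_mono1)
      from less.IH[OF _ this, of "a + 1" b] N False
      have "has_match \<delta> u v {a + 1..<a + m} {b..<b + int l} (k / N * (real (m - 1) - c (a + 1) (m - 1) - N))"
        by (simp add: c_def)
      moreover have c1: "c a m = 1 + c (a + 1) (m - 1)"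
      proof -
        have "{t\<in>{a..<a + 1}. \<not> good t} = {a}" using bad by auto
        then show ?thesis using c_split[of a 1 "m - 1"] N False by (simp add: c_def)
      qed
      have "real m - c a m - N = real (m - 1) - c (a + 1) (m - 1) - N" using c1 N False by simp
      then have "k / N * (real m - c a m - N) = k / N * (real (m - 1) - c (a + 1) (m - 1) - N)"
        by (simp only:)
      ultimately show ?thesis
        unfolding c_def by (elim has_match_mono) auto
    qed
  qed
qed

section \<open>Counting along periodic sequences\<close>

lemma sum_periodic_window:
  fixes f :: "nat \<Rightarrow> 'b::ab_group_add"
  assumes "\<And>t. f (t + q) = f t"
  shows "sum f {a..<a + q} = sum f {..<q}"
proof (induction a)
  case (Suc a)
  have "sum f {a..<Suc (a + q)} = f a + sum f {Suc a..<Suc (a + q)}"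
    by (rule sum.atLeast_Suc_lessThan) simp
  moreover have "sum f {a..<Suc (a + q)} = sum f {a..<a + q} + f (a + q)" by simp
  ultimately show ?case using Suc assms by (simp add: add.commute)
qed (simp add: lessThan_atLeast0)

lemma card_periodic_window:
  fixes P :: "nat \<Rightarrow> bool"
  assumes "\<And>t. P (t + q) \<longleftrightarrow> P t"
  shows "card {t\<in>{a..<a + q}. P t} = card {t\<in>{..<q}. P t}"
proof -
  have *: "int (card {t\<in>A. P t}) = (\<Sum>t\<in>A. of_bool (P t))" if "finite A" for A

  proof -
    have "A \<inter> {t. P t} = {t\<in>A. P t}" by auto
    then show ?thesis using that by simp
  qed
  have "int (card {t\<in>{a..<a + q}. P t}) = int (card {t\<in>{..<q}. P t})"
    unfolding *[OF finite_atLeastLessThan] *[OF finite_lessThan]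
    by (rule sum_periodic_window) (simp add: assms)
  then show ?thesis by simp
qed

lemma card_windows_le:
  fixes P :: "nat \<Rightarrow> bool"
  assumes "\<And>a. card {t\<in>{a..<a + q}. P t} \<le> c" "q > 0"
  shows "card {t\<in>{a..<a + m}. P t} \<le> (m div q + 1) * c"
proof -
  have "{t\<in>{a..<a + m}. P t} \<subseteq> (\<Union>i\<le>m div q. {t\<in>{a + i * q..<a + i * q + q}. P t})"
  proof
    fix t assume t: "t \<in> {t\<in>{a..<a + m}. P t}"
    have "(t - a) div q \<le> m div q" using t by (intro div_le_mono) auto
    moreover have "t - a = (t - a) div q * q + (t - a) mod q" by simp
    then have "t \<in> {a + (t - a) div q * q..<a + (t - a) div q * q + q}"
      using t mod_less_divisor[OF assms(2), of "t - a"]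
      by (simp only: atLeastLessThan_iff mem_Collect_eq) linarith
    ultimately show "t \<in> (\<Union>i\<le>m div q. {t\<in>{a + i * q..<a + i * q + q}. P t})" using t by blast
  qed
  then have "card {t\<in>{a..<a + m}. P t} \<le> card (\<Union>i\<le>m div q. {t\<in>{a + i * q..<a + i * q + q}. P t})"
    by (intro card_mono) auto
  also have "\<dots> \<le> (\<Sum>i\<le>m div q. card {t\<in>{a + i * q..<a + i * q + q}. P t})" by (intro card_UN_le) auto
  also have "\<dots> \<le> (\<Sum>i\<le>m div q. c)" by (intro sum_mono assms(1))
  finally show ?thesis by simp
qed

section \<open>Matching a single block\<close>

context shadowing
begin

text \<open>Among \<open>p\<close> consecutive positions the residues are distinct, and only \<tau>
  residues lie in the arc.\<close>

lemma card_in_arc: "card {v\<in>{b..<b + m}. in_arc a (d + int v)} \<le> (m div nat p + 1) * \<tau>"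
proof (rule card_windows_le)
  fix b
  let ?f = "\<lambda>v. (d + int v - a) mod p"
  have "inj_on ?f {v\<in>{b..<b + nat p}. in_arc a (d + int v)}"
  proof (rule inj_onI)
    fix v w assume *: "v \<in> {v\<in>{b..<b + nat p}. in_arc a (d + int v)}" "w \<in> {v\<in>{b..<b + nat p}. in_arc a (d + int v)}"
      "?f v = ?f w"
    then have "p dvd (d + int v - a) - (d + int w - a)" by (simp only: mod_eq_dvd_iff)
    then have dvd: "p dvd int v - int w" by simp
    have "\<bar>int v - int w\<bar> < p" using * by auto
    then have "int v - int w = 0" using dvd dvd_imp_le_int[of "int v - int w" p] p_pos by linarith
    then show "v = w" by simp
  qed
  moreover have "?f ` {v\<in>{b..<b + nat p}. in_arc a (d + int v)} \<subseteq> {0..<int \<tau>}"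
    using p_pos unfolding in_arc_def by auto
  ultimately have "card {v\<in>{b..<b + nat p}. in_arc a (d + int v)} \<le> card {0..<int \<tau>}"
    by (intro card_inj_on_le) auto
  then show "card {v\<in>{b..<b + nat p}. in_arc a (d + int v)} \<le> \<tau>" by simp
qed (use p_pos in simp)

text \<open>Within a block of \<open>L\<close> steps the matched position follows the slow jumps of the phase; the
  other jumps are ignored: a free one moves no point far, a bad one spoils only an arc of length
  \<open>\<tau>\<close> in every period.\<close>
lemma block_match:
  assumes \<Delta>: "\<And>i. i \<le> L \<Longrightarrow> a + i * \<tau> \<in> \<Delta>"
    and bads: "card {i. i < L \<and> bad (a + i * \<tau>)} \<le> B"
    and s0: "p dvd \<phi> a - s0" and \<sigma>: "\<sigma> \<le> \<tau>"
    and \<delta>: "(real L * (4 * real I + 2) + 1) * \<gamma> \<le> \<delta>"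
  shows "has_match \<delta> y x {a..<a + L * \<tau>} {s0..<s0 + int (L * (\<tau> + \<sigma>))}
    (real L * (real \<tau> - real \<sigma>) - real B * real ((L * (\<tau> + \<sigma>) div nat p + 1) * \<tau>))"
proof -
  define t where "t i = a + i * \<tau>" for i
  define W where "W = L * (\<tau> + \<sigma>)"
  \<comment> \<open>A slow jump is followed by its small representative; for any other jump the
    default \<open>0\<close> lets the matched position simply advance by \<tau>.\<close>
  define r where "r i = (if slow (jump (t i)) then SOME r. \<bar>r\<bar> \<le> int \<sigma> \<and> p dvd jump (t i) - r else 0)" for i
  have r_slow: "\<bar>r i\<bar> \<le> int \<sigma> \<and> p dvd jump (t i) - r i" if "slow (jump (t i))" for i
    using someI_ex[OF that[unfolded slow_def]] that unfolding r_def by simp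
  have r_le: "\<bar>r i\<bar> \<le> int \<sigma>" for i 
    using r_slow[of i] by (cases "slow (jump (t i))") (simp_all add: r_def)
  define s where "s i = s0 + int i * int \<tau> + (\<Sum>l<i. r l)" for i
  have s_0: "s 0 = s0" and s_Suc: "s (Suc i) = s i + int \<tau> + r i" for i
    unfolding s_def by (simp_all add: algebra_simps)
  \<comment> \<open>The discrepancy between the true phase and the matched position. It is a
    multiple of \<open>p\<close> at the start, and every ignored jump is added to it.\<close>
  define D where "D i = \<phi> (t i) - s i" for i
  have D_Suc: "D (Suc i) = D i + jump (t i) - r i" for i
    unfolding D_def s_Suc jump_def t_def by (simp add: algebra_simps)
  \<comment> \<open>The offsets \<open>v\<close> for which the point \<open>s0 + v + D l\<close>,
    about to be shifted by the \<open>l\<close>-th jump, lies in the exceptional arc of a bad jump.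
    At most \<open>B\<close> values of \<open>l\<close> contribute.\<close>
  define U where "U = {v\<in>{0..<0 + W}. \<exists>l\<in>{l. l < L \<and> bad (t l)}. in_arc (\<phi> (t l)) (s0 + D l + int v)}"
  have U: "card U \<le> B * ((W div nat p + 1) * \<tau>)"
  proof -
    have fin: "finite {l. l < L \<and> bad (t l)}" by simp
    have "U = (\<Union>l\<in>{l. l < L \<and> bad (t l)}. {v\<in>{0..<0 + W}. in_arc (\<phi> (t l)) (s0 + D l + int v)})"
      unfolding U_def by auto
    then have "card U \<le> (\<Sum>l\<in>{l. l < L \<and> bad (t l)}. card {v\<in>{0..<0 + W}. in_arc (\<phi> (t l)) (s0 + D l + int v)})"
      by (simp only: card_UN_le[OF fin])
    also have "\<dots> \<le> (\<Sum>l\<in>{l. l < L \<and> bad (t l)}. (W div nat p + 1) * \<tau>)"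
    proof (rule sum_mono)
      fix l
      show "card {v\<in>{0..<0 + W}. in_arc (\<phi> (t l)) (s0 + D l + int v)} \<le> (W div nat p + 1) * \<tau>"
        by (rule card_in_arc[of 0 W "\<phi> (t l)" "s0 + D l"])
    qed
    also have "\<dots> = card {l. l < L \<and> bad (t l)} * ((W div nat p + 1) * \<tau>)" by simp
    also have "\<dots> \<le> B * ((W div nat p + 1) * \<tau>)" using bads unfolding t_def by (rule mult_le_mono1)
    finally show ?thesis .
  qed
  have finU: "finite U" unfolding U_def by simp
  \<comment> \<open>The displacement is bounded one jump at a time: a slow jump changes
    \<open>D\<close> by a multiple of \<open>p\<close>, a free one moves every point by less than
    the constant in \<open>free\<close>, and a bad one moves the points with offset outside
    \<open>U\<close> by less than \<open>2 * \<gamma>\<close>.\<close>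
  have drift: "dist (x (u + D i)) (x u) \<le> real i * ((4 * real I + 2) * \<gamma>)"
    if u: "u = s0 + int v" "v < W" "v \<notin> U" and "i \<le> L" for u v i
    using \<open>i \<le> L\<close>
  proof (induction i)
    case 0
    have "x (u + D 0) = x u" using s0 by (intro x_cong) (simp add: D_def s_0 t_def)
    then show ?case by simp
  next
    case (Suc l)
    have "dist (x (u + D (Suc l))) (x (u + D l)) \<le> (4 * real I + 2) * \<gamma>"
    proof (cases "slow (jump (t l))")
      case True
      have "x (u + D (Suc l)) = x (u + D l)"
        using r_slow[OF True] by (intro x_cong) (simp add: D_Suc)
      then show ?thesis using \<gamma>_pos by simp
    next
      case not_slow: False
      then have r0: "u + D (Suc l) = u + D l + jump (t l)" unfolding D_Suc r_def by simp
      show ?thesis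
      proof (cases "free (jump (t l))")
        case True
        then show ?thesis unfolding r0 free_def by (simp add: less_imp_le)
      next
        case False
        have \<Delta>l: "t l \<in> \<Delta>" "t l + \<tau> \<in> \<Delta>"
          using \<Delta>[of l] \<Delta>[of "Suc l"] Suc.prems unfolding t_def by (simp_all add: algebra_simps)
        with False not_slow have "bad (t l)" unfolding bad_def by simp
        then have "\<not> in_arc (\<phi> (t l)) (u + D l)"
          using u Suc.prems unfolding U_def by (auto simp: algebra_simps)
        then have "dist (x (u + D l + jump (t l))) (x (u + D l)) < 2 * \<gamma>"
          using shift_off_arc_jump[OF \<Delta>l] unfolding shift_off_arc_def by blast
        also have "\<dots> \<le> (4 * real I + 2) * \<gamma>" using \<gamma>_pos by (intro mult_right_mono) auto
        finally show ?thesis unfolding r0 by simp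
      qed
    qed
    then show ?case
      using Suc dist_triangle[of "x (u + D (Suc l))" "x u" "x (u + D l)"] by (simp add: algebra_simps)
  qed
  have s_ge: "s (Suc i) \<ge> s i + int (\<tau> - \<sigma>)" for i
    using r_le[of i] \<sigma> unfolding s_Suc by (simp add: of_nat_diff)
  have s_mono: "i \<le> j \<Longrightarrow> s i \<le> s j" for i j
  proof (rule lift_Suc_mono_le[of s])
    show "s n \<le> s (Suc n)" for n using s_ge[of n] by linarith
  qed
  have s_le: "s i \<le> s0 + int i * int (\<tau> + \<sigma>)" for i
  proof (induction i)
    case (Suc i)
    then show ?case using r_le[of i] unfolding s_Suc by (simp add: algebra_simps)
  qed (simp add: s_0)
  \<comment> \<open>Consecutive positions \<open>s i\<close> may be only
    \<open>\<tau> - \<sigma>\<close> apart. Matching no more than that many indices of each step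
    keeps the images disjoint and in order.\<close>
  define P where "P = {..<L} \<times> {..<\<tau> - \<sigma>}"
  define f where "f ij = (t (fst ij) + snd ij)" for ij
  define g where "g ij = (s (fst ij) + int (snd ij))" for ij
  define lex where "lex ij kl \<longleftrightarrow> fst ij < fst kl \<or> fst ij = fst kl \<and> snd ij < snd kl" for ij kl :: "nat \<times> nat"
  have lex: "f ij < f kl \<and> g ij < g kl" if "ij \<in> P" "kl \<in> P" "lex ij kl" for ij kl
  proof (cases "fst ij = fst kl")
    case True then show ?thesis using that unfolding lex_def f_def g_def by simp
  next
    case False
    then have less: "fst ij < fst kl" using that unfolding lex_def by simp
    have "Suc (fst ij) * \<tau> \<le> fst kl * \<tau>" using less by (intro mult_right_mono) auto
    moreover have "s (Suc (fst ij)) \<le> s (fst kl)" using less by (intro s_mono) simp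
    ultimately show ?thesis
      using that s_ge[of "fst ij"] unfolding P_def f_def g_def t_def by auto
  qed
  have trich: "lex ij kl \<or> ij = kl \<or> lex kl ij" for ij kl
    unfolding lex_def by (cases ij; cases kl) auto
  have g_range: "s0 \<le> g ij" "g ij < s0 + int W" if "ij \<in> P" for ij
  proof -
    have "s0 \<le> s (fst ij)" using s_mono[of 0 "fst ij"] s_0 by simp
    then show "s0 \<le> g ij" unfolding g_def by simp
    define z where "z = fst ij * (\<tau> + \<sigma>)"
    have "s (fst ij) \<le> s0 + int z" using s_le[of "fst ij"] unfolding z_def by simp
    moreover have "Suc (fst ij) * (\<tau> + \<sigma>) \<le> W" using that unfolding W_def P_def by (intro mult_right_mono) auto
    then have "\<tau> + \<sigma> + z \<le> W" unfolding z_def by simp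
    moreover have "snd ij < \<tau> - \<sigma>" using that unfolding P_def by auto
    ultimately show "g ij < s0 + int W" unfolding g_def by linarith
  qed
  define G where "G = {ij\<in>P. nat (g ij - s0) \<notin> U}"
  define Q where "Q = (\<lambda>ij. (f ij, g ij)) ` G"
  have fin: "finite P" unfolding P_def by simp
  have inj: "inj_on g P"
  proof (rule inj_onI)
    fix ij kl assume "ij \<in> P" "kl \<in> P" "g ij = g kl"
    then show "ij = kl" using lex[of ij kl] lex[of kl ij] trich[of ij kl] by auto
  qed
  have "card (P - G) \<le> card U"
  proof (rule card_inj_on_le)
    show "inj_on (\<lambda>ij. nat (g ij - s0)) (P - G)"
    proof (rule inj_onI)
      fix ij kl assume "ij \<in> P - G" "kl \<in> P - G" "nat (g ij - s0) = nat (g kl - s0)"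
      then have "g ij = g kl" using g_range(1)[of ij] g_range(1)[of kl] by auto
      then show "ij = kl" using inj \<open>ij \<in> P - G\<close> \<open>kl \<in> P - G\<close> unfolding inj_on_def by blast
    qed
    show "(\<lambda>ij. nat (g ij - s0)) ` (P - G) \<subseteq> U" unfolding G_def by auto
  qed (rule finU)
  moreover have "card P = card G + card (P - G)"
  proof -
    have "G \<subseteq> P" unfolding G_def by auto
    then show ?thesis using fin by (metis card_Diff_subset card_mono finite_subset le_add_diff_inverse)
  qed
  moreover have "card Q = card G"
    unfolding Q_def
  proof (rule card_image)
    have "inj_on g G" using inj unfolding G_def by (rule inj_on_subset) auto
    then show "inj_on (\<lambda>ij. (f ij, g ij)) G" unfolding inj_on_def by blast
  qed
  moreover have "real (card P) = real L * (real \<tau> - real \<sigma>)" unfolding P_def using \<sigma> by (simp add: of_nat_diff)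
  ultimately have card: "real L * (real \<tau> - real \<sigma>) - real (card U) \<le> real (card Q)" by linarith
  show ?thesis
    unfolding has_match_def
  proof (intro exI[of _ Q] conjI)
    show "Q \<subseteq> {a..<a + L * \<tau>} \<times> {s0..<s0 + int (L * (\<tau> + \<sigma>))}"
    proof
      fix e assume "e \<in> Q"
      then obtain ij where ij: "ij \<in> P" "e = (f ij, g ij)" unfolding Q_def G_def by blast
      have "Suc (fst ij) * \<tau> \<le> L * \<tau>" using ij unfolding P_def by (intro mult_right_mono) auto
      then have "f ij \<in> {a..<a + L * \<tau>}" using ij unfolding f_def t_def P_def by auto
      moreover have "g ij \<in> {s0..<s0 + int (L * (\<tau> + \<sigma>))}" using g_range[OF ij(1)] unfolding W_def by auto
      ultimately show "e \<in> {a..<a + L * \<tau>} \<times> {s0..<s0 + int (L * (\<tau> + \<sigma>))}" using ij by simp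
    qed
    show "order_matching Q"
      unfolding order_matching_def
    proof (intro ballI, clarify)
      fix i j i' j' assume "(i, j) \<in> Q" "(i', j') \<in> Q"
      then obtain ij kl where "ij \<in> P" "kl \<in> P" and eq: "i = f ij" "j = g ij" "i' = f kl" "j' = g kl"
        unfolding Q_def G_def by blast
      then have "f ij < f kl \<and> g ij < g kl \<or> ij = kl \<or> f kl < f ij \<and> g kl < g ij"
        using lex trich by blast
      then show "i < i' \<longleftrightarrow> j < j'" unfolding eq by auto
    qed
    show "\<forall>(i, j)\<in>Q. dist (y i) (x j) < \<delta>"
    proof clarify
      fix i j assume "(i, j) \<in> Q"
      then obtain ij where ij: "ij \<in> G" "i = f ij" "j = g ij" unfolding Q_def by blast
      then have P: "ij \<in> P" unfolding G_def by simp
      have "fst ij \<le> L" using P unfolding P_def by auto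
      have v: "j = s0 + int (nat (j - s0))" "nat (j - s0) < W" "nat (j - s0) \<notin> U"
        using g_range[OF P] ij unfolding G_def by auto
      have "dist (x (j + D (fst ij))) (x j) \<le> real (fst ij) * ((4 * real I + 2) * \<gamma>)"
        by (rule drift[OF v]) fact
      also have "\<dots> \<le> real L * ((4 * real I + 2) * \<gamma>)"
        using \<gamma>_pos \<open>fst ij \<le> L\<close> by (intro mult_right_mono) auto
      finally have 1: "dist (x (j + D (fst ij))) (x j) \<le> real L * (4 * real I + 2) * \<gamma>" by (simp add: mult.assoc)
      have "j + D (fst ij) = \<phi> (t (fst ij)) + int (snd ij)" unfolding ij g_def D_def by simp
      moreover have "t (fst ij) \<in> \<Delta>" using \<Delta> P unfolding t_def P_def by auto
      moreover have "int (snd ij) < p" using P \<tau>_le unfolding P_def by auto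
      ultimately have 2: "dist (y i) (x (j + D (fst ij))) < \<gamma>"
        using shadow unfolding ij f_def by auto
      have "dist (y i) (x j) < \<gamma> + real L * (4 * real I + 2) * \<gamma>"
        using dist_triangle[of "y i" "x j" "x (j + D (fst ij))"] 1 2 by linarith
      also have "\<dots> \<le> \<delta>" using \<delta> by (simp add: algebra_simps)
      finally show "dist (y i) (x j) < \<delta>" .
    qed
    have "real (card U) \<le> real (B * ((W div nat p + 1) * \<tau>))" using U by (rule of_nat_mono)
    then show "real L * (real \<tau> - real \<sigma>) - real B * real ((L * (\<tau> + \<sigma>) div nat p + 1) * \<tau>) \<le> real (card Q)"
      using card unfolding W_def by simp
  qed
qed

end

lemma card_shift_periodic:
  fixes P :: "nat \<Rightarrow> bool"
  assumes "\<And>t. P (t + q) \<longleftrightarrow> P t"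
  shows "card {t\<in>{a..<a + q}. P (t + j)} = card {t\<in>{..<q}. P t}"
proof -
  have "card {t\<in>{a..<a + q}. P (t + j)} = card ((\<lambda>t. t + j) ` {t\<in>{a..<a + q}. P (t + j)})"
    by (rule card_image[symmetric]) simp
  also have "(\<lambda>t. t + j) ` {t\<in>{a..<a + q}. P (t + j)} = {t\<in>{a + j..<a + j + q}. P t}"
  proof (intro set_eqI iffI)
    fix t assume t: "t \<in> {t\<in>{a + j..<a + j + q}. P t}"
    then show "t \<in> (\<lambda>t. t + j) ` {t\<in>{a..<a + q}. P (t + j)}"
      by (intro image_eqI[of _ _ "t - j"]) auto
  qed auto
  also have "card \<dots> = card {t\<in>{..<q}. P t}" using assms by (rule card_periodic_window)
  finally show ?thesis .
qed

section \<open>Averaging over the starting points of blocks\<close>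

context shadowing
begin

context
  fixes q c n :: nat
  assumes q_pos: "q > 0"
    and \<Delta>_periodic: "t + q \<in> \<Delta> \<longleftrightarrow> t \<in> \<Delta>" and \<phi>_periodic: "\<phi> (t + q) = \<phi> t"
    and card_not_\<Delta>: "card {t\<in>{..<q}. t \<notin> \<Delta>} \<le> n"
    and card_fibre: "\<And>r. card {t\<in>{..<q}. t \<in> \<Delta> \<and> \<phi> t mod p = r} \<le> c"
begin

lemma bad_periodic: "bad (t + q) \<longleftrightarrow> bad t"
proof -
  have "t + q + \<tau> = (t + \<tau>) + q" by simp
  then show ?thesis unfolding bad_def jump_def using \<Delta>_periodic \<phi>_periodic by metis
qed

text \<open>Each of the at most \<open>8 * \<tau>\<close> bad phases is taken at most
  \<open>c\<close> times in \<open>{..<q}\<close>; this is where the bounded fibres enter.\<close>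

lemma card_bad: "card {t\<in>{..<q}. bad t} \<le> 8 * \<tau> * c"
proof -
  let ?R = "(\<lambda>t. \<phi> t mod p) ` Collect bad"
  have "{t\<in>{..<q}. bad t} \<subseteq> (\<Union>r\<in>?R. {t\<in>{..<q}. t \<in> \<Delta> \<and> \<phi> t mod p = r})"
    unfolding bad_def by auto
  then have "card {t\<in>{..<q}. bad t} \<le> card (\<Union>r\<in>?R. {t\<in>{..<q}. t \<in> \<Delta> \<and> \<phi> t mod p = r})"
    using card_bad_phases(1) by (intro card_mono finite_UN_I) auto
  also have "\<dots> \<le> (\<Sum>r\<in>?R. card {t\<in>{..<q}. t \<in> \<Delta> \<and> \<phi> t mod p = r})"
    using card_bad_phases(1) by (rule card_UN_le)
  also have "\<dots> \<le> (\<Sum>r\<in>?R. c)" by (intro sum_mono card_fibre)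
  also have "\<dots> \<le> 8 * \<tau> * c" using card_bad_phases(2) by simp
  finally show ?thesis .
qed

definition good_start :: "nat \<Rightarrow> nat \<Rightarrow> nat \<Rightarrow> bool" where
  "good_start L B a \<longleftrightarrow> (\<forall>i\<le>L. a + i * \<tau> \<in> \<Delta>) \<and> card {i. i < L \<and> bad (a + i * \<tau>)} \<le> B"

text \<open>A start fails if one of its \<open>L + 1\<close> samples misses \<Delta>, or if it sees
  more than \<open>B\<close> bad jumps. The former are counted by periodicity, sample by sample. The
  latter are bounded by Markov's inequality, since all starts together see at most
  \<open>L * (8 * \<tau> * c)\<close> bad jumps.\<close>

lemma card_not_good_start:
  "real (card {t\<in>{a..<a + q}. \<not> good_start L B t}) \<le> (real L + 1) * real n + real L * (8 * real \<tau> * real c) / (real B + 1)"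
proof -
  let ?M = "{t\<in>{a..<a + q}. card {i. i < L \<and> bad (t + i * \<tau>)} > B}"
  have "{t\<in>{a..<a + q}. \<not> good_start L B t} \<subseteq> (\<Union>i\<le>L. {t\<in>{a..<a + q}. t + i * \<tau> \<notin> \<Delta>}) \<union> ?M"
    unfolding good_start_def by auto
  then have "card {t\<in>{a..<a + q}. \<not> good_start L B t}
      \<le> card ((\<Union>i\<le>L. {t\<in>{a..<a + q}. t + i * \<tau> \<notin> \<Delta>}) \<union> ?M)"
    by (intro card_mono) auto
  also have "\<dots> \<le> card (\<Union>i\<le>L. {t\<in>{a..<a + q}. t + i * \<tau> \<notin> \<Delta>}) + card ?M" by (rule card_Un_le)
  also have "card (\<Union>i\<le>L. {t\<in>{a..<a + q}. t + i * \<tau> \<notin> \<Delta>}) \<le> (\<Sum>i\<le>L. card {t\<in>{a..<a + q}. t + i * \<tau> \<notin> \<Delta>})"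
    by (rule card_UN_le) simp
  also have "(\<Sum>i\<le>L. card {t\<in>{a..<a + q}. t + i * \<tau> \<notin> \<Delta>}) \<le> (\<Sum>i\<le>L. n)"
  proof (rule sum_mono)
    fix i
    have "card {t\<in>{a..<a + q}. t + i * \<tau> \<notin> \<Delta>} = card {t\<in>{..<q}. t \<notin> \<Delta>}"
      by (rule card_shift_periodic) (simp add: \<Delta>_periodic)
    then show "card {t\<in>{a..<a + q}. t + i * \<tau> \<notin> \<Delta>} \<le> n" using card_not_\<Delta> by simp
  qed
  also have "(\<Sum>i\<le>L. n) = (L + 1) * n" by simp
  finally have 1: "card {t\<in>{a..<a + q}. \<not> good_start L B t} \<le> (L + 1) * n + card ?M" by simp
  have "(B + 1) * card ?M = (\<Sum>t\<in>?M. B + 1)" by simp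
  also have "\<dots> \<le> (\<Sum>t\<in>?M. card {i. i < L \<and> bad (t + i * \<tau>)})" by (intro sum_mono) auto
  also have "\<dots> \<le> (\<Sum>t\<in>{a..<a + q}. card {i. i < L \<and> bad (t + i * \<tau>)})" by (intro sum_mono2) auto
  also have "\<dots> = (\<Sum>t\<in>{a..<a + q}. \<Sum>i\<in>{..<L}. of_bool (bad (t + i * \<tau>)))"
  proof (rule sum.cong[OF refl])
    fix t
    have "{i. i < L \<and> bad (t + i * \<tau>)} = {..<L} \<inter> {i. bad (t + i * \<tau>)}" by auto
    then show "card {i. i < L \<and> bad (t + i * \<tau>)} = (\<Sum>i\<in>{..<L}. of_bool (bad (t + i * \<tau>)))" by simp
  qed
  also have "\<dots> = (\<Sum>i\<in>{..<L}. \<Sum>t\<in>{a..<a + q}. of_bool (bad (t + i * \<tau>)))" by (rule sum.swap)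
  also have "\<dots> \<le> (\<Sum>i\<in>{..<L}. 8 * \<tau> * c)"
  proof (rule sum_mono)
    fix i
    have "{a..<a + q} \<inter> {t. bad (t + i * \<tau>)} = {t\<in>{a..<a + q}. bad (t + i * \<tau>)}" by auto
    then have "(\<Sum>t\<in>{a..<a + q}. of_bool (bad (t + i * \<tau>))) = card {t\<in>{a..<a + q}. bad (t + i * \<tau>)}" by simp
    also have "\<dots> = card {t\<in>{..<q}. bad t}" by (rule card_shift_periodic) (rule bad_periodic)
    also note card_bad
    finally show "(\<Sum>t\<in>{a..<a + q}. of_bool (bad (t + i * \<tau>))) \<le> 8 * \<tau> * c" .
  qed
  also have "\<dots> = L * (8 * \<tau> * c)" by simp
  finally have "real ((B + 1) * card ?M) \<le> real (L * (8 * \<tau> * c))" by (rule of_nat_mono)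
  then have "real (card ?M) \<le> real L * (8 * real \<tau> * real c) / (real B + 1)"
    by (simp add: field_simps)
  moreover have "real (card {t\<in>{a..<a + q}. \<not> good_start L B t}) \<le> real ((L + 1) * n + card ?M)"
    using 1 by (rule of_nat_mono)
  ultimately show ?thesis by (simp add: algebra_simps)
qed

text \<open>Blocks from good starts are placed greedily. A block can be matched only from a position
  congruent to the phase of its start, so the window of \<open>x\<close> reserved for it is longer
  by one period.\<close>

lemma long_match:
  fixes k :: real and L B N N' :: nat
  defines "k \<equiv> real L * (real \<tau> - real \<sigma>) - real B * real ((L * (\<tau> + \<sigma>) div nat p + 1) * \<tau>)"
    and "N \<equiv> L * \<tau>" and "N' \<equiv> L * (\<tau> + \<sigma>) + nat p"
  assumes \<sigma>: "\<sigma> \<le> \<tau>" and \<delta>: "(real L * (4 * real I + 2) + 1) * \<gamma> \<le> \<delta>"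
    and k: "k \<ge> 0" and N: "N > 0" and len: "m * N' \<le> l * N"
  shows "has_match \<delta> y x {a..<a + m} {b..<b + int l}
    (k / N * (real m - (real m / q + 1) * ((real L + 1) * real n + real L * (8 * real \<tau> * real c) / (real B + 1)) - N))"
proof -
  have block: "has_match \<delta> y x {a..<a + N} {b..<b + int N'} k" if "good_start L B a" for a b
  proof -
    define s0 where "s0 = b + (\<phi> a - b) mod p"
    have "p dvd (\<phi> a - b) - (\<phi> a - b) mod p" by (rule dvd_minus_mod)
    then have "p dvd \<phi> a - s0" unfolding s0_def by (simp add: algebra_simps)
    then have "has_match \<delta> y x {a..<a + L * \<tau>} {s0..<s0 + int (L * (\<tau> + \<sigma>))} k"
      unfolding k_def using that \<sigma> \<delta> by (intro block_match) (auto simp: good_start_def)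
    moreover have "b \<le> s0" "s0 + int (L * (\<tau> + \<sigma>)) \<le> b + int N'"
    proof -
      have "0 \<le> (\<phi> a - b) mod p" "(\<phi> a - b) mod p < p" using p_pos by simp_all
      then show "b \<le> s0" "s0 + int (L * (\<tau> + \<sigma>)) \<le> b + int N'" unfolding s0_def N'_def by linarith+
    qed
    ultimately show ?thesis unfolding N_def by (elim has_match_mono) auto
  qed
  define \<rho> where "\<rho> = (real L + 1) * real n + real L * (8 * real \<tau> * real c) / (real B + 1)"
  have "real (card {t\<in>{a..<a + m}. \<not> good_start L B t}) \<le> (real m / q + 1) * \<rho>"
  proof -
    have "card {t\<in>{a..<a + m}. \<not> good_start L B t} \<le> (m div q + 1) * nat \<lfloor>\<rho>\<rfloor>"
    proof (rule card_windows_le[OF _ q_pos])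
      fix a show "card {t\<in>{a..<a + q}. \<not> good_start L B t} \<le> nat \<lfloor>\<rho>\<rfloor>"
        using card_not_good_start[of a L B] unfolding \<rho>_def[symmetric] by (rule le_nat_floor)
    qed
    then have "real (card {t\<in>{a..<a + m}. \<not> good_start L B t}) \<le> real ((m div q + 1) * nat \<lfloor>\<rho>\<rfloor>)"
      by (rule of_nat_mono)
    also have "\<dots> = real (m div q + 1) * real (nat \<lfloor>\<rho>\<rfloor>)" by (rule of_nat_mult)
    also have "\<dots> \<le> (real m / q + 1) * \<rho>"
    proof (rule mult_mono)
      show "real (m div q + 1) \<le> real m / q + 1" using of_nat_div_le_of_nat[of m q, where 'a = real] by simp
      have "0 \<le> \<rho>" unfolding \<rho>_def by (intro add_nonneg_nonneg mult_nonneg_nonneg divide_nonneg_nonneg) auto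
      then show "real (nat \<lfloor>\<rho>\<rfloor>) \<le> \<rho>" by simp
    qed auto
    finally show ?thesis .
  qed
  then have "k / N * (real m - (real m / q + 1) * \<rho> - N)
      \<le> k / N * (real m - real (card {t\<in>{a..<a + m}. \<not> good_start L B t}) - N)"
    using k by (intro mult_left_mono) auto
  moreover have "has_match \<delta> y x {a..<a + m} {b..<b + int l}
      (k / N * (real m - real (card {t\<in>{a..<a + m}. \<not> good_start L B t}) - N))"
    by (rule greedy_match[OF _ k N len]) (rule block)
  ultimately show ?thesis unfolding \<rho>_def by (elim has_match_mono) auto
qed

end

end

text \<open>The loss \<open>C\<close> depends neither on the position nor on the length of the
  window. This is stronger than a bound on \<open>fk\<close>, which sees only initial windows;
  \<open>concat_match\<close> needs windows that start at late times.\<close>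

definition uniformly_close :: "real \<Rightarrow> (nat \<Rightarrow> 'a::metric_space) \<Rightarrow> (nat \<Rightarrow> 'a) \<Rightarrow> bool" where
  "uniformly_close \<delta> u v \<longleftrightarrow>
     (\<exists>C. \<forall>a m. has_match \<delta> u v {a..<a + m} {a..<a + m} ((1 - \<delta>) * real m - C))"

lemma has_match_nat:
  assumes "has_match \<delta> u v A {int b..<int b + int m} k"
  shows "has_match \<delta> u (\<lambda>j. v (int j)) A {b..<b + m} k"
proof -
  obtain Q where Q: "Q \<subseteq> A \<times> {int b..<int b + int m}" "order_matching Q"
      "\<forall>(i, j)\<in>Q. dist (u i) (v j) < \<delta>" "k \<le> real (card Q)"
    using assms unfolding has_match_def by blast
  let ?f = "\<lambda>(i, j). (i, nat j)"
  have ge: "0 \<le> j" if "(i, j) \<in> Q" for i j using Q(1) that by auto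
  have inj: "inj_on ?f Q"
  proof (rule inj_onI)
    fix e e' assume "e \<in> Q" "e' \<in> Q" "?f e = ?f e'"
    then show "e = e'" using ge[of "fst e" "snd e"] ge[of "fst e'" "snd e'"] by (cases e; cases e') auto
  qed
  have "?f ` Q \<subseteq> A \<times> {b..<b + m}" using Q(1) by fastforce
  moreover have "order_matching (?f ` Q)"
    unfolding order_matching_def
  proof (intro ballI, clarify)
    fix i j i' j' assume *: "(i, j) \<in> Q" "(i', j') \<in> Q"
    then have "i < i' \<longleftrightarrow> j < j'" using Q(2) unfolding order_matching_def by blast
    then show "i < i' \<longleftrightarrow> nat j < nat j'" using ge[OF *(1)] ge[OF *(2)] by auto
  qed
  moreover have "\<forall>(i, j)\<in>?f ` Q. dist (u i) (v (int j)) < \<delta>" using Q(3) ge by auto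
  moreover have "k \<le> real (card (?f ` Q))" using Q(4) card_image[OF inj] by simp
  ultimately show ?thesis unfolding has_match_def by blast
qed

text \<open>With \<open>\<tau> = p div E\<close> and blocks of \<open>I * E\<close> steps containing at most \<open>8 * I ^ 2\<close> bad jumps, each of the
  following is at most \<open>2 / I\<close> of the length of a block or of all blocks: the drift of the slow jumps,
  the realignment, the places spoilt by bad jumps, the blocks leaving \<open>\<Delta>\<close> or with too many bad jumps.\<close>
lemma shadowing_uniformly_close:
  fixes x :: "int \<Rightarrow> 'a::metric_space" and I E :: nat
  assumes I: "I \<ge> 2" "7 / real I \<le> \<delta>" and E: "E = 24 * I ^ 3"
    and p: "int E \<le> p"
    and periodic: "\<And>k. x (k + p) = x k"
    and shadow: "\<And>t j. t \<in> \<Delta> \<Longrightarrow> int j < p \<Longrightarrow> dist (y (t + j)) (x (\<phi> t + int j)) < \<gamma>"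
    and \<gamma>: "\<gamma> > 0" "(real (I * E) * (4 * real I + 2) + 1) * \<gamma> \<le> \<delta>"
    and q: "q > 0" and \<Delta>: "\<And>t. t + q \<in> \<Delta> \<longleftrightarrow> t \<in> \<Delta>" and \<phi>: "\<And>t. \<phi> (t + q) = \<phi> t"
    and n: "real (card {t\<in>{..<q}. t \<notin> \<Delta>}) \<le> real q / (real I * (real (I * E) + 1))"
    and c: "\<And>r. card {t\<in>{..<q}. t \<in> \<Delta> \<and> \<phi> t mod p = r} \<le> c" "int c * p \<le> int q"
  shows "uniformly_close \<delta> y (\<lambda>j. x (int j))"
proof -
  \<comment> \<open>About \<open>E\<close> steps make up one period, so a block of
    \<open>I * E\<close> steps lasts about \<open>I\<close> periods, against which one period lost
    in realigning is small.\<close>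
  define \<tau> where "\<tau> = nat p div E"
  define \<sigma> where "\<sigma> = \<tau> div I"
  define L where "L = I * E"
  \<comment> \<open>Bad times have density at most \<open>8 * \<tau> * c / q \<le> 8 / E\<close>, so
    an average block contains at most \<open>8 * I\<close> of them. A threshold \<open>I\<close>
    times higher is exceeded for at most a fraction \<open>1 / I\<close> of the starts.\<close>
  define B where "B = 8 * I ^ 2"
  define N where "N = L * \<tau>"
  define N' where "N' = L * (\<tau> + \<sigma>) + nat p"
  define n where "n = card {t\<in>{..<q}. t \<notin> \<Delta>}"
  define k where "k = real L * (real \<tau> - real \<sigma>) - real B * real ((L * (\<tau> + \<sigma>) div nat p + 1) * \<tau>)"
  have E2: "E \<ge> 2" using I(1) power_increasing[of 1 3 I] unfolding E by simp
  have p_pos: "p > 0" using p E2 by simp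
  have \<tau>_pos: "\<tau> > 0" unfolding \<tau>_def using p E2 by (simp add: div_greater_zero_iff nat_le_iff le_nat_iff)
  have \<tau>E: "\<tau> * E \<le> nat p" unfolding \<tau>_def by simp
  \<comment> \<open>Rounding down loses at most a factor of \<open>2\<close>, since \<tau> is
    positive.\<close>
  have pE: "nat p \<le> 2 * (\<tau> * E)"
  proof -
    have "nat p < \<tau> * E + E" unfolding \<tau>_def using dividend_less_div_times[of E "nat p"] E2 by simp
    moreover have "E \<le> \<tau> * E" using \<tau>_pos by simp
    ultimately show ?thesis by linarith
  qed
  have \<tau>2: "2 * int \<tau> \<le> p"
  proof -
    have "\<tau> * 2 \<le> \<tau> * E" using E2 by simp
    then show ?thesis using \<tau>E p_pos by linarith
  qed
  have \<sigma>_le: "\<sigma> \<le> \<tau>" unfolding \<sigma>_def by simp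
  have \<sigma>I: "\<sigma> * I \<le> \<tau>" unfolding \<sigma>_def by simp
  have \<tau>_less: "\<tau> < (\<sigma> + 1) * I" unfolding \<sigma>_def using I(1) dividend_less_div_times[of I \<tau>] by simp
  interpret shadowing x y p \<Delta> \<phi> \<gamma> \<tau> \<sigma> I
    by standard (use p_pos periodic shadow \<gamma>(1) \<tau>2 \<tau>_less in auto)
  have I0: "real I > 0" using I(1) by simp
  have B_pos: "real B > 0" unfolding B_def using I(1) by simp
  have N_pos: "N > 0" unfolding N_def L_def using I(1) E2 \<tau>_pos by simp
  have N_real: "real N = real I * (real E * real \<tau>)" unfolding N_def L_def by simp
  have p_real: "real (nat p) \<le> 2 * real N / real I"
  proof -
    have "real (nat p) \<le> real (2 * (\<tau> * E))" using pE by (rule of_nat_mono)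
    then show ?thesis unfolding N_real using I0 by (simp add: mult.commute)
  qed
  have \<sigma>_real: "real L * real \<sigma> \<le> real N / real I"
  proof -
    have "real (\<sigma> * I) \<le> real \<tau>" using \<sigma>I by (rule of_nat_mono)
    then have "real \<sigma> \<le> real \<tau> / real I" using I0 by (simp add: field_simps)
    then have "real L * real \<sigma> \<le> real L * (real \<tau> / real I)" by (intro mult_left_mono) auto
    then show ?thesis unfolding N_def by simp
  qed
  \<comment> \<open>The image of a block meets an arc in at most
    \<open>2 * I + 1 \<le> 3 * I\<close> periods, so \<open>B\<close> bad jumps spoil at most
    \<open>24 * I ^ 3 * \<tau>\<close> places. This determines \<open>E\<close>: the bound is
    \<open>E * \<tau>\<close>, a fraction \<open>1 / I\<close> of the block.\<close>
  have k_ge: "k \<ge> real N * (1 - 2 / real I)"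
  proof -
    have "L * (\<tau> + \<sigma>) \<le> 2 * I * nat p"
    proof -
      have "L * (\<tau> + \<sigma>) \<le> L * (2 * \<tau>)" using \<sigma>_le by (intro mult_left_mono) auto
      also have "\<dots> = 2 * I * (\<tau> * E)" unfolding L_def by simp
      also have "\<dots> \<le> 2 * I * nat p" using \<tau>E by (intro mult_left_mono) auto
      finally show ?thesis .
    qed
    then have "L * (\<tau> + \<sigma>) div nat p \<le> 2 * I * nat p div nat p" by (rule div_le_mono)
    also have "\<dots> = 2 * I" using p_pos by simp
    finally have "B * ((L * (\<tau> + \<sigma>) div nat p + 1) * \<tau>) \<le> B * ((3 * I) * \<tau>)"
      using I(1) by (intro mult_left_mono mult_right_mono) auto
    also have "\<dots> = E * \<tau>" unfolding B_def E by (simp add: power2_eq_square power3_eq_cube)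
    finally have "real (B * ((L * (\<tau> + \<sigma>) div nat p + 1) * \<tau>)) \<le> real (E * \<tau>)" by (rule of_nat_mono)
    moreover have "real (E * \<tau>) = real N / real I" unfolding N_real using I0 by simp
    ultimately have "real B * real ((L * (\<tau> + \<sigma>) div nat p + 1) * \<tau>) \<le> real N / real I"
      by (simp only: of_nat_mult)
    moreover have "real L * (real \<tau> - real \<sigma>) \<ge> real N - real N / real I"
      using \<sigma>_real unfolding N_def by (simp add: algebra_simps)
    ultimately have "k \<ge> real N - real N / real I - real N / real I" unfolding k_def by linarith
    then show ?thesis by (simp add: algebra_simps)
  qed
  have I2: "2 / real I \<le> 1" using I(1) by simp
  have "0 \<le> real N * (1 - 2 / real I)" using I2 by (intro mult_nonneg_nonneg) simp_all
  with k_ge have k0: "k \<ge> 0" by linarith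
  have kN: "k / real N \<ge> 1 - 2 / real I" using k_ge N_pos by (simp add: field_simps)
  have N'_le: "real N' \<le> real N * (1 + 3 / real I)"
  proof -
    have "real N' = real N + real L * real \<sigma> + real (nat p)" unfolding N'_def N_def by (simp add: algebra_simps)
    also have "\<dots> \<le> real N + real N / real I + 2 * real N / real I" using \<sigma>_real p_real by linarith
    finally show ?thesis by (simp add: algebra_simps)
  qed
  have N'_pos: "N' > 0" unfolding N'_def using p_pos by simp
  define \<rho> where "\<rho> = (real L + 1) * real n + real L * (8 * real \<tau> * real c) / (real B + 1)"
  have \<rho>0: "\<rho> \<ge> 0" unfolding \<rho>_def by (intro add_nonneg_nonneg mult_nonneg_nonneg divide_nonneg_nonneg) auto
  have \<rho>: "\<rho> \<le> 2 * real q / real I"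
  proof -
    have "(real L + 1) * real n \<le> (real L + 1) * (real q / (real I * (real L + 1)))"
      using assms(12) unfolding n_def L_def by (intro mult_left_mono) auto
    also have "\<dots> = real q / real I" by (simp add: divide_simps)
    finally have 1: "(real L + 1) * real n \<le> real q / real I" .
    have "real L * (8 * real \<tau> * real c) / (real B + 1) \<le> real L * (8 * real \<tau> * real c) / real B"
      using B_pos by (intro divide_left_mono mult_pos_pos add_pos_pos) auto
    also have "\<dots> = (real (\<tau> * E) * real c) / real I"
      unfolding L_def B_def using I0 by (simp add: power2_eq_square)
    also have "\<dots> \<le> (real (nat p) * real c) / real I"
      using \<tau>E I0 by (intro divide_right_mono mult_right_mono of_nat_mono) auto
    also have "\<dots> \<le> real q / real I"
    proof -
      have "real_of_int (int c * p) \<le> real_of_int (int q)" using c(2) by (simp only: of_int_le_iff)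
      then have "real (nat p) * real c \<le> real q" using p_pos by (simp add: mult.commute)
      then show ?thesis using I0 by (intro divide_right_mono) auto
    qed
    finally show ?thesis using 1 unfolding \<rho>_def by (simp add: add_divide_distrib)
  qed
  \<comment> \<open>Absorbs the rounding of \<open>m\<close>, an incomplete window of length
    \<open>q\<close> and an incomplete last block.\<close>
  define C where "C = 1 + 2 * real q + real N"
  have "has_match \<delta> y (\<lambda>j. x (int j)) {a..<a + M} {b..<b + M} ((1 - \<delta>) * real M - C)" for a b M
  proof -
    \<comment> \<open>Blocks need more room in \<open>x\<close> than in \<open>y\<close>, so only
      the first \<open>m\<close> of the \<open>M\<close> indices of \<open>y\<close> are used; up to
      rounding, at most a fraction \<open>3 / I\<close> is given up.\<close>
    define m where "m = M * N div N'"
    define i where "i = real m - (real m / q + 1) * \<rho> - N"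
    have "m * N' \<le> M * N" unfolding m_def by simp
    have "has_match \<delta> y x {a..<a + m} {int b..<int b + int M} (k / N * i)"
      unfolding i_def \<rho>_def k_def N_def
    proof (rule long_match[OF q \<Delta> \<phi> _ c(1) \<sigma>_le])
      show "card {t \<in> {..<q}. t \<notin> \<Delta>} \<le> n" unfolding n_def by simp
      show "(real L * (4 * real I + 2) + 1) * \<gamma> \<le> \<delta>" using \<gamma>(2) unfolding L_def .
      show "0 \<le> real L * (real \<tau> - real \<sigma>) - real B * real ((L * (\<tau> + \<sigma>) div nat p + 1) * \<tau>)"
        using k0 unfolding k_def .
      show "0 < L * \<tau>" using N_pos unfolding N_def .
      show "m * (L * (\<tau> + \<sigma>) + nat p) \<le> M * (L * \<tau>)" using \<open>m * N' \<le> M * N\<close> unfolding N_def N'_def .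
    qed
    then have match: "has_match \<delta> y (\<lambda>j. x (int j)) {a..<a + m} {b..<b + M} (k / N * i)" by (rule has_match_nat)
    have NN': "N \<le> N'" unfolding N_def N'_def by (simp add: add_mult_distrib2)
    have m_le: "m \<le> M"
    proof -
      have "M * N div N' \<le> M * N' div N'" using NN' by (intro div_le_mono mult_left_mono) auto
      then show ?thesis unfolding m_def using N'_pos by simp
    qed
    have m_ge: "real m \<ge> real M * (1 - 3 / real I) - 1"
    proof -
      have "M * N < (m + 1) * N'" unfolding m_def using dividend_less_div_times[OF N'_pos] by simp
      then have "real (M * N) < real ((m + 1) * N')" by (rule of_nat_less_iff[THEN iffD2])
      then have "real (M * N) / real N' < real m + 1"
        using N'_pos by (simp add: pos_divide_less_eq algebra_simps)
      moreover have "real M * (1 - 3 / real I) \<le> real (M * N) / real N'"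
      proof -
        have "(1 - 3 / real I) * real N' \<le> real N"
        proof (cases "3 / real I \<le> 1")
          have sq: "(1 - r) * (real N * (1 + r)) = real N * (1 - r\<^sup>2)" for r
            by (simp add: algebra_simps power2_eq_square)
          case True
          then have "(1 - 3 / real I) * real N' \<le> (1 - 3 / real I) * (real N * (1 + 3 / real I))"
            using N'_le by (intro mult_left_mono) auto
          also have "\<dots> = real N * (1 - (3 / real I)\<^sup>2)" by (rule sq)
          also have "\<dots> \<le> real N * 1" by (intro mult_left_mono) auto
          finally show ?thesis by simp
        next
          case False
          then have "(1 - 3 / real I) * real N' \<le> 0" by (intro mult_nonpos_nonneg) auto
          then show ?thesis by (rule order_trans) simp
        qed
        then have "real M * ((1 - 3 / real I) * real N') \<le> real M * real N" by (intro mult_left_mono) auto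
        then show ?thesis using N'_pos by (simp add: pos_le_divide_eq mult.assoc)
      qed
      ultimately show ?thesis by linarith
    qed
    have i_ge: "i \<ge> real M * (1 - 5 / real I) - C"
    proof -
      define X where "X = (real m / q + 1) * \<rho>"
      have "X \<le> (real M / q + 1) * (2 * real q / real I)"
        unfolding X_def using m_le \<rho> \<rho>0 by (intro mult_mono add_right_mono divide_right_mono) auto
      also have "\<dots> = 2 * real M / real I + real q * (2 / real I)" using q I0 by (simp add: field_simps)
      finally have 1: "X \<le> 2 * real M / real I + real q * (2 / real I)" .
      have 2: "real q * (2 / real I) \<le> real q * 1" using I2 by (intro mult_left_mono) auto
      have X: "X \<le> 2 * real M / real I + real q * 1" using order_trans[OF 1 add_left_mono[OF 2]] .
      have "i \<ge> real M * (1 - 3 / real I) - 1 - (2 * real M / real I + real q * 1) - N"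
        unfolding i_def X_def[symmetric] using diff_mono[OF diff_mono[OF m_ge X] order_refl[of "real N"]] .
      moreover have "real M * (1 - 3 / real I) - 2 * real M / real I = real M * (1 - 5 / real I)"
        using I0 by (simp add: field_simps)
      ultimately show ?thesis unfolding C_def using q by linarith
    qed
    have \<delta>I: "(1 - \<delta>) * real M \<le> real M * (1 - 7 / real I)"
      using I(2) mult_left_mono[OF I(2), of "real M"] by (simp add: algebra_simps)
    have C0: "C \<ge> 0" unfolding C_def by simp
    have "(1 - \<delta>) * real M - C \<le> 0 \<or> (1 - \<delta>) * real M - C \<le> k / N * i"
    proof (cases "i \<ge> 0")
      case True
      \<comment> \<open>The \<open>7\<close> collects \<open>2\<close> for the losses inside blocks,
        \<open>3\<close> for the extra room taken by drift and realignment, and \<open>2\<close> for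
        the indices that are not good starts.\<close>
      have "real M * (1 - 7 / real I) - C \<le> (1 - 2 / real I) * (real M * (1 - 5 / real I) - C)"
      proof -
        have "(1 - 2 / real I) * (real M * (1 - 5 / real I) - C) - (real M * (1 - 7 / real I) - C)
            = real M * (10 / (real I * real I)) + 2 / real I * C"
          using I0 by (simp add: field_simps)
        also have "\<dots> \<ge> 0" using C0 by simp
        finally show ?thesis by (simp only: diff_ge_0_iff_ge)
      qed
      also have "\<dots> \<le> (1 - 2 / real I) * i" using i_ge I2 by (intro mult_left_mono) auto
      also have "\<dots> \<le> k / N * i" using kN True by (intro mult_right_mono) auto
      finally show ?thesis using \<delta>I by linarith
    next
      case False
      have "5 / real I \<le> 7 / real I" by (rule divide_right_mono) simp_all
      then have "1 - 7 / real I \<le> 1 - 5 / real I" by linarith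
      then have "real M * (1 - 7 / real I) \<le> real M * (1 - 5 / real I)" by (rule mult_left_mono) (rule of_nat_0_le_iff)
      then show ?thesis using i_ge False \<delta>I by linarith
    qed
    then consider "(1 - \<delta>) * real M - C \<le> 0" | "(1 - \<delta>) * real M - C \<le> k / N * i" by blast
    then show ?thesis
    proof cases
      case 1
      show ?thesis using has_match_empty[OF 1] .
    next
      case 2
      have sub: "{a..<a + m} \<subseteq> {a..<a + M}" using m_le by auto
      show ?thesis using has_match_mono[OF match order_refl sub order_refl 2] .
    qed
  qed
  then show ?thesis unfolding uniformly_close_def by blast
qed

section \<open>Good approximations of periodic orbits\<close>

lemma trajectory_add: "trajectory T x (i + j) = trajectory T (trajectory T x i) j"
  unfolding trajectory_def by (subst add.commute) (simp only: funpow_add comp_apply)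

lemma trajectory_0 [simp]: "trajectory T x 0 = x"
  unfolding trajectory_def by simp

lemma trajectory_Suc: "trajectory T x (Suc j) = T (trajectory T x j)"
  unfolding trajectory_def by simp

lemma funpow_funpow: "(f ^^ i) ((f ^^ j) x) = (f ^^ (i + j)) x"
  by (simp add: funpow_add)

text \<open>The least period of \<open>y\<close> is the number of points of the orbit. Stating the
  facts for an arbitrary \<open>y\<close> lets any chosen point serve as base point.\<close>

lemma periodic_orbit_trajectory:
  assumes "periodic_orbit T \<Gamma>" "y \<in> \<Gamma>"
  shows "finite \<Gamma>" "card \<Gamma> > 0" "trajectory T y (t + card \<Gamma>) = trajectory T y t"
    "bij_betw (trajectory T y) {..<card \<Gamma>} \<Gamma>" "range (trajectory T y) = \<Gamma>"
proof -
  obtain x0 P where P: "P > 0" "(T ^^ P) x0 = x0" and \<Gamma>: "\<Gamma> = range (trajectory T x0)"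
    using assms(1) unfolding periodic_orbit_def by blast
  obtain i where i: "y = (T ^^ i) x0" using assms(2) unfolding \<Gamma> trajectory_def by blast
  have per: "(T ^^ (j + k * P)) x0 = (T ^^ j) x0" for j k
    using funpow_mod_eq[OF P(2), of "j + k * P"] funpow_mod_eq[OF P(2), of j] by simp
  have "(T ^^ P) y = (T ^^ (i + 1 * P)) x0" unfolding i by (simp add: funpow_funpow add.commute)
  also have "\<dots> = y" unfolding per i ..
  finally have Py: "(T ^^ P) y = y" .
  define m where "m = (LEAST m. m > 0 \<and> (T ^^ m) y = y)"
  have m: "m > 0" "(T ^^ m) y = y"
    using LeastI[of "\<lambda>m. m > 0 \<and> (T ^^ m) y = y" P] P(1) Py unfolding m_def by auto
  have least: "\<not> (l > 0 \<and> (T ^^ l) y = y)" if "l < m" for l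
    using that not_less_Least unfolding m_def by blast
  have range: "range (trajectory T y) = \<Gamma>"
  proof
    show "range (trajectory T y) \<subseteq> \<Gamma>"
      unfolding \<Gamma> trajectory_def i by (auto simp: funpow_funpow)
    show "\<Gamma> \<subseteq> range (trajectory T y)"
    proof
      fix z assume "z \<in> \<Gamma>"
      then obtain j where j: "z = (T ^^ j) x0" unfolding \<Gamma> trajectory_def by blast
      \<comment> \<open>Going around the orbit \<open>i\<close> more times makes room to step back
        by \<open>i\<close>.\<close>
      have le: "i \<le> j + i * P" using P(1) by (simp add: trans_le_add2)
      have "z = (T ^^ (j + i * P - i + i)) x0" using le by (simp add: per j)
      also have "\<dots> = trajectory T y (j + i * P - i)"
        unfolding trajectory_def i by (simp only: funpow_funpow)
      finally show "z \<in> range (trajectory T y)" by blast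
    qed
  qed
  have inj: "inj_on (trajectory T y) {..<m}"
  proof (rule linorder_inj_onI)
    fix i j assume ij: "i < j" "i \<in> {..<m}" "j \<in> {..<m}"
    show "trajectory T y i \<noteq> trajectory T y j"
    proof
      assume eq: "trajectory T y i = trajectory T y j"
      have "(T ^^ (m - j + i)) y = (T ^^ (m - j)) ((T ^^ i) y)" by (simp only: funpow_funpow)
      also have "(T ^^ i) y = (T ^^ j) y" using eq unfolding trajectory_def .
      also have "(T ^^ (m - j)) ((T ^^ j) y) = (T ^^ (m - j + j)) y" by (simp only: funpow_funpow)
      also have "\<dots> = y" using ij m by simp
      finally show False using least[of "m - j + i"] ij by simp
    qed
  qed auto
  have img: "trajectory T y ` {..<m} = \<Gamma>"
  proof
    show "\<Gamma> \<subseteq> trajectory T y ` {..<m}"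
    proof
      fix z assume "z \<in> \<Gamma>"
      then obtain j where "z = (T ^^ j) y" using range unfolding trajectory_def by blast
      then have "z = trajectory T y (j mod m)" unfolding trajectory_def using funpow_mod_eq[OF m(2)] by simp
      then show "z \<in> trajectory T y ` {..<m}" using m by auto
    qed
  qed (use range in auto)
  have card: "card \<Gamma> = m" using card_image[OF inj] img by simp
  show "finite \<Gamma>" using img by (metis finite_imageI finite_lessThan)
  show "card \<Gamma> > 0" using card m by simp
  show "bij_betw (trajectory T y) {..<card \<Gamma>} \<Gamma>" using inj img unfolding card bij_betw_def by simp
  show "range (trajectory T y) = \<Gamma>" by (rule range)
  show "trajectory T y (t + card \<Gamma>) = trajectory T y t"
    unfolding card trajectory_def using funpow_mod_eq[OF m(2), of "t + m"] funpow_mod_eq[OF m(2), of t] by simp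
qed

lemma periodic_orbit_nonempty: "periodic_orbit T \<Gamma> \<Longrightarrow> \<Gamma> \<noteq> {}"
  unfolding periodic_orbit_def by blast

lemma periodic_orbit_finite: "periodic_orbit T \<Gamma> \<Longrightarrow> finite \<Gamma>"
  by (metis all_not_in_conv periodic_orbit_nonempty periodic_orbit_trajectory(1))

lemma card_constant_fibres:
  assumes "finite \<Delta>" "\<psi> ` \<Delta> = \<Lambda>" "\<And>x. x \<in> \<Lambda> \<Longrightarrow> card {y\<in>\<Delta>. \<psi> y = x} = c"
  shows "card \<Delta> = c * card \<Lambda>"
proof -
  have "(\<Sum>x\<in>\<Lambda>. card {y\<in>\<Delta>. \<psi> y = x}) = card \<Delta>"
    using sum.group[of \<Delta> \<Lambda> \<psi> "\<lambda>_. 1 :: nat"] assms(1,2) by auto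
  then show ?thesis using assms(3) by (simp add: mult.commute)
qed

lemma good_approximationE:
  assumes "good_approximation T \<gamma> \<kappa> \<Gamma> \<Lambda>"
  obtains \<Delta> \<psi> c where "\<Delta> \<subseteq> \<Gamma>" "real (card \<Delta>) / real (card \<Gamma>) \<ge> \<kappa>" "\<psi> ` \<Delta> = \<Lambda>"
    "\<forall>x\<in>\<Lambda>. card {y \<in> \<Delta>. \<psi> y = x} = c"
    "\<forall>y\<in>\<Delta>. \<forall>j<card \<Lambda>. dist ((T ^^ j) y) ((T ^^ j) (\<psi> y)) < \<gamma>"
  using assms[unfolded good_approximation_def] by (elim exE conjE) (rule that)

text \<open>Restrict \<open>\<psi>'\<close> to the preimage of \<Delta>. Since all its fibres have
  the same size, the proportions multiply and the composition is again constant-to-one. The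
  assumption on the cardinalities makes both distance estimates available for the whole time
  required by \<open>\<Gamma>1\<close>.\<close>

lemma good_approximation_trans:
  assumes 1: "good_approximation T \<gamma> \<kappa> \<Gamma>2 \<Gamma>1" and 2: "good_approximation T \<gamma>' \<kappa>' \<Gamma>3 \<Gamma>2"
    and fin: "finite \<Gamma>2" "finite \<Gamma>3" and card: "card \<Gamma>1 \<le> card \<Gamma>2" and \<kappa>: "\<kappa> \<ge> 0" "\<kappa>' \<ge> 0"
    and pos: "card \<Gamma>2 > 0"
  shows "good_approximation T (\<gamma> + \<gamma>') (\<kappa> * \<kappa>') \<Gamma>3 \<Gamma>1"
proof -
  obtain \<Delta> \<psi> c where \<Delta>: "\<Delta> \<subseteq> \<Gamma>2" "real (card \<Delta>) / real (card \<Gamma>2) \<ge> \<kappa>" "\<psi> ` \<Delta> = \<Gamma>1"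
    and "\<forall>x\<in>\<Gamma>1. card {y \<in> \<Delta>. \<psi> y = x} = c"
    and "\<forall>y\<in>\<Delta>. \<forall>j<card \<Gamma>1. dist ((T ^^ j) y) ((T ^^ j) (\<psi> y)) < \<gamma>"
    using 1 by (rule good_approximationE)
  note c = this(4)[rule_format] and d = this(5)[rule_format]
  obtain \<Delta>' \<psi>' c' where \<Delta>': "\<Delta>' \<subseteq> \<Gamma>3" "real (card \<Delta>') / real (card \<Gamma>3) \<ge> \<kappa>'" "\<psi>' ` \<Delta>' = \<Gamma>2"
    and "\<forall>x\<in>\<Gamma>2. card {y \<in> \<Delta>'. \<psi>' y = x} = c'"
    and "\<forall>y\<in>\<Delta>'. \<forall>j<card \<Gamma>2. dist ((T ^^ j) y) ((T ^^ j) (\<psi>' y)) < \<gamma>'"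
    using 2 by (rule good_approximationE)
  note c' = this(4)[rule_format] and d' = this(5)[rule_format]
  have fin\<Delta>: "finite \<Delta>" "finite \<Delta>'" using \<Delta>(1) \<Delta>'(1) fin by (auto intro: finite_subset)
  define \<Delta>'' where "\<Delta>'' = {y\<in>\<Delta>'. \<psi>' y \<in> \<Delta>}"
  have img: "\<psi>' ` \<Delta>'' = \<Delta>" unfolding \<Delta>''_def using \<Delta>'(3) \<Delta>(1) by blast
  have fib: "card {y\<in>\<Delta>''. \<psi>' y = x} = c'" if "x \<in> \<Delta>" for x
  proof -
    have "{y\<in>\<Delta>''. \<psi>' y = x} = {y\<in>\<Delta>'. \<psi>' y = x}" unfolding \<Delta>''_def using that by blast
    then show ?thesis using c' that \<Delta>(1) by auto
  qed
  have fin'': "finite \<Delta>''" unfolding \<Delta>''_def using fin\<Delta> by simp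
  have card'': "card \<Delta>'' = c' * card \<Delta>" using fin'' img fib by (rule card_constant_fibres)
  have card': "card \<Delta>' = c' * card \<Gamma>2" using fin\<Delta>(2) \<Delta>'(3) c' by (rule card_constant_fibres)
  show ?thesis
    unfolding good_approximation_def
  proof (intro exI conjI ballI allI impI)
    show "\<Delta>'' \<subseteq> \<Gamma>3" unfolding \<Delta>''_def using \<Delta>'(1) by blast
    have "real (card \<Delta>'') / real (card \<Gamma>3) = (real (card \<Delta>) / real (card \<Gamma>2)) * (real (card \<Delta>') / real (card \<Gamma>3))"
      unfolding card'' card' using pos by simp
    also have "\<dots> \<ge> \<kappa> * \<kappa>'" using \<Delta>(2) \<Delta>'(2) \<kappa> by (intro mult_mono) auto
    finally show "\<kappa> * \<kappa>' \<le> real (card \<Delta>'') / real (card \<Gamma>3)" .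
    show "(\<psi> \<circ> \<psi>') ` \<Delta>'' = \<Gamma>1" using img \<Delta>(3) by (metis image_comp)
    show "card {y\<in>\<Delta>''. (\<psi> \<circ> \<psi>') y = x} = c' * c" if "x \<in> \<Gamma>1" for x
    proof -
      have "card {y\<in>\<Delta>''. (\<psi> \<circ> \<psi>') y = x} = c' * card {y\<in>\<Delta>. \<psi> y = x}"
      proof (rule card_constant_fibres)
        show "\<psi>' ` {y\<in>\<Delta>''. (\<psi> \<circ> \<psi>') y = x} = {y\<in>\<Delta>. \<psi> y = x}" using img by auto
        show "card {y' \<in> {y \<in> \<Delta>''. (\<psi> \<circ> \<psi>') y = x}. \<psi>' y' = z} = c'" if "z \<in> {y\<in>\<Delta>. \<psi> y = x}" for z
        proof -
          have "{y' \<in> {y \<in> \<Delta>''. (\<psi> \<circ> \<psi>') y = x}. \<psi>' y' = z} = {y\<in>\<Delta>''. \<psi>' y = z}" using that by auto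
          then show ?thesis using fib that by simp
        qed
      qed (use fin'' in simp)
      then show ?thesis using c[OF that] by simp
    qed
    show "dist ((T ^^ j) y) ((T ^^ j) ((\<psi> \<circ> \<psi>') y)) < \<gamma> + \<gamma>'" if "y \<in> \<Delta>''" "j < card \<Gamma>1" for y j
    proof -
      have "dist ((T ^^ j) y) ((T ^^ j) (\<psi>' y)) < \<gamma>'" using d' that card unfolding \<Delta>''_def by auto
      moreover have "dist ((T ^^ j) (\<psi>' y)) ((T ^^ j) (\<psi> (\<psi>' y))) < \<gamma>" using d that unfolding \<Delta>''_def by auto
      ultimately show ?thesis
        using dist_triangle[of "(T ^^ j) y" "(T ^^ j) (\<psi> (\<psi>' y))" "(T ^^ j) (\<psi>' y)"] by simp
    qed
  qed
qed

text \<open>The thresholds are fixed before the map and the orbits, so they serve all pairs of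
  orbits of a sequence at once. The orbit \<Gamma> is read along the times of \<open>y\<close>, and
  the phase of a time is the index, on the trajectory of \<open>x\<close>, of its image under
  \<psi>.\<close>

lemma good_approximation_uniformly_close:
  fixes \<delta> :: real
  assumes "\<delta> > 0"
  obtains \<epsilon> P where "\<epsilon> > 0"
    "\<And>(T :: 'a::metric_space \<Rightarrow> 'a) \<Gamma> \<Lambda> \<gamma> \<kappa> y x. periodic_orbit T \<Gamma> \<Longrightarrow> periodic_orbit T \<Lambda> \<Longrightarrow> good_approximation T \<gamma> \<kappa> \<Gamma> \<Lambda> \<Longrightarrow>
       0 < \<gamma> \<Longrightarrow> \<gamma> \<le> \<epsilon> \<Longrightarrow> \<kappa> \<ge> 1 - \<epsilon> \<Longrightarrow> card \<Lambda> \<ge> P \<Longrightarrow> y \<in> \<Gamma> \<Longrightarrow> x \<in> \<Lambda> \<Longrightarrow>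
       uniformly_close \<delta> (trajectory T y) (trajectory T x)"
proof -
  obtain I0 :: nat where "7 / \<delta> \<le> real I0" using real_arch_simple by blast
  define I where "I = max 2 I0"
  have I: "I \<ge> 2" unfolding I_def by simp
  have "7 / \<delta> \<le> real I" using \<open>7 / \<delta> \<le> real I0\<close> unfolding I_def by simp
  then have I\<delta>: "7 / real I \<le> \<delta>" using assms I by (simp add: field_simps)
  define E where "E = 24 * I ^ 3"
  \<comment> \<open>The first bound keeps the points outside the shadowing set rare even when
    \<open>I * E + 1\<close> samples have to avoid them; the second keeps the total displacement
    within a block below \<delta>.\<close>
  define \<epsilon> where "\<epsilon> = min (1 / (real I * (real (I * E) + 1))) (\<delta> / (real (I * E) * (4 * real I + 2) + 1))"
  have pos1: "real I * (real (I * E) + 1) > 0" using I by (intro mult_pos_pos add_nonneg_pos) auto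
  have pos2: "real (I * E) * (4 * real I + 2) + 1 > 0" by (intro add_nonneg_pos mult_nonneg_nonneg) auto
  have \<epsilon>: "\<epsilon> > 0" unfolding \<epsilon>_def using pos1 pos2 assms by simp
  have "uniformly_close \<delta> (trajectory T y) (trajectory T x)"
    if \<Gamma>: "periodic_orbit T \<Gamma>" and \<Lambda>: "periodic_orbit T \<Lambda>" and good: "good_approximation T \<gamma> \<kappa> \<Gamma> \<Lambda>"
      and \<gamma>: "0 < \<gamma>" "\<gamma> \<le> \<epsilon>" and \<kappa>: "\<kappa> \<ge> 1 - \<epsilon>" and E_le: "card \<Lambda> \<ge> E" and y: "y \<in> \<Gamma>" and x: "x \<in> \<Lambda>"
    for T :: "'a \<Rightarrow> 'a" and \<Gamma> \<Lambda> \<gamma> \<kappa> y x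
  proof -
    note \<Gamma>' = periodic_orbit_trajectory[OF \<Gamma> y] and \<Lambda>' = periodic_orbit_trajectory[OF \<Lambda> x]
    define p where "p = card \<Lambda>"
    define q where "q = card \<Gamma>"
    obtain \<Delta> \<psi> c where \<Delta>: "\<Delta> \<subseteq> \<Gamma>" "real (card \<Delta>) / real q \<ge> \<kappa>" "\<psi> ` \<Delta> = \<Lambda>"
      and "\<forall>z\<in>\<Lambda>. card {y \<in> \<Delta>. \<psi> y = z} = c"
      and "\<forall>y\<in>\<Delta>. \<forall>j<p. dist ((T ^^ j) y) ((T ^^ j) (\<psi> y)) < \<gamma>"
      using good unfolding p_def q_def by (rule good_approximationE)
    note c = this(4)[rule_format] and d = this(5)[rule_format]
    define D where "D = {t. trajectory T y t \<in> \<Delta>}"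
    define idx where "idx = the_inv_into {..<p} (trajectory T x)"
    define \<phi> where "\<phi> t = int (idx (\<psi> (trajectory T y t)))" for t
    define X where "X k = trajectory T x (nat (k mod int p))" for k
    have p: "p > 0" and q: "q > 0" using \<Lambda>'(2) \<Gamma>'(2) unfolding p_def q_def .
    have idx: "idx z < p" "trajectory T x (idx z) = z" if "z \<in> \<Lambda>" for z
    proof -
      have "inj_on (trajectory T x) {..<p}" "z \<in> trajectory T x ` {..<p}"
        using \<Lambda>'(4) that unfolding p_def bij_betw_def by auto
      then show "idx z < p" "trajectory T x (idx z) = z"
        unfolding idx_def using the_inv_into_into[of "trajectory T x" "{..<p}" z "{..<p}"] f_the_inv_into_f by fastforce+
    qed
    have mod: "trajectory T x (j mod p) = trajectory T x j" for j
    proof -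
      have "(T ^^ p) x = x" using \<Lambda>'(3)[of 0] unfolding p_def trajectory_def by simp
      then show ?thesis unfolding trajectory_def by (rule funpow_mod_eq)
    qed
    have X: "X (int j) = trajectory T x j" for j
      unfolding X_def using mod by (simp flip: zmod_int)
    have \<psi>: "\<psi> (trajectory T y t) \<in> \<Lambda>" if "t \<in> D" for t using that \<Delta>(3) unfolding D_def by auto
    have fibre: "card {t\<in>{..<q}. Q (trajectory T y t)} = card {z\<in>\<Gamma>. Q z}" for Q
    proof (rule bij_betw_same_card[of "trajectory T y"])
      have "bij_betw (trajectory T y) {..<q} \<Gamma>" using \<Gamma>'(4) unfolding q_def .
      then show "bij_betw (trajectory T y) {t\<in>{..<q}. Q (trajectory T y t)} {z\<in>\<Gamma>. Q z}"
        unfolding bij_betw_def inj_on_def by auto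
    qed
    have "uniformly_close \<delta> (trajectory T y) (\<lambda>j. X (int j))"
    proof (rule shadowing_uniformly_close[where \<Delta> = D and \<phi> = \<phi> and q = q and c = c])
      show "I \<ge> 2" "7 / real I \<le> \<delta>" "E = 24 * I ^ 3" "0 < \<gamma>" "0 < q" using I I\<delta> \<gamma>(1) q by (simp_all add: E_def)
      show "int E \<le> int p" using E_le unfolding p_def by simp
      show "X (k + int p) = X k" for k unfolding X_def by simp
      show "dist (trajectory T y (t + j)) (X (\<phi> t + int j)) < \<gamma>" if t: "t \<in> D" and "int j < int p" for t j
      proof -
        have "X (\<phi> t + int j) = trajectory T x (idx (\<psi> (trajectory T y t)) + j)"
          unfolding \<phi>_def of_nat_add[symmetric] by (rule X)
        also have "\<dots> = (T ^^ j) (\<psi> (trajectory T y t))"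
          unfolding trajectory_add idx(2)[OF \<psi>[OF t]] trajectory_def[of T _ j] ..
        finally show ?thesis
          using d[of "trajectory T y t" j] that unfolding trajectory_add D_def trajectory_def[of T _ j] by simp
      qed
      show "(real (I * E) * (4 * real I + 2) + 1) * \<gamma> \<le> \<delta>"
      proof -
        have "\<gamma> \<le> \<delta> / (real (I * E) * (4 * real I + 2) + 1)" using \<gamma>(2) unfolding \<epsilon>_def by simp
        then show ?thesis using pos2 by (simp add: pos_le_divide_eq mult.commute)
      qed
      show "t + q \<in> D \<longleftrightarrow> t \<in> D" for t unfolding D_def q_def using \<Gamma>'(3) by simp
      show "\<phi> (t + q) = \<phi> t" for t unfolding \<phi>_def q_def using \<Gamma>'(3) by simp
      show "real (card {t\<in>{..<q}. t \<notin> D}) \<le> real q / (real I * (real (I * E) + 1))"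
      proof -
        have "card {t\<in>{..<q}. t \<notin> D} = card {z\<in>\<Gamma>. z \<notin> \<Delta>}" unfolding D_def using fibre[of "\<lambda>z. z \<notin> \<Delta>"] by simp
        also have "{z\<in>\<Gamma>. z \<notin> \<Delta>} = \<Gamma> - \<Delta>" by blast
        finally have "real (card {t\<in>{..<q}. t \<notin> D}) = real q - real (card \<Delta>)"
          using \<Delta>(1) \<Gamma>'(1) unfolding q_def by (simp add: card_Diff_subset finite_subset of_nat_diff card_mono)
        also have "\<dots> \<le> real q - (1 - \<epsilon>) * real q"
        proof -
          have "1 - \<epsilon> \<le> real (card \<Delta>) / real q" using \<Delta>(2) \<kappa> by linarith
          then show ?thesis using q by (simp add: pos_le_divide_eq)
        qed
        also have "\<dots> = real q * \<epsilon>" by (simp add: algebra_simps)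
        also have "\<dots> \<le> real q * (1 / (real I * (real (I * E) + 1)))"
          unfolding \<epsilon>_def by (intro mult_left_mono min.cobounded1) simp
        finally show ?thesis by simp
      qed
      show "card {t\<in>{..<q}. t \<in> D \<and> \<phi> t mod int p = r} \<le> c" for r
      proof (cases "\<exists>t. t \<in> D \<and> \<phi> t mod int p = r")
        case True
        have \<phi>_mod: "\<phi> t mod int p = \<phi> t" if "t \<in> D" for t
          using idx(1)[OF \<psi>[OF that]] unfolding \<phi>_def by simp
        obtain t0 where t0: "t0 \<in> D" "\<phi> t0 = r" using True \<phi>_mod by metis
        define z where "z = \<psi> (trajectory T y t0)"
        have "{t\<in>{..<q}. t \<in> D \<and> \<phi> t mod int p = r} \<subseteq> {t\<in>{..<q}. trajectory T y t \<in> \<Delta> \<and> \<psi> (trajectory T y t) = z}"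
        proof clarify
          fix t assume t: "t < q" "t \<in> D" "r = \<phi> t mod int p"
          then have "idx (\<psi> (trajectory T y t)) = idx z" using \<phi>_mod t0 unfolding \<phi>_def z_def by simp
          then have "\<psi> (trajectory T y t) = z" using idx(2) \<psi> t t0 unfolding z_def by metis
          then show "t \<in> {..<q} \<and> trajectory T y t \<in> \<Delta> \<and> \<psi> (trajectory T y t) = z"
            using t unfolding D_def by simp
        qed
        then have "card {t\<in>{..<q}. t \<in> D \<and> \<phi> t mod int p = r}
            \<le> card {t\<in>{..<q}. trajectory T y t \<in> \<Delta> \<and> \<psi> (trajectory T y t) = z}"
          by (intro card_mono) auto
        also have "\<dots> = card {w\<in>\<Gamma>. w \<in> \<Delta> \<and> \<psi> w = z}" using fibre[of "\<lambda>w. w \<in> \<Delta> \<and> \<psi> w = z"] .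
        also have "{w\<in>\<Gamma>. w \<in> \<Delta> \<and> \<psi> w = z} = {w\<in>\<Delta>. \<psi> w = z}" using \<Delta>(1) by blast
        also have "card \<dots> = c" using c \<psi>[OF t0(1)] unfolding z_def .
        finally show ?thesis .
      next
        case False
        then have "{t\<in>{..<q}. t \<in> D \<and> \<phi> t mod int p = r} = {}" by blast
        then show ?thesis by (simp only: card.empty)
      qed
      have "card \<Delta> = c * p" unfolding p_def
        using \<Delta> c \<Gamma>'(1) by (intro card_constant_fibres) (auto intro: finite_subset)
      moreover have "card \<Delta> \<le> q" unfolding q_def using \<Delta>(1) \<Gamma>'(1) by (rule card_mono[rotated])
      ultimately show "int c * int p \<le> int q" by (metis of_nat_mult of_nat_le_iff)
    qed
    then show ?thesis unfolding X .
  qed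
  with \<epsilon> show ?thesis by (rule that)
qed

lemma uniformly_close_sym:
  assumes "uniformly_close \<delta> u v"
  shows "uniformly_close \<delta> v u"
proof -
  obtain C where "\<forall>a m. has_match \<delta> u v {a..<a + m} {a..<a + m} ((1 - \<delta>) * real m - C)"
    using assms unfolding uniformly_close_def ..
  then have "\<forall>a m. has_match \<delta> v u {a..<a + m} {a..<a + m} ((1 - \<delta>) * real m - C)"
    by (intro allI) (rule has_match_sym, erule allE, erule allE)
  then show ?thesis unfolding uniformly_close_def ..
qed

lemma uniformly_close_refl:
  assumes "\<delta> > 0"
  shows "uniformly_close \<delta> u u"
proof -
  have "has_match \<delta> u u {a..<a + m} {a..<a + m} ((1 - \<delta>) * real m - 0)" for a m
    unfolding has_match_def
  proof (intro exI conjI)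
    let ?Q = "(\<lambda>i. (i, i)) ` {a..<a + m}"
    show "?Q \<subseteq> {a..<a + m} \<times> {a..<a + m}" by auto
    show "order_matching ?Q" unfolding order_matching_def by auto
    show "\<forall>(i, j)\<in>?Q. dist (u i) (u j) < \<delta>" using assms by auto
    have "card ?Q = m" by (subst card_image) (auto simp: inj_on_def)
    then show "(1 - \<delta>) * real m - 0 \<le> real (card ?Q)" using assms by (simp add: algebra_simps)
  qed
  then show ?thesis unfolding uniformly_close_def by blast
qed

section \<open>From matchings to the Feldman-Katok distance\<close>

lemma fbar_n_le:
  assumes "has_match \<delta> u v {..<n} {..<n} k" "n > 0"
  shows "fbar_n n \<delta> u v \<le> 1 - k / real n"
proof -
  obtain Q where Q: "Q \<subseteq> {..<n} \<times> {..<n}" "order_matching Q" "\<forall>(i, j)\<in>Q. dist (u i) (v j) < \<delta>" "k \<le> real (card Q)"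
    using assms(1) unfolding has_match_def by blast
  have ord: "i < i' \<longleftrightarrow> j < j'" if "(i, j) \<in> Q" "(i', j') \<in> Q" for i j i' j'
    using Q(2) that unfolding order_matching_def by blast
  have fun1: "j = j'" if "(i, j) \<in> Q" "(i, j') \<in> Q" for i j j'
    using ord[OF that] ord[OF that(2,1)] by auto
  have fun2: "i = i'" if "(i, j) \<in> Q" "(i', j) \<in> Q" for i i' j
    using ord[OF that] ord[OF that(2,1)] by auto
  define \<pi> where "\<pi> i = (THE j. (i, j) \<in> Q)" for i
  have \<pi>: "\<pi> i = j" if "(i, j) \<in> Q" for i j
    unfolding \<pi>_def using that fun1 by (intro the_equality) auto
  define S where "S = {card D | D R \<pi>. is_match n \<delta> u v D R \<pi>}"
  have "is_match n \<delta> u v (fst ` Q) (snd ` Q) \<pi>"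
    unfolding is_match_def
  proof (intro conjI ballI)
    show "fst ` Q \<subseteq> {..<n}" "snd ` Q \<subseteq> {..<n}" using Q(1) by auto
    show "strict_mono_on (fst ` Q) \<pi>"
      by (rule strict_mono_onI) (use \<pi> ord in fastforce)
    show "bij_betw \<pi> (fst ` Q) (snd ` Q)"
      unfolding bij_betw_def inj_on_def using \<pi> fun2 by (auto simp: image_iff) (metis fst_conv snd_conv)+
    show "dist (u i) (v (\<pi> i)) < \<delta>" if "i \<in> fst ` Q" for i using that \<pi> Q(3) by auto
  qed
  then have "card (fst ` Q) \<in> S" unfolding S_def by blast
  moreover have "card (fst ` Q) = card Q"
    by (rule card_image) (use fun1 in \<open>auto simp: inj_on_def\<close>)
  moreover have "finite S"
  proof (rule finite_subset)
    show "S \<subseteq> {..n}" unfolding S_def is_match_def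
      using card_mono[of "{..<n}"] by fastforce
  qed simp
  ultimately have "card Q \<le> Max S" by (metis Max_ge)
  then have "k \<le> real (Max S)" using Q(4) by linarith
  then show ?thesis unfolding fbar_n_def S_def[symmetric] using assms(2) by (simp add: divide_right_mono)
qed

lemma fk_le:
  assumes ev: "\<forall>\<^sub>F n in sequentially. has_match \<delta> u v {..<n} {..<n} ((1 - \<delta>') * real n)"
    and \<delta>: "0 < \<delta>" "\<delta>' < \<delta>"
  shows "fk u v \<le> \<delta>"
proof -
  have "\<forall>\<^sub>F n in sequentially. ereal (fbar_n n \<delta> u v) \<le> ereal \<delta>'"
    using ev eventually_gt_at_top[of 0]
  proof eventually_elim
    case (elim n)
    then show ?case using fbar_n_le[OF elim] by simp
  qed
  then have "fbar \<delta> u v \<le> ereal \<delta>'" unfolding fbar_def by (rule Limsup_bounded)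
  also have "\<dots> < ereal \<delta>" using \<delta>(2) by simp
  finally have "\<delta> \<in> {\<delta>. \<delta> > 0 \<and> fbar \<delta> u v < ereal \<delta>}" using \<delta>(1) by simp
  then show ?thesis unfolding fk_def by (rule cInf_lower) (auto intro!: bdd_belowI[of _ 0])
qed

text \<open>The lower bound passes to the infimum only if the set is nonempty. It contains
  \<open>2\<close>, because the empty match already gives \<open>fbar 2 u v \<le> 1\<close>.\<close>

lemma fk_nonneg: "fk u v \<ge> 0"
proof -
  have "\<forall>\<^sub>F n in sequentially. ereal (fbar_n n 2 u v) \<le> ereal 1"
    using eventually_gt_at_top[of 0]
  proof eventually_elim
    case (elim n)
    show ?case using fbar_n_le[OF has_match_empty[OF order_refl] elim] by simp
  qed
  then have "fbar 2 u v \<le> ereal 1" unfolding fbar_def by (rule Limsup_bounded)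
  also have "\<dots> < ereal 2" by simp
  finally have "{\<delta>. \<delta> > 0 \<and> fbar \<delta> u v < ereal \<delta>} \<noteq> {}" by (auto intro!: exI[of _ 2])
  then show ?thesis unfolding fk_def by (intro cInf_greatest) auto
qed

text \<open>The constant loss is eventually at most \<open>\<delta> * n\<close>. The resulting
  defect \<open>2 * \<delta>\<close> must stay strictly below the parameter of \<open>fbar\<close>,
  whence \<open>3 * \<delta>\<close>.\<close>

lemma uniformly_close_fk:
  assumes "uniformly_close \<delta> u v" "0 < \<delta>"
  shows "fk u v \<le> 3 * \<delta>"
proof -
  obtain C where C: "\<And>a m. has_match \<delta> u v {a..<a + m} {a..<a + m} ((1 - \<delta>) * real m - C)"
    using assms(1) unfolding uniformly_close_def by blast
  have "\<forall>\<^sub>F n in sequentially. C / \<delta> \<le> real n"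
    using filterlim_real_sequentially unfolding filterlim_at_top by blast
  then have "\<forall>\<^sub>F n in sequentially. has_match (3 * \<delta>) u v {..<n} {..<n} ((1 - 2 * \<delta>) * real n)"
  proof eventually_elim
    case (elim n)
    have "C \<le> \<delta> * real n" using elim assms(2) by (simp add: pos_divide_le_eq mult.commute)
    then have "(1 - 2 * \<delta>) * real n \<le> (1 - \<delta>) * real n - C" by (simp add: algebra_simps)
    then show ?case
      using C[of 0 n] assms(2) by (elim has_match_mono) auto
  qed
  then show ?thesis using assms(2) by (intro fk_le) auto
qed

text \<open>The partial products \<open>P n\<close> decrease to some \<open>L > 0\<close>. Each
  \<open>L * (1 - \<kappa> i)\<close> is at most \<open>P i - P (Suc i)\<close>, and these decreases
  telescope to at most \<open>1\<close>. A tail product is \<open>P m / P n \<ge> L / P n\<close>,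
  and \<open>P n < L * (1 + \<epsilon>)\<close> for large \<open>n\<close>.\<close>

lemma prod_tails:
  fixes \<kappa> :: "nat \<Rightarrow> real"
  assumes \<kappa>: "\<And>n. 0 < \<kappa> n" "\<And>n. \<kappa> n \<le> 1" and conv: "convergent_prod \<kappa>"
  shows "summable (\<lambda>n. 1 - \<kappa> n)"
    and "\<epsilon> > 0 \<Longrightarrow> \<exists>N. \<forall>n\<ge>N. \<forall>m\<ge>n. prod \<kappa> {n..<m} \<ge> 1 - \<epsilon>"
proof -
  define P where "P n = prod \<kappa> {..<n}" for n
  define L where "L = prodinf \<kappa>"
  have "(\<lambda>n. P (Suc n)) \<longlonglongrightarrow> L"
    unfolding P_def L_def lessThan_Suc_atMost by (rule convergent_prod_LIMSEQ[OF conv])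
  then have lim: "P \<longlonglongrightarrow> L" by (simp only: filterlim_sequentially_Suc)
  have P_Suc: "P (Suc n) = P n * \<kappa> n" for n unfolding P_def by simp
  have P_pos: "P n > 0" for n unfolding P_def using \<kappa>(1) by (simp add: prod_pos)
  have dec: "decseq P"
    unfolding decseq_Suc_iff P_Suc using P_pos \<kappa>(2) by (simp add: mult_left_le less_imp_le)
  have L_le: "L \<le> P n" for n using decseq_ge[OF dec lim] .
  have "L \<noteq> 0" unfolding L_def using conv \<kappa>(1) by (intro prodinf_nonzero) (auto simp: less_imp_neq[symmetric])
  moreover have "L \<ge> 0" using P_pos by (intro LIMSEQ_le_const[OF lim]) (auto intro: less_imp_le)
  ultimately have L: "L > 0" by simp
  show "summable (\<lambda>n. 1 - \<kappa> n)"
  proof (rule summableI_nonneg_bounded)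
    show "0 \<le> 1 - \<kappa> n" for n using \<kappa>(2) by simp
    show "(\<Sum>i<n. 1 - \<kappa> i) \<le> 1 / L" for n
    proof -
      have "(\<Sum>i<n. L * (1 - \<kappa> i)) \<le> (\<Sum>i<n. P i - P (Suc i))"
      proof (rule sum_mono)
        fix i
        have "L * (1 - \<kappa> i) \<le> P i * (1 - \<kappa> i)" using L_le \<kappa>(2) by (intro mult_right_mono) auto
        then show "L * (1 - \<kappa> i) \<le> P i - P (Suc i)" unfolding P_Suc by (simp add: algebra_simps)
      qed
      also have "\<dots> = P 0 - P n" by (rule sum_lessThan_telescope')
      also have "\<dots> \<le> 1" using P_pos[of n] unfolding P_def by simp
      finally have "L * (\<Sum>i<n. 1 - \<kappa> i) \<le> 1" by (simp only: sum_distrib_left)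
      then show ?thesis using L by (simp add: pos_le_divide_eq mult.commute)
    qed
  qed
  show "\<exists>N. \<forall>n\<ge>N. \<forall>m\<ge>n. prod \<kappa> {n..<m} \<ge> 1 - \<epsilon>" if "\<epsilon> > 0"
  proof -
    have "\<forall>\<^sub>F n in sequentially. P n < L * (1 + \<epsilon>)"
      using lim L that by (intro order_tendstoD) auto
    then obtain N where N: "\<And>n. n \<ge> N \<Longrightarrow> P n < L * (1 + \<epsilon>)" unfolding eventually_sequentially by blast
    have "prod \<kappa> {n..<m} \<ge> 1 - \<epsilon>" if nm: "n \<ge> N" "m \<ge> n" for n m
    proof -
      have "{..<m} = {..<n} \<union> {n..<m}" using nm by auto
      then have eq: "P m = P n * prod \<kappa> {n..<m}" unfolding P_def by (simp add: prod.union_disjoint ivl_disj_int)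
      have "(1 - \<epsilon>) * P n \<le> L"
      proof (cases "\<epsilon> \<le> 1")
        case True
        then have "(1 - \<epsilon>) * P n \<le> (1 - \<epsilon>) * (L * (1 + \<epsilon>))" using N[OF nm(1)] by (intro mult_left_mono) auto
        also have "\<dots> = L - L * \<epsilon>\<^sup>2" by (simp add: algebra_simps power2_eq_square)
        also have "\<dots> \<le> L" using L by simp
        finally show ?thesis .
      next
        case False
        then have "(1 - \<epsilon>) * P n \<le> 0" using P_pos[of n] by (intro mult_nonpos_nonneg) auto
        then show ?thesis using L by simp
      qed
      also have "\<dots> \<le> P m" by (rule L_le)
      finally have "(1 - \<epsilon>) * P n \<le> prod \<kappa> {n..<m} * P n" unfolding eq by (simp add: mult.commute)
      then show ?thesis using P_pos[of n] by simp
    qed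
    then show ?thesis by blast
  qed
qed

section \<open>Closeness along a GIKN sequence\<close>

lemma good_approximation_le_1:
  assumes "good_approximation T \<gamma> \<kappa> \<Gamma> \<Lambda>" "finite \<Gamma>"
  shows "\<kappa> \<le> 1"
proof -
  obtain \<Delta> where "\<Delta> \<subseteq> \<Gamma>" "\<kappa> \<le> real (card \<Delta>) / real (card \<Gamma>)"
    using assms(1) by (rule good_approximationE)
  moreover have "real (card \<Delta>) / real (card \<Gamma>) \<le> 1"
    using card_mono[OF assms(2) \<open>\<Delta> \<subseteq> \<Gamma>\<close>] by (cases "card \<Gamma> = 0") (simp_all add: divide_le_eq_1)
  ultimately show ?thesis by linarith
qed

lemma GIKN_sequenceE:
  assumes "GIKN_sequence T \<Gamma>"
  obtains \<gamma> \<kappa> where "\<And>n. periodic_orbit T (\<Gamma> n)" "incseq (\<lambda>n. card (\<Gamma> n))"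
    "filterlim (\<lambda>n. card (\<Gamma> n)) at_top sequentially"
    "\<And>n. 0 < \<gamma> n" "\<And>n. 0 < \<kappa> n" "\<And>n. \<kappa> n \<le> 1"
    "\<And>n. good_approximation T (\<gamma> n) (\<kappa> n) (\<Gamma> (Suc n)) (\<Gamma> n)" "summable \<gamma>" "convergent_prod \<kappa>"
proof -
  from assms obtain \<gamma> \<kappa> where *: "\<forall>n. periodic_orbit T (\<Gamma> n)" "incseq (\<lambda>n. card (\<Gamma> n))"
    "filterlim (\<lambda>n. card (\<Gamma> n)) at_top sequentially" "\<forall>n. \<gamma> n > 0" "\<forall>n. \<kappa> n > 0"
    "\<forall>n. good_approximation T (\<gamma> n) (\<kappa> n) (\<Gamma> (Suc n)) (\<Gamma> n)" "summable \<gamma>" "convergent_prod \<kappa>"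
    unfolding GIKN_sequence_def by (elim exE conjE)
  have "\<kappa> n \<le> 1" for n
    using good_approximation_le_1[OF *(6)[rule_format]] periodic_orbit_finite[OF *(1)[rule_format]] .
  then show ?thesis using that[of \<gamma> \<kappa>] * by simp
qed

lemma GIKN_good_approximation:
  assumes orbit: "\<And>n. periodic_orbit T (\<Gamma> n)" and inc: "incseq (\<lambda>n. card (\<Gamma> n))"
    and \<kappa>: "\<And>n. 0 < \<kappa> n" and good: "\<And>n. good_approximation T (\<gamma> n) (\<kappa> n) (\<Gamma> (Suc n)) (\<Gamma> n)"
    and "n < m"
  shows "good_approximation T (sum \<gamma> {n..<m}) (prod \<kappa> {n..<m}) (\<Gamma> m) (\<Gamma> n)"
  using \<open>n < m\<close>
proof (induction m)
  case (Suc m)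
  show ?case
  proof (cases "n = m")
    case True
    then show ?thesis using good by simp
  next
    case False
    then have nm: "n < m" using Suc.prems by simp
    have "good_approximation T (sum \<gamma> {n..<m} + \<gamma> m) (prod \<kappa> {n..<m} * \<kappa> m) (\<Gamma> (Suc m)) (\<Gamma> n)"
    proof (rule good_approximation_trans[OF Suc.IH[OF nm] good])
      show "card (\<Gamma> n) \<le> card (\<Gamma> m)" using incseqD[OF inc] nm by simp
      show "0 \<le> prod \<kappa> {n..<m}" using \<kappa> by (intro prod_nonneg) (simp add: less_imp_le)
      show "card (\<Gamma> m) > 0"
        using periodic_orbit_trajectory(2)[OF orbit] periodic_orbit_nonempty[OF orbit] by blast
    qed (use orbit \<kappa> in \<open>auto intro: periodic_orbit_finite less_imp_le\<close>)
    then show ?thesis using nm by simp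
  qed
qed simp

lemma GIKN_uniformly_close:
  fixes T :: "'a::metric_space \<Rightarrow> 'a"
  assumes "GIKN_sequence T \<Gamma>" "\<delta> > 0" and x: "\<And>n. x n \<in> \<Gamma> n"
  shows "\<exists>N. \<forall>n\<ge>N. \<forall>m\<ge>N. uniformly_close \<delta> (trajectory T (x m)) (trajectory T (x n))"
proof -
  obtain \<gamma> \<kappa> where orbit: "\<And>n. periodic_orbit T (\<Gamma> n)" and inc: "incseq (\<lambda>n. card (\<Gamma> n))"
    and lim: "filterlim (\<lambda>n. card (\<Gamma> n)) at_top sequentially"
    and \<gamma>: "\<And>n. 0 < \<gamma> n" and \<kappa>: "\<And>n. 0 < \<kappa> n" "\<And>n. \<kappa> n \<le> 1"
    and good: "\<And>n. good_approximation T (\<gamma> n) (\<kappa> n) (\<Gamma> (Suc n)) (\<Gamma> n)"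
    and "summable \<gamma>" "convergent_prod \<kappa>"
    using assms(1) by (rule GIKN_sequenceE) blast
  obtain \<epsilon> P where \<epsilon>: "\<epsilon> > 0" and close:
    "\<And>(T :: 'a \<Rightarrow> 'a) \<Gamma> \<Lambda> \<gamma> \<kappa> y x. periodic_orbit T \<Gamma> \<Longrightarrow> periodic_orbit T \<Lambda> \<Longrightarrow> good_approximation T \<gamma> \<kappa> \<Gamma> \<Lambda> \<Longrightarrow>
       0 < \<gamma> \<Longrightarrow> \<gamma> \<le> \<epsilon> \<Longrightarrow> \<kappa> \<ge> 1 - \<epsilon> \<Longrightarrow> card \<Lambda> \<ge> P \<Longrightarrow> y \<in> \<Gamma> \<Longrightarrow> x \<in> \<Lambda> \<Longrightarrow>
       uniformly_close \<delta> (trajectory T y) (trajectory T x)"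
    using good_approximation_uniformly_close[OF \<open>\<delta> > 0\<close>, where 'a = 'a] by blast
  obtain N1 where N1: "\<And>m n. m \<ge> N1 \<Longrightarrow> norm (sum \<gamma> {m..<n}) < \<epsilon>"
    using \<open>summable \<gamma>\<close> \<epsilon> unfolding summable_Cauchy by blast
  obtain N2 where N2: "\<And>n m. n \<ge> N2 \<Longrightarrow> m \<ge> n \<Longrightarrow> prod \<kappa> {n..<m} \<ge> 1 - \<epsilon>"
    using prod_tails(2)[OF \<kappa> \<open>convergent_prod \<kappa>\<close> \<epsilon>] by blast
  obtain N3 where N3: "\<And>n. n \<ge> N3 \<Longrightarrow> P \<le> card (\<Gamma> n)"
    using lim unfolding filterlim_at_top eventually_sequentially by blast
  define N where "N = max N1 (max N2 N3)"
  have less: "uniformly_close \<delta> (trajectory T (x m)) (trajectory T (x n))" if "n \<ge> N" "n < m" for n m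
  proof (rule close[OF orbit orbit GIKN_good_approximation[OF orbit inc \<kappa>(1) good that(2)]])
    show "0 < sum \<gamma> {n..<m}" using that \<gamma> by (intro sum_pos) auto
    show "sum \<gamma> {n..<m} \<le> \<epsilon>" using N1[of n m] that unfolding N_def by simp
    show "1 - \<epsilon> \<le> prod \<kappa> {n..<m}" using N2[of n m] that unfolding N_def by simp
    show "P \<le> card (\<Gamma> n)" using N3[of n] that unfolding N_def by simp
  qed (rule x)+
  have "uniformly_close \<delta> (trajectory T (x m)) (trajectory T (x n))" if "n \<ge> N" "m \<ge> N" for n m
  proof -
    consider "n < m" | "n = m" | "m < n" by linarith
    then show ?thesis
    proof cases
      case 1 then show ?thesis by (rule less[OF that(1)])
    next
      case 2 show ?thesis unfolding 2 by (rule uniformly_close_refl[OF \<open>\<delta> > 0\<close>])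
    next
      case 3 then show ?thesis by (rule uniformly_close_sym[OF less[OF that(2)]])
    qed
  qed
  then show ?thesis by blast
qed

lemma GIKN_fk_Cauchy:
  fixes T :: "'a::metric_space \<Rightarrow> 'a"
  assumes "GIKN_sequence T \<Gamma>" "\<And>n. x n \<in> \<Gamma> n"
  shows "fk_Cauchy T x"
  unfolding fk_Cauchy_def fk_point_def
proof (intro allI impI)
  fix \<epsilon> :: real assume "\<epsilon> > 0"
  then obtain N where N: "\<forall>n\<ge>N. \<forall>m\<ge>N. uniformly_close (\<epsilon> / 6) (trajectory T (x m)) (trajectory T (x n))"
    using GIKN_uniformly_close[where \<delta> = "\<epsilon> / 6", OF assms(1) _ assms(2)] by auto
  have "fk (trajectory T (x m)) (trajectory T (x n)) < \<epsilon>" if "m \<ge> N" "n \<ge> N" for m n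
    using uniformly_close_fk[of "\<epsilon> / 6" "trajectory T (x m)" "trajectory T (x n)"] N that \<open>\<epsilon> > 0\<close> by simp
  then show "\<exists>N. \<forall>m\<ge>N. \<forall>n\<ge>N. fk (trajectory T (x m)) (trajectory T (x n)) < \<epsilon>" by blast
qed

section \<open>Concatenation of orbit segments\<close>

lemma has_match_cong:
  assumes "has_match \<delta> u v A B k" "\<And>i. i \<in> A \<Longrightarrow> u i = u' i"
  shows "has_match \<delta> u' v A B k"
proof -
  obtain Q where Q: "Q \<subseteq> A \<times> B" "order_matching Q" "\<forall>(i, j)\<in>Q. dist (u i) (v j) < \<delta>" "k \<le> real (card Q)"
    using assms(1) unfolding has_match_def by blast
  have "\<forall>(i, j)\<in>Q. dist (u' i) (v j) < \<delta>"
  proof clarify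
    fix i j assume "(i, j) \<in> Q"
    then have "i \<in> A" "dist (u i) (v j) < \<delta>" using Q(1,3) by auto
    then show "dist (u' i) (v j) < \<delta>" using assms(2)[of i] by simp
  qed
  then show ?thesis unfolding has_match_def using Q by blast
qed

section \<open>Averages along periodic orbits\<close>

lemma integral_empirical_measure:
  fixes f :: "'a::metric_space \<Rightarrow> real"
  assumes "f \<in> borel_measurable borel"
  shows "integral\<^sup>L (empirical_measure x n) f = (\<Sum>j<n. f (x j)) / real n"
proof -
  have "x \<in> measurable (uniform_count_measure {..<n}) borel"
    by (auto simp: measurable_def space_uniform_count_measure sets_uniform_count_measure)
  from integral_distr[OF this assms] show ?thesis
    unfolding empirical_measure_def by (simp add: integral_uniform_count_measure)
qed

lemma integral_orbit_measure:
  fixes f :: "'a::metric_space \<Rightarrow> real"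
  assumes "f \<in> borel_measurable borel" "finite \<Gamma>"
  shows "integral\<^sup>L (orbit_measure \<Gamma>) f = (\<Sum>y\<in>\<Gamma>. f y) / real (card \<Gamma>)"
proof -
  have "(\<lambda>x. x) \<in> measurable (uniform_count_measure \<Gamma>) borel"
    by (auto simp: measurable_def space_uniform_count_measure sets_uniform_count_measure)
  from integral_distr[OF this assms(1)] show ?thesis
    unfolding orbit_measure_def by (simp add: integral_uniform_count_measure assms(2))
qed

lemma borel_prob_orbit_measure:
  assumes "finite \<Gamma>" "\<Gamma> \<noteq> {}"
  shows "borel_prob (orbit_measure (\<Gamma> :: 'a::metric_space set))"
proof -
  interpret prob_space "uniform_count_measure \<Gamma>" using assms by (rule prob_space_uniform_count_measure)
  have "(\<lambda>x. x) \<in> measurable (uniform_count_measure \<Gamma>) borel"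
    by (auto simp: measurable_def space_uniform_count_measure sets_uniform_count_measure)
  then show ?thesis unfolding borel_prob_def orbit_measure_def by (simp add: prob_space_distr)
qed

lemma continuous_borel_measurable:
  fixes f :: "'a::metric_space \<Rightarrow> real"
  shows "continuous_on UNIV f \<Longrightarrow> f \<in> borel_measurable borel"
  by (rule borel_measurable_continuous_onI)

text \<open>Full periods have exactly the orbit average, so only one incomplete period is left to
  estimate. The error depends neither on \<open>a\<close> nor on \<open>m\<close>, so it can be
  charged to a segment as a fixed cost.\<close>

lemma orbit_average:
  fixes f :: "'a::metric_space \<Rightarrow> real"
  assumes orbit: "periodic_orbit T \<Gamma>" "y \<in> \<Gamma>" and F: "\<And>z. \<bar>f z\<bar> \<le> F"
  shows "\<bar>(\<Sum>j\<in>{a..<a + m}. f (trajectory T y j)) - real m * ((\<Sum>z\<in>\<Gamma>. f z) / real (card \<Gamma>))\<bar>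
    \<le> 2 * F * real (card \<Gamma>)"
proof -
  note orb = periodic_orbit_trajectory[OF orbit]
  define q where "q = card \<Gamma>"
  define g where "g j = f (trajectory T y j)" for j
  define A where "A = (\<Sum>z\<in>\<Gamma>. f z) / real q"
  have q: "q > 0" using orb(2) unfolding q_def .
  have F0: "F \<ge> 0" using F[of y] by simp
  have "\<bar>\<Sum>z\<in>\<Gamma>. f z\<bar> \<le> (\<Sum>z\<in>\<Gamma>. F)" by (rule order_trans[OF sum_abs sum_mono]) (rule F)
  then have A: "\<bar>A\<bar> \<le> F" unfolding A_def q_def using orb(2) by (simp add: field_simps)
  have per: "g (t + q) = g t" for t unfolding g_def q_def orb(3) ..
  have period: "sum g {b..<b + q} = real q * A" for b
  proof -
    have "sum g {b..<b + q} = sum g {..<q}" using per by (rule sum_periodic_window)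
    also have "\<dots> = (\<Sum>z\<in>\<Gamma>. f z)"
      unfolding g_def using sum.reindex_bij_betw[OF orb(4), of f] by (simp add: q_def)
    finally show ?thesis unfolding A_def using q by simp
  qed
  have periods: "sum g {a..<a + d * q} = real (d * q) * A" for d
  proof (induction d)
    case (Suc d)
    have "sum g {a..<a + Suc d * q} = sum g {a..<a + d * q} + sum g {a + d * q..<a + d * q + q}"
      by (subst sum.atLeastLessThan_concat) (simp_all add: algebra_simps)
    then show ?case unfolding Suc period by (simp add: algebra_simps)
  qed simp
  define d where "d = m div q"
  define r where "r = m mod q"
  have m: "m = d * q + r" and r: "r < q" unfolding d_def r_def using q by simp_all
  have "sum g {a..<a + m} = sum g {a..<a + d * q} + sum g {a + d * q..<a + m}"
    by (subst sum.atLeastLessThan_concat) (simp_all add: m)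
  then have "sum g {a..<a + m} - real m * A = sum g {a + d * q..<a + m} - real r * A"
    unfolding periods by (simp add: m algebra_simps)
  moreover have "\<bar>sum g {a + d * q..<a + m}\<bar> \<le> F * real q"
  proof -
    have "\<bar>sum g {a + d * q..<a + m}\<bar> \<le> (\<Sum>j\<in>{a + d * q..<a + m}. F)"
      unfolding g_def by (rule order_trans[OF sum_abs sum_mono]) (rule F)
    also have "\<dots> = F * real r" by (simp add: m)
    also have "\<dots> \<le> F * real q" using r F0 by (intro mult_left_mono) auto
    finally show ?thesis .
  qed
  moreover have "\<bar>real r * A\<bar> \<le> F * real q"
  proof -
    have "\<bar>real r * A\<bar> = real r * \<bar>A\<bar>" by (simp add: abs_mult)
    also have "\<dots> \<le> real q * F" using r A by (intro mult_mono) auto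
    finally show ?thesis by (simp add: mult.commute)
  qed
  ultimately have "\<bar>sum g {a..<a + m} - real m * A\<bar> \<le> F * real q + F * real q" by linarith
  then show ?thesis unfolding g_def A_def q_def by simp
qed

lemma compact_bounded_real:
  fixes f :: "'a::metric_space \<Rightarrow> real"
  assumes "compact (UNIV :: 'a set)" "continuous_on UNIV f"
  obtains F where "\<And>z. \<bar>f z\<bar> \<le> F" "F \<ge> 0"
proof -
  have "bounded (range f)" using compact_continuous_image[OF assms(2,1)] by (rule compact_imp_bounded)
  then obtain F where F: "\<And>z. \<bar>f z\<bar> \<le> F" unfolding bounded_iff by auto
  moreover have "F \<ge> 0" using F[of undefined] by simp
  ultimately show ?thesis using that by blast
qed

lemma genericI:
  fixes z :: "nat \<Rightarrow> 'a::metric_space"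
  assumes "borel_prob \<mu>"
    and "\<And>f :: 'a \<Rightarrow> real. continuous_on UNIV f \<Longrightarrow> (\<lambda>n. (\<Sum>j<n. f (z j)) / real n) \<longlonglongrightarrow> integral\<^sup>L \<mu> f"
  shows "generic z \<mu>"
  unfolding generic_def weak_star_tendsto_def
  using assms by (simp add: integral_empirical_measure continuous_borel_measurable)

lemma generic_orbit:
  fixes T :: "'a::metric_space \<Rightarrow> 'a"
  assumes "compact (UNIV :: 'a set)" "periodic_orbit T \<Gamma>" "y \<in> \<Gamma>"
  shows "generic (trajectory T y) (orbit_measure \<Gamma>)"
proof (rule genericI)
  have fin: "finite \<Gamma>" and ne: "\<Gamma> \<noteq> {}" using assms(2,3) periodic_orbit_finite by auto
  then show "borel_prob (orbit_measure \<Gamma>)" by (rule borel_prob_orbit_measure)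
  fix f :: "'a \<Rightarrow> real" assume f: "continuous_on UNIV f"
  obtain F where F: "\<And>z. \<bar>f z\<bar> \<le> F" "F \<ge> 0" using compact_bounded_real[OF assms(1) f] by blast
  define A where "A = (\<Sum>z\<in>\<Gamma>. f z) / real (card \<Gamma>)"
  have "(\<lambda>n. (\<Sum>j<n. f (trajectory T y j)) / real n) \<longlonglongrightarrow> A"
  proof (rule LIM_zero_cancel, rule Lim_null_comparison)
    show "\<forall>\<^sub>F n in sequentially. norm ((\<Sum>j<n. f (trajectory T y j)) / real n - A) \<le> 2 * F * real (card \<Gamma>) / real n"
      using eventually_gt_at_top[of 0]
    proof eventually_elim
      case (elim n)
      have "(\<Sum>j<n. f (trajectory T y j)) / real n - A = ((\<Sum>j<n. f (trajectory T y j)) - real n * A) / real n"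
        using elim by (simp add: field_simps)
      moreover have "\<bar>(\<Sum>j<n. f (trajectory T y j)) - real n * A\<bar> \<le> 2 * F * real (card \<Gamma>)"
        using orbit_average[OF assms(2,3) F(1), where a = 0 and m = n] unfolding A_def by (simp add: lessThan_atLeast0)
      ultimately show ?case by (simp add: abs_divide divide_right_mono)
    qed
    show "(\<lambda>n. 2 * F * real (card \<Gamma>) / real n) \<longlonglongrightarrow> 0" by (rule lim_const_over_n)
  qed
  then show "(\<lambda>n. (\<Sum>j<n. f (trajectory T y j)) / real n) \<longlonglongrightarrow> integral\<^sup>L (orbit_measure \<Gamma>) f"
    unfolding A_def using f fin by (simp add: integral_orbit_measure continuous_borel_measurable)
qed

lemma quasi_orbitI:
  assumes "(\<lambda>n. real (card ({n. z (Suc n) \<noteq> T (z n)} \<inter> {..<n})) / real n) \<longlonglongrightarrow> 0"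
  shows "quasi_orbit T z"
proof -
  have "(\<lambda>n. ereal (real (card ({n. z (Suc n) \<noteq> T (z n)} \<inter> {..<n})) / real n)) \<longlonglongrightarrow> ereal 0"
    using assms by (rule tendsto_ereal)
  then show ?thesis unfolding quasi_orbit_def upper_density_def zero_ereal_def
    by (intro lim_imp_Limsup) auto
qed

lemma quasi_orbit_trajectory: "quasi_orbit T (trajectory T x)"
  by (rule quasi_orbitI) (simp add: trajectory_Suc)

text \<open>\<open>c k\<close> is a cost charged to the \<open>k\<close>-th segment, to be chosen
  large enough for every estimate on it. Costs of at least \<open>1\<close> also pay for the breaks
  of the quasi-orbit between segments.\<close>

locale concatenation =
  fixes T :: "'a::metric_space \<Rightarrow> 'a" and x :: "nat \<Rightarrow> 'a" and c :: "nat \<Rightarrow> nat"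
  assumes c_pos: "c k \<ge> 1"
begin

definition weight :: "nat \<Rightarrow> nat" where
  "weight k = (\<Sum>j\<le>k. c j)"

text \<open>If the \<open>k\<close>-th segment contributes an error of \<open>c k\<close>, the errors up to time \<open>n\<close> add up to the
  weight of the current segment, which is at most \<open>n\<close> divided by the number of the segment.\<close>
definition start :: "nat \<Rightarrow> nat" where
  "start k = k * weight k"

definition seg :: "nat \<Rightarrow> nat" where
  "seg j = (LEAST k. j < start (Suc k))"

text \<open>The time is not reset at the beginning of a segment. Hence a segment agrees with the
  trajectory of its base point on the same window of indices, and the matches of all segments with
  one sequence \<open>v\<close> can be put side by side.\<close>

definition concat_orbit :: "nat \<Rightarrow> 'a" where
  "concat_orbit j = trajectory T (x (seg j)) j"

lemma weight_Suc: "weight (Suc k) = weight k + c (Suc k)"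
  unfolding weight_def by simp

lemma c_le_weight: "real (c k) \<le> real (weight k)"
proof -
  have "c k \<le> weight k" unfolding weight_def by (rule member_le_sum) simp_all
  then show ?thesis by simp
qed

lemma weight_ge: "weight k \<ge> k + 1"
proof (induction k)
  case 0
  show ?case using c_pos[of 0] unfolding weight_def by simp
next
  case (Suc k)
  then show ?case using c_pos[of "Suc k"] unfolding weight_Suc by simp
qed

lemma start_less: "start k < start (Suc k)"
proof -
  have "k * weight k \<le> k * weight (Suc k)" unfolding weight_Suc by simp
  moreover have "Suc k * weight (Suc k) = weight (Suc k) + k * weight (Suc k)" by simp
  ultimately show ?thesis unfolding start_def using weight_ge[of "Suc k"] by linarith
qed

lemma start_strict_mono: "strict_mono start"
  using start_less by (rule strict_monoI_Suc)

lemma start_ge: "start k \<ge> k"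
  unfolding start_def using weight_ge[of k] by simp

lemma seg_upper: "j < start (Suc (seg j))"
  unfolding seg_def
proof (rule LeastI)
  show "j < start (Suc j)" using start_ge[of "Suc j"] by simp
qed

lemma seg_lower: "start (seg j) \<le> j"
proof (cases "seg j")
  case 0
  then show ?thesis unfolding start_def by simp
next
  case (Suc k)
  then have "\<not> j < start (Suc k)" using not_less_Least[of k "\<lambda>k. j < start (Suc k)"] unfolding seg_def by simp
  then show ?thesis using Suc by simp
qed

lemma seg_eq:
  assumes "start k \<le> j" "j < start (Suc k)"
  shows "seg j = k"
proof (rule antisym)
  show "seg j \<le> k" unfolding seg_def using assms(2) by (rule Least_le)
  have "start k < start (Suc (seg j))" using assms(1) seg_upper[of j] by simp
  then show "k \<le> seg j" using strict_mono_less[OF start_strict_mono] by simp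
qed

lemma seg_mono: "i \<le> j \<Longrightarrow> seg i \<le> seg j"
proof -
  assume "i \<le> j"
  then have "start (seg i) < start (Suc (seg j))" using seg_lower[of i] seg_upper[of j] by linarith
  then show ?thesis using strict_mono_less[OF start_strict_mono] by simp
qed

lemma concat_orbit_segment: "start k \<le> j \<Longrightarrow> j < start (Suc k) \<Longrightarrow> concat_orbit j = trajectory T (x k) j"
  unfolding concat_orbit_def using seg_eq by simp

lemma weight_seg_tendsto: "(\<lambda>n. real (weight (seg n)) / real n) \<longlonglongrightarrow> 0"
proof (rule LIMSEQ_I)
  fix \<epsilon> :: real assume "\<epsilon> > 0"
  obtain K :: nat where K: "1 / \<epsilon> < real K" using reals_Archimedean2 by blast
  then have K0: "K > 0" using \<open>\<epsilon> > 0\<close> by (metis gr0I of_nat_0 less_asym zero_less_divide_1_iff)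
  show "\<exists>N. \<forall>n\<ge>N. norm (real (weight (seg n)) / real n - 0) < \<epsilon>"
  proof (intro exI allI impI)
    fix n assume n: "n \<ge> start K"
    then have "seg n \<ge> seg (start K)" by (rule seg_mono)
    moreover have "seg (start K) = K" using start_less by (intro seg_eq) auto
    ultimately have "K \<le> seg n" by simp
    have "K * weight (seg n) \<le> seg n * weight (seg n)" using \<open>K \<le> seg n\<close> by simp
    also have "\<dots> \<le> n" using seg_lower[of n] unfolding start_def .
    finally have "real (K * weight (seg n)) \<le> real n" by (rule of_nat_mono)
    then have le: "real K * real (weight (seg n)) \<le> real n" by simp
    have "n > 0" using n start_ge[of K] K0 by simp
    have "real (weight (seg n)) / real n \<le> 1 / real K"
      using le K0 \<open>n > 0\<close> by (simp add: field_simps)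
    also have "\<dots> < \<epsilon>" using K \<open>\<epsilon> > 0\<close> K0 by (simp add: field_simps)
    finally show "norm (real (weight (seg n)) / real n - 0) < \<epsilon>" by simp
  qed
qed

text \<open>Both ends of a segment are allowed for \<open>n\<close>, so that a statement reached at
  \<open>start (Suc k)\<close> can be handed to the next segment; this is why the number of the
  segment is a separate argument of \<open>P\<close>.\<close>

lemma segment_induct [consumes 1, case_names base step]:
  assumes "start k0 \<le> n"
    and base: "\<And>n. start k0 \<le> n \<Longrightarrow> n \<le> start (Suc k0) \<Longrightarrow> P k0 n"
    and step: "\<And>k n. k0 \<le> k \<Longrightarrow> P k (start (Suc k)) \<Longrightarrow> start (Suc k) \<le> n \<Longrightarrow> n \<le> start (Suc (Suc k)) \<Longrightarrow> P (Suc k) n"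
  shows "P (seg n) n"
proof -
  have "\<forall>n. start k \<le> n \<longrightarrow> n \<le> start (Suc k) \<longrightarrow> P k n" if "k \<ge> k0" for k
    using that
  proof (induction k rule: dec_induct)
    case base
    then show ?case using assms(2) by blast
  next
    case (step k)
    then have "P k (start (Suc k))" using start_less[of k] by (simp add: less_imp_le)
    then show ?case using assms(3) step.hyps by blast
  qed
  moreover have "k0 \<le> seg n"
    using seg_upper[of n] assms(1) strict_mono_less[OF start_strict_mono, of k0 "Suc (seg n)"] by simp
  ultimately show ?thesis using seg_lower[of n] seg_upper[of n] by (simp add: less_imp_le)
qed

text \<open>The orbit relation can fail only at the last index of a segment, and
  \<open>weight (seg N)\<close> is at least the number of segments up to the one containing
  \<open>N\<close>.\<close>

lemma quasi_orbit_concat: "quasi_orbit T concat_orbit"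
proof (rule quasi_orbitI, rule Lim_null_comparison[OF _ weight_seg_tendsto])
  have "card ({n. concat_orbit (Suc n) \<noteq> T (concat_orbit n)} \<inter> {..<N}) \<le> weight (seg N)" for N
  proof -
    let ?J = "{n. concat_orbit (Suc n) \<noteq> T (concat_orbit n)} \<inter> {..<N}"
    have end_seg: "Suc n = start (Suc (seg n))" if "n \<in> ?J" for n
    proof (rule ccontr)
      assume "Suc n \<noteq> start (Suc (seg n))"
      then have "Suc n < start (Suc (seg n))" using seg_upper[of n] by simp
      then have "seg (Suc n) = seg n" using seg_lower[of n] by (intro seg_eq) auto
      then show False using that unfolding concat_orbit_def by (simp add: trajectory_Suc)
    qed
    have "inj_on seg ?J" by (rule inj_onI) (metis end_seg old.nat.inject)
    moreover have "seg ` ?J \<subseteq> {..seg N}" using seg_mono by auto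
    ultimately have "card ?J \<le> card {..seg N}" by (intro card_inj_on_le) auto
    then show ?thesis using weight_ge[of "seg N"] by simp
  qed
  then show "\<forall>\<^sub>F n in sequentially. norm (real (card ({n. concat_orbit (Suc n) \<noteq> T (concat_orbit n)} \<inter> {..<n})) / real n)
      \<le> real (weight (seg n)) / real n"
    by (intro always_eventually allI) (simp add: divide_right_mono)
qed

lemma concat_match:
  assumes k0: "\<And>k a m. k \<ge> k0 \<Longrightarrow> has_match \<delta> (trajectory T (x k)) v {a..<a + m} {a..<a + m} ((1 - \<delta>) * real m - real (c k))"
    and n: "start k0 \<le> n"
  shows "has_match \<delta> concat_orbit v {..<n} {..<n} ((1 - \<delta>) * (real n - real (start k0)) - real (weight (seg n)))"
proof -
  have seg_match: "has_match \<delta> concat_orbit v {start k..<n} {start k..<n} ((1 - \<delta>) * (real n - real (start k)) - real (c k))"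
    if "k0 \<le> k" "start k \<le> n" "n \<le> start (Suc k)" for k n
  proof (rule has_match_cong)
    show "has_match \<delta> (trajectory T (x k)) v {start k..<n} {start k..<n} ((1 - \<delta>) * (real n - real (start k)) - real (c k))"
      using k0[OF that(1), of "start k" "n - start k"] that(2) by (simp add: of_nat_diff)
    show "trajectory T (x k) i = concat_orbit i" if "i \<in> {start k..<n}" for i
      using that \<open>n \<le> start (Suc k)\<close> concat_orbit_segment[of k i] by simp
  qed
  show ?thesis
    using n
  proof (induction rule: segment_induct)
    case (base n)
    show ?case using seg_match[OF order_refl base] c_le_weight[of k0] by (elim has_match_mono) auto
  next
    case (step k n)
    have "has_match \<delta> concat_orbit v ({..<start (Suc k)} \<union> {start (Suc k)..<n}) ({..<start (Suc k)} \<union> {start (Suc k)..<n})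
       ((1 - \<delta>) * (real (start (Suc k)) - real (start k0)) - real (weight k)
        + ((1 - \<delta>) * (real n - real (start (Suc k))) - real (c (Suc k))))"
      using step by (intro has_match_Un seg_match) auto
    moreover have "{..<start (Suc k)} \<union> {start (Suc k)..<n} = {..<n}" using step by auto
    moreover have "(1 - \<delta>) * (real (start (Suc k)) - real (start k0)) - real (weight k)
        + ((1 - \<delta>) * (real n - real (start (Suc k))) - real (c (Suc k)))
        = (1 - \<delta>) * (real n - real (start k0)) - real (weight (Suc k))"
      unfolding weight_Suc by (simp add: algebra_simps)
    ultimately show ?case by (simp only:)
  qed
qed

lemma concat_fk:
  assumes k0: "\<And>k a m. k \<ge> k0 \<Longrightarrow> has_match \<delta> (trajectory T (x k)) v {a..<a + m} {a..<a + m} ((1 - \<delta>) * real m - real (c k))"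
    and \<delta>: "\<delta> > 0"
  shows "fk concat_orbit v \<le> 3 * \<delta>"
proof (rule fk_le)
  have "(\<lambda>n. real (weight (seg n)) / real n + real (start k0) / real n) \<longlonglongrightarrow> 0 + 0"
    by (intro tendsto_add weight_seg_tendsto lim_const_over_n)
  then have "\<forall>\<^sub>F n in sequentially. real (weight (seg n)) / real n + real (start k0) / real n < \<delta>"
    using \<delta> by (intro order_tendstoD(2)) simp_all
  then show "\<forall>\<^sub>F n in sequentially. has_match (3 * \<delta>) concat_orbit v {..<n} {..<n} ((1 - 2 * \<delta>) * real n)"
    using eventually_ge_at_top[of "start k0"] eventually_gt_at_top[of 0]
  proof eventually_elim
    case (elim n)
    have "(real (weight (seg n)) + real (start k0)) / real n < \<delta>" using elim by (simp add: add_divide_distrib)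
    then have "real (weight (seg n)) + real (start k0) < \<delta> * real n" using elim(3) by (simp add: pos_divide_less_eq)
    moreover have "(1 - \<delta>) * (real n - real (start k0)) \<ge> (1 - \<delta>) * real n - real (start k0)"
      using \<delta> mult_nonneg_nonneg[of \<delta> "real (start k0)"] by (simp add: algebra_simps)
    ultimately have "(1 - 2 * \<delta>) * real n \<le> (1 - \<delta>) * (real n - real (start k0)) - real (weight (seg n))"
      by (simp add: algebra_simps)
    moreover have "has_match \<delta> concat_orbit v {..<n} {..<n}
        ((1 - \<delta>) * (real n - real (start k0)) - real (weight (seg n)))"
      by (rule concat_match[OF _ elim(2)]) (rule k0)
    ultimately show ?case using \<delta> by (elim has_match_mono) auto
  qed
qed (use \<delta> in auto)

text \<open>Measured against \<open>L\<close> instead of \<open>A k\<close>, the sum over a late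
  segment errs by \<open>K\<close> times its cost and by at most \<open>\<epsilon> / 2\<close> per
  term. The costs add up to the weight, which is negligible against \<open>n\<close>.\<close>

lemma concat_average:
  fixes f :: "'a \<Rightarrow> real" and A :: "nat \<Rightarrow> real"
  assumes seg_avg: "\<And>k a m. \<bar>(\<Sum>j\<in>{a..<a + m}. f (trajectory T (x k) j)) - real m * A k\<bar> \<le> K * real (c k)"
    and K: "K \<ge> 0" and A: "A \<longlonglongrightarrow> L"
  shows "(\<lambda>n. (\<Sum>j<n. f (concat_orbit j)) / real n) \<longlonglongrightarrow> L"
proof (rule LIMSEQ_I)
  fix \<epsilon> :: real assume \<epsilon>: "\<epsilon> > 0"
  obtain k0 where k0: "\<And>k. k \<ge> k0 \<Longrightarrow> \<bar>A k - L\<bar> < \<epsilon> / 2"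
    using LIMSEQ_D[OF A, of "\<epsilon> / 2"] \<epsilon> by auto
  \<comment> \<open>The part before \<open>start k0\<close>, where \<open>A k\<close> may still be
    far from \<open>L\<close>, enters only through this constant.\<close>
  define C where "C = \<bar>\<Sum>j<start k0. f (concat_orbit j)\<bar> + real (start k0) * \<bar>L\<bar>"
  have seg: "\<bar>(\<Sum>j\<in>{start k..<n}. f (concat_orbit j)) - (real n - real (start k)) * L\<bar>
      \<le> (real n - real (start k)) * (\<epsilon> / 2) + K * real (c k)"
    if "k0 \<le> k" "start k \<le> n" "n \<le> start (Suc k)" for k n
  proof -
    have "(\<Sum>j\<in>{start k..<n}. f (concat_orbit j)) = (\<Sum>j\<in>{start k..<n}. f (trajectory T (x k) j))"
      using that by (intro sum.cong) (auto simp: concat_orbit_segment)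
    then have 1: "\<bar>(\<Sum>j\<in>{start k..<n}. f (concat_orbit j)) - (real n - real (start k)) * A k\<bar> \<le> K * real (c k)"
      using seg_avg[of k "start k" "n - start k"] that by (simp add: of_nat_diff)
    have "\<bar>(real n - real (start k)) * A k - (real n - real (start k)) * L\<bar> = (real n - real (start k)) * \<bar>A k - L\<bar>"
      using that by (simp add: abs_mult flip: right_diff_distrib)
    also have "\<dots> \<le> (real n - real (start k)) * (\<epsilon> / 2)"
      using k0[OF that(1)] that by (intro mult_left_mono) auto
    finally show ?thesis using 1 by linarith
  qed
  have bound: "\<bar>(\<Sum>j<n. f (concat_orbit j)) - real n * L\<bar> \<le> C + real n * (\<epsilon> / 2) + K * real (weight (seg n))"
    if "start k0 \<le> n" for n
    using that
  proof (induction rule: segment_induct)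
    case (base n)
    have "{..<n} = {..<start k0} \<union> {start k0..<n}" using base by auto
    then have "(\<Sum>j<n. f (concat_orbit j)) = (\<Sum>j<start k0. f (concat_orbit j)) + (\<Sum>j\<in>{start k0..<n}. f (concat_orbit j))"
      by (simp add: sum.union_disjoint ivl_disj_int)
    moreover have "\<bar>real (start k0) * L\<bar> = real (start k0) * \<bar>L\<bar>" by (simp add: abs_mult)
    moreover have "(real n - real (start k0)) * L = real n * L - real (start k0) * L" by (simp add: algebra_simps)
    moreover have "(real n - real (start k0)) * (\<epsilon> / 2) \<le> real n * (\<epsilon> / 2)"
      using \<epsilon> by (intro mult_right_mono) auto
    moreover have "K * real (c k0) \<le> K * real (weight k0)"
      using c_le_weight K by (intro mult_left_mono)
    ultimately show ?case using seg[OF order_refl base] unfolding C_def by linarith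
  next
    case (step k n)
    have "{..<n} = {..<start (Suc k)} \<union> {start (Suc k)..<n}" using step by auto
    then have "(\<Sum>j<n. f (concat_orbit j)) = (\<Sum>j<start (Suc k). f (concat_orbit j)) + (\<Sum>j\<in>{start (Suc k)..<n}. f (concat_orbit j))"
      by (simp add: sum.union_disjoint ivl_disj_int)
    moreover have "(real n - real (start (Suc k))) * L = real n * L - real (start (Suc k)) * L" by (simp add: algebra_simps)
    moreover have "(real n - real (start (Suc k))) * (\<epsilon> / 2) = real n * (\<epsilon> / 2) - real (start (Suc k)) * (\<epsilon> / 2)"
      by (simp add: algebra_simps)
    moreover have "K * real (weight (Suc k)) = K * real (weight k) + K * real (c (Suc k))"
      unfolding weight_Suc by (simp add: algebra_simps)
    moreover have "k0 \<le> Suc k" using step(1) by simp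
    ultimately show ?case using seg[of "Suc k" n] step(2-4) by linarith
  qed
  have "(\<lambda>n. C / real n + K * (real (weight (seg n)) / real n)) \<longlonglongrightarrow> 0 + K * 0"
    by (intro tendsto_add tendsto_mult tendsto_const weight_seg_tendsto lim_const_over_n)
  then have "(\<lambda>n. C / real n + K * (real (weight (seg n)) / real n)) \<longlonglongrightarrow> 0" by (simp only: mult_zero_right add_0)
  then have "\<forall>\<^sub>F n in sequentially. C / real n + K * (real (weight (seg n)) / real n) < \<epsilon> / 2"
    using \<epsilon> by (rule order_tendstoD(2)[OF _ half_gt_zero])
  then have "\<forall>\<^sub>F n in sequentially. norm ((\<Sum>j<n. f (concat_orbit j)) / real n - L) < \<epsilon>"
    using eventually_ge_at_top[of "start k0"] eventually_gt_at_top[of 0]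
  proof eventually_elim
    case (elim n)
    have "(\<Sum>j<n. f (concat_orbit j)) / real n - L = ((\<Sum>j<n. f (concat_orbit j)) - real n * L) / real n"
      using elim(3) by (simp add: field_simps)
    then have "norm ((\<Sum>j<n. f (concat_orbit j)) / real n - L) = \<bar>(\<Sum>j<n. f (concat_orbit j)) - real n * L\<bar> / real n"
      by (simp add: abs_divide)
    also have "\<dots> \<le> (C + real n * (\<epsilon> / 2) + K * real (weight (seg n))) / real n"
      by (intro divide_right_mono bound elim) simp
    also have "\<dots> = C / real n + K * (real (weight (seg n)) / real n) + \<epsilon> / 2"
      using elim(3) by (simp add: field_simps)
    also have "\<dots> < \<epsilon>" using elim(1) by linarith
    finally show ?case .
  qed
  then show "\<exists>N. \<forall>n\<ge>N. norm ((\<Sum>j<n. f (concat_orbit j)) / real n - L) < \<epsilon>"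
    unfolding eventually_sequentially .
qed

end

section \<open>Coupling of the orbit measures\<close>

lemma bij_betw_preimage:
  assumes "bij_betw f A B" "C \<subseteq> B"
  shows "bij_betw f {x\<in>A. f x \<in> C} C"
proof (rule bij_betw_imageI)
  show "inj_on f {x\<in>A. f x \<in> C}"
    using bij_betw_imp_inj_on[OF assms(1)] by (rule inj_on_subset) auto
  show "f ` {x\<in>A. f x \<in> C} = C"
    using bij_betw_imp_surj_on[OF assms(1)] assms(2) by auto
qed

text \<open>\<open>F g u\<close> is the successor of \<open>g\<close> for a uniform random
  \<open>u\<close>; the cardinality condition says that a uniform \<open>g\<close> has a uniform
  successor. For \<open>u < card \<Delta>\<close> the successor is drawn evenly from the fibre of
  \<psi> over \<open>g\<close>, and for the remaining \<open>u\<close> the points of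
  \<open>\<Gamma>' - \<Delta>\<close> are hit equally often in total.\<close>

lemma coupling_step:
  assumes fin: "finite \<Gamma>" "finite \<Gamma>'" and \<Delta>: "\<Delta> \<subseteq> \<Gamma>'" "\<psi> ` \<Delta> = \<Gamma>"
    and c: "\<And>x. x \<in> \<Gamma> \<Longrightarrow> card {y\<in>\<Delta>. \<psi> y = x} = c"
  shows "\<exists>F. (\<forall>g\<in>\<Gamma>. \<forall>u<card \<Gamma>'. F g u \<in> \<Gamma>') \<and>
    (\<forall>y\<in>\<Gamma>'. card {(g, u) \<in> \<Gamma> \<times> {..<card \<Gamma>'}. F g u = y} = card \<Gamma>) \<and>
    (\<forall>g\<in>\<Gamma>. \<forall>u<card \<Delta>. F g u \<in> \<Delta> \<and> \<psi> (F g u) = g)"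
proof -
  have fin\<Delta>: "finite \<Delta>" using \<Delta>(1) fin(2) by (rule finite_subset)
  have card\<Delta>: "card \<Delta> = c * card \<Gamma>" using fin\<Delta> \<Delta>(2) c by (rule card_constant_fibres)
  have le: "card \<Delta> \<le> card \<Gamma>'" using \<Delta>(1) fin(2) by (rule card_mono[rotated])
  \<comment> \<open>The factor \<Gamma> only counts repetitions: since
    \<open>card \<Delta> = c * card \<Gamma>\<close>, each of the \<open>c\<close> points of the
    fibre is taken \<open>card \<Gamma>\<close> times.\<close>
  have "\<exists>b. bij_betw b {..<card \<Delta>} ({y\<in>\<Delta>. \<psi> y = g} \<times> \<Gamma>)" if "g \<in> \<Gamma>" for g
    using fin fin\<Delta> c[OF that] by (intro finite_same_card_bij) (simp_all add: card_cartesian_product card\<Delta>)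
  then obtain b where b: "\<And>g. g \<in> \<Gamma> \<Longrightarrow> bij_betw (b g) {..<card \<Delta>} ({y\<in>\<Delta>. \<psi> y = g} \<times> \<Gamma>)"
    by metis
  have "\<exists>b'. bij_betw b' (\<Gamma> \<times> {card \<Delta>..<card \<Gamma>'}) ((\<Gamma>' - \<Delta>) \<times> \<Gamma>)"
    using fin fin\<Delta> \<Delta>(1) by (intro finite_same_card_bij) (simp_all add: card_cartesian_product card_Diff_subset)
  then obtain b' where b': "bij_betw b' (\<Gamma> \<times> {card \<Delta>..<card \<Gamma>'}) ((\<Gamma>' - \<Delta>) \<times> \<Gamma>)" by blast
  define F where "F g u = (if u < card \<Delta> then fst (b g u) else fst (b' (g, u)))" for g u
  have F1: "F g u \<in> \<Delta> \<and> \<psi> (F g u) = g" if "g \<in> \<Gamma>" "u < card \<Delta>" for g u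
  proof -
    have "b g u \<in> {y\<in>\<Delta>. \<psi> y = g} \<times> \<Gamma>" using bij_betwE[OF b[OF that(1)]] that(2) by auto
    then show ?thesis unfolding F_def using that(2) by auto
  qed
  have F2: "F g u \<in> \<Gamma>' - \<Delta>" if "g \<in> \<Gamma>" "u < card \<Gamma>'" "\<not> u < card \<Delta>" for g u
  proof -
    have "b' (g, u) \<in> (\<Gamma>' - \<Delta>) \<times> \<Gamma>" using bij_betwE[OF b'] that by auto
    then show ?thesis unfolding F_def using that(3) by auto
  qed
  have F3: "F g u \<in> \<Gamma>'" if "g \<in> \<Gamma>" "u < card \<Gamma>'" for g u
      using F1[OF that(1)] F2[OF that] \<Delta>(1) by blast
  have F4: "card {(g, u) \<in> \<Gamma> \<times> {..<card \<Gamma>'}. F g u = y} = card \<Gamma>" if y: "y \<in> \<Gamma>'" for y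
  proof (cases "y \<in> \<Delta>")
    case True
    have g: "\<psi> y \<in> \<Gamma>" using True \<Delta>(2) by blast
    let ?U = "{u\<in>{..<card \<Delta>}. b (\<psi> y) u \<in> {y} \<times> \<Gamma>}"
    have "{(g, u) \<in> \<Gamma> \<times> {..<card \<Gamma>'}. F g u = y} = Pair (\<psi> y) ` ?U"
    proof (intro set_eqI iffI)
      fix e assume "e \<in> {(g, u) \<in> \<Gamma> \<times> {..<card \<Gamma>'}. F g u = y}"
      then obtain g u where e: "e = (g, u)" "g \<in> \<Gamma>" "u < card \<Gamma>'" "F g u = y" by auto
      have u: "u < card \<Delta>" using F2[OF e(2,3)] e(4) True by blast
      then have "\<psi> y = g" using F1[OF e(2)] e(4) by blast
      moreover have "b g u \<in> {y} \<times> \<Gamma>"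
        using bij_betwE[OF b[OF e(2)]] u e(4) unfolding F_def by (auto simp: mem_Times_iff)
      ultimately show "e \<in> Pair (\<psi> y) ` ?U" using e u by auto
    next
      fix e assume "e \<in> Pair (\<psi> y) ` ?U"
      then show "e \<in> {(g, u) \<in> \<Gamma> \<times> {..<card \<Gamma>'}. F g u = y}" using g le unfolding F_def by auto
    qed
    then have "card {(g, u) \<in> \<Gamma> \<times> {..<card \<Gamma>'}. F g u = y} = card ?U"
      by (simp add: card_image inj_on_def)
    also have "card ?U = card ({y} \<times> \<Gamma>)"
      by (rule bij_betw_same_card, rule bij_betw_preimage[OF b[OF g]]) (use True in auto)
    finally show ?thesis by (simp add: card_cartesian_product)
  next
    case False
    let ?U = "{e\<in>\<Gamma> \<times> {card \<Delta>..<card \<Gamma>'}. b' e \<in> {y} \<times> \<Gamma>}"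
    have eq: "{(g, u) \<in> \<Gamma> \<times> {..<card \<Gamma>'}. F g u = y} = ?U"
    proof (intro set_eqI iffI)
      fix e assume "e \<in> {(g, u) \<in> \<Gamma> \<times> {..<card \<Gamma>'}. F g u = y}"
      then obtain g u where e: "e = (g, u)" "g \<in> \<Gamma>" "u < card \<Gamma>'" "F g u = y" by auto
      have u: "\<not> u < card \<Delta>" using F1[OF e(2)] e(4) False by blast
      have "b' (g, u) \<in> {y} \<times> \<Gamma>"
        using bij_betwE[OF b'] u e unfolding F_def by (auto simp: mem_Times_iff)
      then show "e \<in> ?U" using e u by auto
    next
      fix e assume "e \<in> ?U"
      then show "e \<in> {(g, u) \<in> \<Gamma> \<times> {..<card \<Gamma>'}. F g u = y}" unfolding F_def by auto
    qed
    have "bij_betw b' ?U ({y} \<times> \<Gamma>)"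
      by (rule bij_betw_preimage[OF b']) (use y False in auto)
    then have "card {(g, u) \<in> \<Gamma> \<times> {..<card \<Gamma>'}. F g u = y} = card ({y} \<times> \<Gamma>)"
      unfolding eq by (rule bij_betw_same_card)
    then show ?thesis by (simp add: card_cartesian_product)
  qed
  show ?thesis using F1 F3 F4 by (intro exI[of _ F]) simp
qed

text \<open>An index below \<open>Q * q\<close> is a pair: its quotient selects the current point,
  its remainder the random choice. There are \<open>card \<Gamma>\<close> pairs of a point and a
  choice leading to \<open>y\<close>, and each comes from \<open>e\<close> indices.\<close>

lemma coupling_fibres:
  fixes H :: "nat \<Rightarrow> 'a"
  assumes F: "\<And>y. y \<in> \<Gamma>' \<Longrightarrow> card {(g, u) \<in> \<Gamma> \<times> {..<q}. F g u = y} = card \<Gamma>"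
    and H: "\<And>k. k < Q \<Longrightarrow> H k \<in> \<Gamma>" "\<And>y. y \<in> \<Gamma> \<Longrightarrow> card {k\<in>{..<Q}. H k = y} = e" "e * card \<Gamma> = Q" "e > 0"
    and q: "q > 0" and y: "y \<in> \<Gamma>'"
  shows "card {k\<in>{..<Q * q}. F (H (k div q)) (k mod q) = y} = Q"
proof -
  let ?S = "{(g, u) \<in> \<Gamma> \<times> {..<q}. F g u = y}"
  let ?K = "{(l, u) \<in> {..<Q} \<times> {..<q}. F (H l) u = y}"
  have "bij_betw (\<lambda>k. (k div q, k mod q)) {k\<in>{..<Q * q}. F (H (k div q)) (k mod q) = y} ?K"
  proof (rule bij_betwI[where g = "\<lambda>(l, u). l * q + u"])
    show "(\<lambda>k. (k div q, k mod q)) \<in> {k\<in>{..<Q * q}. F (H (k div q)) (k mod q) = y} \<rightarrow> ?K"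
      using q by (auto simp: less_mult_imp_div_less)
    show "(\<lambda>(l, u). l * q + u) \<in> ?K \<rightarrow> {k\<in>{..<Q * q}. F (H (k div q)) (k mod q) = y}"
    proof (rule funcsetI)
      fix e assume e: "e \<in> ?K"
      obtain l u where lu: "e = (l, u)" by (cases e)
      have "Suc l * q \<le> Q * q" using e lu by (intro mult_right_mono) auto
      then have "l * q + u < Q * q" using e lu by simp
      then show "(case e of (l, u) \<Rightarrow> l * q + u) \<in> {k\<in>{..<Q * q}. F (H (k div q)) (k mod q) = y}"
        using e lu q by simp
    qed
  qed (use q in auto)
  then have "card {k\<in>{..<Q * q}. F (H (k div q)) (k mod q) = y} = card ?K" by (rule bij_betw_same_card)
  also have "card ?K = e * card ?S"
  proof (rule card_constant_fibres[where \<psi> = "\<lambda>(l, u). (H l, u)"])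
    show "finite ?K" by (rule finite_subset[of _ "{..<Q} \<times> {..<q}"]) auto
    show "(\<lambda>(l, u). (H l, u)) ` ?K = ?S"
    proof (intro set_eqI iffI)
      fix s assume "s \<in> ?S"
      then obtain g u where s: "s = (g, u)" "g \<in> \<Gamma>" "u < q" "F g u = y" by auto
      have "{k\<in>{..<Q}. H k = g} \<noteq> {}" using H(2)[OF s(2)] H(4) by (metis card.empty less_irrefl)
      then obtain l where "l < Q" "H l = g" by auto
      then show "s \<in> (\<lambda>(l, u). (H l, u)) ` ?K" using s by (intro image_eqI[of _ _ "(l, u)"]) auto
    qed (use H(1) in auto)
    show "card {k \<in> ?K. (case k of (l, u) \<Rightarrow> (H l, u)) = s} = e" if "s \<in> ?S" for s
    proof -
      obtain g u where gu: "s = (g, u)" by (cases s)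
      then have s: "s = (g, u)" "g \<in> \<Gamma>" "u < q" "F g u = y" using that by simp_all
      have "{k \<in> ?K. (case k of (l, u) \<Rightarrow> (H l, u)) = s} = (\<lambda>l. (l, u)) ` {l\<in>{..<Q}. H l = g}"
        using s by auto
      then show ?thesis using H(2)[OF s(2)] by (simp add: card_image inj_on_def)
    qed
  qed
  also have "\<dots> = Q" using F[OF y] H(3) by simp
  finally show ?thesis .
qed

text \<open>On the unit interval the value \<open>k\<close> is taken exactly between
  \<open>k / Q\<close> and \<open>(k + 1) / Q\<close>. This places the finite couplings of all
  levels on one probability space.\<close>

lemma distr_floor_lborel:
  fixes Q :: nat
  assumes "Q > 0"
  shows "distr (uniform_measure lborel {0..<1::real}) (count_space UNIV) (\<lambda>\<omega>. nat \<lfloor>\<omega> * real Q\<rfloor>)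
    = measure_pmf (pmf_of_set {..<Q})"
proof (rule measure_eqI_countable[where A = "UNIV :: nat set"])
  let ?M = "uniform_measure lborel {0..<1::real}"
  have meas: "(\<lambda>\<omega>. nat \<lfloor>\<omega> * real Q\<rfloor>) \<in> measurable ?M (count_space UNIV)" by measurable
  fix k :: nat
  have "emeasure (distr ?M (count_space UNIV) (\<lambda>\<omega>. nat \<lfloor>\<omega> * real Q\<rfloor>)) {k}
      = emeasure ?M ((\<lambda>\<omega>. nat \<lfloor>\<omega> * real Q\<rfloor>) -` {k})"
    using meas by (subst emeasure_distr) auto
  also have "\<dots> = emeasure lborel ({0..<1} \<inter> (\<lambda>\<omega>. nat \<lfloor>\<omega> * real Q\<rfloor>) -` {k}) / emeasure lborel {0..<1::real}"
  proof (rule emeasure_uniform_measure)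
    have "(\<lambda>\<omega>. nat \<lfloor>\<omega> * real Q\<rfloor>) -` {k} \<inter> space ?M \<in> sets ?M" using meas by (rule measurable_sets) simp
    then show "(\<lambda>\<omega>. nat \<lfloor>\<omega> * real Q\<rfloor>) -` {k} \<in> sets lborel" by simp
  qed simp
  also have "emeasure lborel {0..<1::real} = 1" by simp
  also have "{0..<1} \<inter> (\<lambda>\<omega>. nat \<lfloor>\<omega> * real Q\<rfloor>) -` {k} = (if k < Q then {real k / real Q..<(real k + 1) / real Q} else {})"
  proof (intro set_eqI)
    fix \<omega> :: real
    have "\<omega> \<in> {0..<1} \<and> nat \<lfloor>\<omega> * real Q\<rfloor> = k \<longleftrightarrow> 0 \<le> \<omega> \<and> \<omega> < 1 \<and> real k \<le> \<omega> * real Q \<and> \<omega> * real Q < real k + 1"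
      by (auto simp: nat_eq_iff floor_eq_iff)
    also have "\<dots> \<longleftrightarrow> k < Q \<and> real k / real Q \<le> \<omega> \<and> \<omega> < (real k + 1) / real Q"
    proof -
      have "\<omega> < 1" if "k < Q" "\<omega> * real Q < real k + 1"
      proof -
        have "real k + 1 \<le> real Q" using that(1) by linarith
        then have "\<omega> * real Q < 1 * real Q" using that(2) by linarith
        then show ?thesis using assms by simp
      qed
      moreover have "k < Q" if "\<omega> < 1" "real k \<le> \<omega> * real Q"
      proof -
        have "\<omega> * real Q < 1 * real Q" using that(1) assms by (intro mult_strict_right_mono) auto
        then show ?thesis using that(2) by linarith
      qed
      moreover have "0 \<le> \<omega>" if "real k \<le> \<omega> * real Q"
      proof -
        have "0 \<le> \<omega> * real Q" using that by linarith
        then show ?thesis using assms by (simp add: zero_le_mult_iff)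
      qed
      ultimately show ?thesis using assms by (auto simp: pos_divide_le_eq pos_less_divide_eq)
    qed
    finally show "\<omega> \<in> {0..<1} \<inter> (\<lambda>\<omega>. nat \<lfloor>\<omega> * real Q\<rfloor>) -` {k} \<longleftrightarrow>
        \<omega> \<in> (if k < Q then {real k / real Q..<(real k + 1) / real Q} else {})" by auto
  qed
  also have "emeasure lborel (if k < Q then {real k / real Q..<(real k + 1) / real Q} else {}) / 1
      = (if k < Q then ennreal (1 / real Q) else 0)"
    using assms by (simp add: divide_right_mono diff_divide_distrib[symmetric] divide_ennreal_def)
  also have "\<dots> = emeasure (measure_pmf (pmf_of_set {..<Q})) {k}"
    using assms by (simp add: emeasure_pmf_single pmf_of_set lessThan_empty_iff indicator_def)
  finally show "emeasure (distr ?M (count_space UNIV) (\<lambda>\<omega>. nat \<lfloor>\<omega> * real Q\<rfloor>)) {k}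
    = emeasure (measure_pmf (pmf_of_set {..<Q})) {k}" .
qed simp_all

section \<open>The limit measure\<close>

lemma weak_star_tendstoD:
  fixes f :: "'a::metric_space \<Rightarrow> real"
  shows "weak_star_tendsto M \<mu> \<Longrightarrow> continuous_on UNIV f \<Longrightarrow> (\<lambda>n. integral\<^sup>L (M n) f) \<longlonglongrightarrow> integral\<^sup>L \<mu> f"
  unfolding weak_star_tendsto_def by simp

text \<open>The cost \<open>c k\<close> dominates the constants for comparing \<open>x k\<close>
  with \<open>x n\<close> at precision \<open>\<delta> i\<close> for all
  \<open>n, i \<le> k\<close>, and the length of the \<open>k\<close>-th orbit for the averages. For
  fixed \<open>n\<close> and \<open>i\<close> all late segments are therefore covered, provided the
  points are close. As \<open>z\<close> does not depend on \<mu>, any weak limit can be inserted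
  afterwards.\<close>

lemma GIKN_concatenation:
  fixes T :: "'a::metric_space \<Rightarrow> 'a"
  assumes compact: "compact (UNIV :: 'a set)" and \<Gamma>: "GIKN_sequence T \<Gamma>" and x: "\<And>n. x n \<in> \<Gamma> n"
  shows "\<exists>z. quasi_orbit T z \<and> (\<lambda>n. fk z (trajectory T (x n))) \<longlonglongrightarrow> 0 \<and>
    (\<forall>\<mu>. borel_prob \<mu> \<longrightarrow> weak_star_tendsto (\<lambda>n. orbit_measure (\<Gamma> n)) \<mu> \<longrightarrow> generic z \<mu>)"
proof -
  have orbit: "periodic_orbit T (\<Gamma> n)" for n using \<Gamma> unfolding GIKN_sequence_def by blast
  define \<delta> :: "nat \<Rightarrow> real" where "\<delta> i = 1 / (real i + 1)" for i
  define bound where "bound k n i C \<longleftrightarrow> (\<forall>a m. has_match (\<delta> i) (trajectory T (x k)) (trajectory T (x n))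
      {a..<a + m} {a..<a + m} ((1 - \<delta> i) * real m - real C))" for k n i and C :: nat
  have bound_ex: "\<exists>C. bound k n i C"
    if close: "uniformly_close (\<delta> i) (trajectory T (x k)) (trajectory T (x n))" for k n i
  proof -
    obtain C where C: "\<forall>a m. has_match (\<delta> i) (trajectory T (x k)) (trajectory T (x n)) {a..<a + m} {a..<a + m}
        ((1 - \<delta> i) * real m - C)" using close unfolding uniformly_close_def ..
    obtain C' :: nat where "C \<le> real C'" using real_arch_simple by blast
    have "bound k n i C'"
      unfolding bound_def
    proof (intro allI)
      fix a m
      show "has_match (\<delta> i) (trajectory T (x k)) (trajectory T (x n)) {a..<a + m} {a..<a + m}
          ((1 - \<delta> i) * real m - real C')"
        by (rule has_match_mono[OF C[rule_format, of a m]]) (use \<open>C \<le> real C'\<close> in simp_all)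
    qed
    then show ?thesis ..
  qed
  define C where "C k n i = (SOME C. bound k n i C)" for k n i
  have C: "has_match (\<delta> i) (trajectory T (x k)) (trajectory T (x n)) {a..<a + m} {a..<a + m}
        ((1 - \<delta> i) * real m - real (C k n i))"
    if "uniformly_close (\<delta> i) (trajectory T (x k)) (trajectory T (x n))" for k n i a m
  proof -
    have "bound k n i (C k n i)" unfolding C_def by (rule someI_ex[OF bound_ex[OF that]])
    then show ?thesis unfolding bound_def by blast
  qed
  define c where "c k = 1 + card (\<Gamma> k) + (\<Sum>n\<le>k. \<Sum>i\<le>k. C k n i)" for k
  interpret concatenation T x c by standard (simp add: c_def)
  have C_le: "C k n i \<le> c k" if "n \<le> k" "i \<le> k" for k n i
  proof -
    have "C k n i \<le> (\<Sum>i\<le>k. C k n i)" using that by (intro member_le_sum) auto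
    also have "\<dots> \<le> (\<Sum>n\<le>k. \<Sum>i\<le>k. C k n i)" using that by (intro member_le_sum[of n "{..k}" "\<lambda>n. \<Sum>i\<le>k. C k n i"]) auto
    finally show ?thesis unfolding c_def by simp
  qed
  show ?thesis
  proof (intro exI[of _ concat_orbit] conjI allI impI)
    show "quasi_orbit T concat_orbit" by (rule quasi_orbit_concat)
    show "(\<lambda>n. fk concat_orbit (trajectory T (x n))) \<longlonglongrightarrow> 0"
    proof (rule LIMSEQ_I)
      fix \<epsilon> :: real assume "\<epsilon> > 0"
      obtain i :: nat where i: "3 / \<epsilon> < real i" using reals_Archimedean2 by blast
      have \<delta>i: "\<delta> i > 0" "3 * \<delta> i < \<epsilon>"
      proof -
        have "3 / \<epsilon> < real i + 1" using i by simp
        then show "\<delta> i > 0" "3 * \<delta> i < \<epsilon>" unfolding \<delta>_def using \<open>\<epsilon> > 0\<close> by (simp_all add: field_simps)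
      qed
      obtain N where N: "\<forall>n\<ge>N. \<forall>m\<ge>N. uniformly_close (\<delta> i) (trajectory T (x m)) (trajectory T (x n))"
        using GIKN_uniformly_close[OF \<Gamma> \<delta>i(1) x] by blast
      have "norm (fk concat_orbit (trajectory T (x n)) - 0) < \<epsilon>" if "n \<ge> N" for n
      proof -
        have "fk concat_orbit (trajectory T (x n)) \<le> 3 * \<delta> i"
        proof (rule concat_fk[of "max n i"])
          fix k a m assume k: "max n i \<le> k"
          have "uniformly_close (\<delta> i) (trajectory T (x k)) (trajectory T (x n))" using N that k by simp
          then show "has_match (\<delta> i) (trajectory T (x k)) (trajectory T (x n)) {a..<a + m} {a..<a + m}
              ((1 - \<delta> i) * real m - real (c k))"
            using C_le[of n k i] k by (intro has_match_mono[OF C[of i k n a m]]) simp_all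
        qed (rule \<delta>i)
        then show ?thesis using fk_nonneg[of concat_orbit "trajectory T (x n)"] \<delta>i by simp
      qed
      then show "\<exists>N. \<forall>n\<ge>N. norm (fk concat_orbit (trajectory T (x n)) - 0) < \<epsilon>" by blast
    qed
    fix \<mu> :: "'a measure" assume \<mu>: "borel_prob \<mu>" "weak_star_tendsto (\<lambda>n. orbit_measure (\<Gamma> n)) \<mu>"
    show "generic concat_orbit \<mu>"
    proof (rule genericI[OF \<mu>(1)])
      fix f :: "'a \<Rightarrow> real" assume f: "continuous_on UNIV f"
      obtain F where F: "\<And>z. \<bar>f z\<bar> \<le> F" "F \<ge> 0" using compact_bounded_real[OF compact f] by blast
      show "(\<lambda>n. (\<Sum>j<n. f (concat_orbit j)) / real n) \<longlonglongrightarrow> integral\<^sup>L \<mu> f"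
      proof (rule concat_average[where A = "\<lambda>k. (\<Sum>z\<in>\<Gamma> k. f z) / real (card (\<Gamma> k))" and K = "2 * F"])
        fix k a m
        have "\<bar>(\<Sum>j\<in>{a..<a + m}. f (trajectory T (x k) j)) - real m * ((\<Sum>z\<in>\<Gamma> k. f z) / real (card (\<Gamma> k)))\<bar>
            \<le> 2 * F * real (card (\<Gamma> k))" by (rule orbit_average[OF orbit x F(1)])
        also have "card (\<Gamma> k) \<le> c k" unfolding c_def by simp
        then have "2 * F * real (card (\<Gamma> k)) \<le> 2 * F * real (c k)" using F(2) by (intro mult_left_mono) simp_all
        finally show "\<bar>(\<Sum>j\<in>{a..<a + m}. f (trajectory T (x k) j)) - real m * ((\<Sum>z\<in>\<Gamma> k. f z) / real (card (\<Gamma> k)))\<bar>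
            \<le> 2 * F * real (c k)" .
      next
        have "(\<lambda>n. integral\<^sup>L (orbit_measure (\<Gamma> n)) f) \<longlonglongrightarrow> integral\<^sup>L \<mu> f"
          using \<mu>(2) f by (rule weak_star_tendstoD)
        then show "(\<lambda>k. (\<Sum>z\<in>\<Gamma> k. f z) / real (card (\<Gamma> k))) \<longlonglongrightarrow> integral\<^sup>L \<mu> f"
          using periodic_orbit_finite[OF orbit] f by (simp add: integral_orbit_measure continuous_borel_measurable)
      qed (use F in auto)
    qed
  qed
qed

text \<open>The functions \<open>g n\<close> decrease to the indicator of a closed set, so by
  dominated convergence the integrals of continuous functions determine the measures of closed sets,
  which form an intersection-stable generator.\<close>

lemma measure_eq_continuous:
  fixes \<mu> \<nu> :: "'a::metric_space measure"
  assumes \<mu>: "borel_prob \<mu>" and \<nu>: "borel_prob \<nu>"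
    and eq: "\<And>f :: 'a \<Rightarrow> real. continuous_on UNIV f \<Longrightarrow> integral\<^sup>L \<mu> f = integral\<^sup>L \<nu> f"
  shows "\<mu> = \<nu>"
proof -
  interpret \<mu>: prob_space \<mu> using \<mu> unfolding borel_prob_def by simp
  interpret \<nu>: prob_space \<nu> using \<nu> unfolding borel_prob_def by simp
  have sets: "sets \<mu> = sets borel" "sets \<nu> = sets borel" using \<mu> \<nu> unfolding borel_prob_def by auto
  have closed: "emeasure \<mu> C = emeasure \<nu> C" if C: "closed C" for C
  \<comment> \<open>The distance to the empty set is \<open>0\<close> by convention, so there
    \<open>g n\<close> would be constantly \<open>1\<close>.\<close>
  proof (cases "C = {}")
    case False
    define g where "g n y = max 0 (1 - real n * infdist y C)" for n y
    have g_cont: "continuous_on UNIV (g n)" for n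
      unfolding g_def by (intro continuous_intros)
    have g_lim: "(\<lambda>n. g n y) \<longlonglongrightarrow> indicat_real C y" for y
    proof (cases "y \<in> C")
      case True
      then show ?thesis unfolding g_def by (simp add: in_closed_iff_infdist_zero[OF C False])
    next
      case y: False
      then have pos: "infdist y C > 0"
        using infdist_nonneg[of y C] in_closed_iff_infdist_zero[OF C False, of y] by linarith
      obtain n0 :: nat where n0: "1 / infdist y C < real n0" using reals_Archimedean2 by blast
      have "g n y = 0" if "n \<ge> n0" for n
      proof -
        have "1 < real n0 * infdist y C" using n0 pos by (simp add: pos_divide_less_eq)
        also have "\<dots> \<le> real n * infdist y C" using that pos by (intro mult_right_mono) auto
        finally show ?thesis unfolding g_def by simp
      qed
      then have "\<forall>\<^sub>F n in sequentially. g n y = indicat_real C y"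
        using y unfolding eventually_sequentially by auto
      then show ?thesis by (rule tendsto_eventually)
    qed
    have lim: "(\<lambda>n. integral\<^sup>L M (g n)) \<longlonglongrightarrow> integral\<^sup>L M (indicat_real C)"
      if M: "prob_space M" "sets M = sets borel" for M
    proof (rule integral_dominated_convergence[where w = "\<lambda>_. 1"])
      interpret prob_space M by (rule M)
      show "integrable M (\<lambda>_. 1 :: real)" by simp
      show "g n \<in> borel_measurable M" for n
        using continuous_borel_measurable[OF g_cont] M(2) by (simp cong: measurable_cong_sets)
      show "indicat_real C \<in> borel_measurable M"
        using C M(2) by (intro borel_measurable_indicator) simp
      show "AE y in M. norm (g n y) \<le> 1" for n
        unfolding g_def by (intro AE_I2) (simp add: infdist_nonneg)
    qed (use g_lim in auto)
    have "integral\<^sup>L \<mu> (indicat_real C) = integral\<^sup>L \<nu> (indicat_real C)"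
      using lim[OF \<mu>.prob_space_axioms sets(1)] lim[OF \<nu>.prob_space_axioms sets(2)] LIMSEQ_unique
      by (simp only: eq[OF g_cont])
    then have "measure \<mu> C = measure \<nu> C"
      using C sets sets_eq_imp_space_eq[OF sets(1)] sets_eq_imp_space_eq[OF sets(2)] by simp
    then show ?thesis by (simp add: \<mu>.emeasure_eq_measure \<nu>.emeasure_eq_measure)
  qed simp
  show ?thesis
  proof (rule measure_eqI_generator_eq[where E = "{C. closed C}" and \<Omega> = UNIV and A = "\<lambda>_. UNIV"])
    show "Int_stable {C :: 'a set. closed C}" by (auto simp: Int_stable_def)
    show "sets \<mu> = sigma_sets UNIV {C. closed C}" "sets \<nu> = sigma_sets UNIV {C. closed C}"
      unfolding sets borel_eq_closed by simp_all
  qed (use closed in auto)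
qed

lemma invariant_measureI:
  fixes T :: "'a::metric_space \<Rightarrow> 'a"
  assumes \<mu>: "borel_prob \<mu>" and T: "continuous_on UNIV T"
    and eq: "\<And>f :: 'a \<Rightarrow> real. continuous_on UNIV f \<Longrightarrow> integral\<^sup>L \<mu> (\<lambda>y. f (T y)) = integral\<^sup>L \<mu> f"
  shows "invariant_measure T \<mu>"
proof -
  interpret prob_space \<mu> using \<mu> unfolding borel_prob_def by simp
  have "T \<in> borel_measurable borel" using T by (rule borel_measurable_continuous_onI)
  then have meas: "T \<in> measurable \<mu> borel" using \<mu> unfolding borel_prob_def by (simp cong: measurable_cong_sets)
  have "distr \<mu> borel T = \<mu>"
  proof (rule measure_eq_continuous[OF _ \<mu>])
    show "borel_prob (distr \<mu> borel T)" unfolding borel_prob_def using meas by (simp add: prob_space_distr)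
    show "integral\<^sup>L (distr \<mu> borel T) f = integral\<^sup>L \<mu> f" if "continuous_on UNIV f" for f :: "'a \<Rightarrow> real"
      using integral_distr[OF meas continuous_borel_measurable[OF that]] eq[OF that] by simp
  qed
  then show ?thesis unfolding invariant_measure_def using \<mu> by simp
qed

text \<open>\<open>T\<close> maps the finite orbit onto itself and therefore permutes it.\<close>

lemma invariant_orbit_measure:
  fixes T :: "'a::metric_space \<Rightarrow> 'a"
  assumes T: "continuous_on UNIV T" and orbit: "periodic_orbit T \<Gamma>"
  shows "invariant_measure T (orbit_measure \<Gamma>)"
proof (rule invariant_measureI[OF _ T])
  have fin: "finite \<Gamma>" and ne: "\<Gamma> \<noteq> {}"
    using periodic_orbit_finite[OF orbit] periodic_orbit_nonempty[OF orbit] .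
  then show "borel_prob (orbit_measure \<Gamma>)" by (rule borel_prob_orbit_measure)
  obtain y where y: "y \<in> \<Gamma>" using ne by blast
  note orb = periodic_orbit_trajectory[OF orbit y]
  have "\<Gamma> \<subseteq> T ` \<Gamma>"
  proof
    fix z assume "z \<in> \<Gamma>"
    then obtain j where "z = trajectory T y j" using orb(5) by blast
    then have "z = trajectory T y (Suc (j + card \<Gamma> - 1))" using orb(2) orb(3)[of j] by simp
    then have "z = T (trajectory T y (j + card \<Gamma> - 1))" unfolding trajectory_Suc .
    then show "z \<in> T ` \<Gamma>" using orb(5) by blast
  qed
  moreover have "T ` \<Gamma> \<subseteq> \<Gamma>"
  proof (rule image_subsetI)
    fix z assume "z \<in> \<Gamma>"
    then obtain j where "z = trajectory T y j" using orb(5) by blast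
    then have "T z = trajectory T y (Suc j)" by (simp add: trajectory_Suc)
    then show "T z \<in> \<Gamma>" using orb(5) by blast
  qed
  moreover have "inj_on T \<Gamma>" using fin \<open>\<Gamma> \<subseteq> T ` \<Gamma>\<close> by (rule finite_surj_inj)
  ultimately have "bij_betw T \<Gamma> \<Gamma>" by (simp add: bij_betw_def subset_antisym)
  fix f :: "'a \<Rightarrow> real" assume f: "continuous_on UNIV f"
  have "continuous_on UNIV (\<lambda>y. f (T y))" using f T by (rule continuous_on_compose2) simp
  then show "integral\<^sup>L (orbit_measure \<Gamma>) (\<lambda>y. f (T y)) = integral\<^sup>L (orbit_measure \<Gamma>) f"
    using f fin sum.reindex_bij_betw[OF \<open>bij_betw T \<Gamma> \<Gamma>\<close>, of f]
    by (simp add: integral_orbit_measure continuous_borel_measurable)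
qed

text \<open>Testing with \<open>f\<close> and with \<open>f \<circ> T\<close>, both continuous,
  gives the same sequence of integrals, hence the same limit.\<close>

lemma weak_limit_invariant:
  fixes T :: "'a::metric_space \<Rightarrow> 'a"
  assumes T: "continuous_on UNIV T" and \<mu>: "borel_prob \<mu>" "weak_star_tendsto M \<mu>"
    and M: "\<And>n. invariant_measure T (M n)"
  shows "invariant_measure T \<mu>"
proof (rule invariant_measureI[OF \<mu>(1) T])
  fix f :: "'a \<Rightarrow> real" assume f: "continuous_on UNIV f"
  have fT: "continuous_on UNIV (\<lambda>y. f (T y))" using f T by (rule continuous_on_compose2) simp
  have eq: "integral\<^sup>L (M n) (\<lambda>y. f (T y)) = integral\<^sup>L (M n) f" for n
  proof -
    have "sets (M n) = sets borel" and inv: "distr (M n) borel T = M n"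
      using M unfolding invariant_measure_def borel_prob_def by auto
    then have meas: "T \<in> measurable (M n) borel"
      using borel_measurable_continuous_onI[OF T] by (simp cong: measurable_cong_sets)
    show ?thesis using integral_distr[OF meas continuous_borel_measurable[OF f]] unfolding inv by simp
  qed
  have "(\<lambda>n. integral\<^sup>L (M n) f) \<longlonglongrightarrow> integral\<^sup>L \<mu> (\<lambda>y. f (T y))"
    using weak_star_tendstoD[OF \<mu>(2) fT] by (simp only: eq)
  moreover have "(\<lambda>n. integral\<^sup>L (M n) f) \<longlonglongrightarrow> integral\<^sup>L \<mu> f"
    using \<mu>(2) f by (rule weak_star_tendstoD)
  ultimately show "integral\<^sup>L \<mu> (\<lambda>y. f (T y)) = integral\<^sup>L \<mu> f" by (rule LIMSEQ_unique)
qed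

text \<open>A tree of equally likely indices: level \<open>n\<close> has \<open>Q n\<close> of them,
  and \<open>k\<close> at level \<open>Suc n\<close> descends from \<open>k div q n\<close>. The
  label \<open>H n k\<close> of a uniform index is uniform on \<open>\<Gamma> n\<close>, expressed
  by averages, and with probability at least \<open>\<kappa> n\<close> the step to a child moves the
  label by less than \<open>\<gamma> n\<close>.\<close>

lemma GIKN_coupling:
  fixes T :: "'a::metric_space \<Rightarrow> 'a"
  assumes orbit: "\<And>n. periodic_orbit T (\<Gamma> n)"
    and good: "\<And>n. good_approximation T (\<gamma> n) (\<kappa> n) (\<Gamma> (Suc n)) (\<Gamma> n)"
  shows "\<exists>(Q :: nat \<Rightarrow> nat) (q :: nat \<Rightarrow> nat) (H :: nat \<Rightarrow> nat \<Rightarrow> 'a).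
    (\<forall>n. Q n > 0) \<and> (\<forall>n. q n > 0) \<and> (\<forall>n. Q (Suc n) = Q n * q n) \<and>
    (\<forall>n (f :: 'a \<Rightarrow> real). (\<Sum>k<Q n. f (H n k)) / real (Q n) = (\<Sum>y\<in>\<Gamma> n. f y) / real (card (\<Gamma> n))) \<and>
    (\<forall>n. real (card {k\<in>{..<Q (Suc n)}. \<gamma> n \<le> dist (H (Suc n) k) (H n (k div q n))})
      \<le> (1 - \<kappa> n) * real (Q (Suc n)))"
proof -
  have fin: "finite (\<Gamma> n)" and ne: "\<Gamma> n \<noteq> {}" for n
    using periodic_orbit_finite[OF orbit] periodic_orbit_nonempty[OF orbit] .
  have card_pos: "card (\<Gamma> n) > 0" for n using fin ne by (simp add: card_gt_0_iff)
  define coupled where "coupled n F d \<longleftrightarrow>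
      (\<forall>g\<in>\<Gamma> n. \<forall>u<card (\<Gamma> (Suc n)). F g u \<in> \<Gamma> (Suc n)) \<and>
      (\<forall>y\<in>\<Gamma> (Suc n). card {(g, u) \<in> \<Gamma> n \<times> {..<card (\<Gamma> (Suc n))}. F g u = y} = card (\<Gamma> n)) \<and>
      \<kappa> n \<le> real d / real (card (\<Gamma> (Suc n))) \<and> d \<le> card (\<Gamma> (Suc n)) \<and>
      (\<forall>g\<in>\<Gamma> n. \<forall>u<d. dist (F g u) g < \<gamma> n)" for n d and F :: "'a \<Rightarrow> nat \<Rightarrow> 'a"
  have "\<exists>F d. coupled n F d" for n
  proof -
    obtain \<Delta> \<psi> c where \<Delta>: "\<Delta> \<subseteq> \<Gamma> (Suc n)" "\<kappa> n \<le> real (card \<Delta>) / real (card (\<Gamma> (Suc n)))" "\<psi> ` \<Delta> = \<Gamma> n"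
      and c: "\<forall>x\<in>\<Gamma> n. card {y \<in> \<Delta>. \<psi> y = x} = c"
      and d: "\<forall>y\<in>\<Delta>. \<forall>j<card (\<Gamma> n). dist ((T ^^ j) y) ((T ^^ j) (\<psi> y)) < \<gamma> n"
      using good[of n] by (rule good_approximationE)
    have "\<exists>F. (\<forall>g\<in>\<Gamma> n. \<forall>u<card (\<Gamma> (Suc n)). F g u \<in> \<Gamma> (Suc n)) \<and>
        (\<forall>y\<in>\<Gamma> (Suc n). card {(g, u) \<in> \<Gamma> n \<times> {..<card (\<Gamma> (Suc n))}. F g u = y} = card (\<Gamma> n)) \<and>
        (\<forall>g\<in>\<Gamma> n. \<forall>u<card \<Delta>. F g u \<in> \<Delta> \<and> \<psi> (F g u) = g)"
      by (rule coupling_step[OF fin fin \<Delta>(1,3)]) (use c in simp)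
    then obtain F where F: "\<forall>g\<in>\<Gamma> n. \<forall>u<card (\<Gamma> (Suc n)). F g u \<in> \<Gamma> (Suc n)"
      "\<forall>y\<in>\<Gamma> (Suc n). card {(g, u) \<in> \<Gamma> n \<times> {..<card (\<Gamma> (Suc n))}. F g u = y} = card (\<Gamma> n)"
      "\<forall>g\<in>\<Gamma> n. \<forall>u<card \<Delta>. F g u \<in> \<Delta> \<and> \<psi> (F g u) = g"
      by (elim exE conjE)
    have "dist (F g u) g < \<gamma> n" if "g \<in> \<Gamma> n" "u < card \<Delta>" for g u
      using d[rule_format, of "F g u" 0] F(3) that card_pos by simp
    then have "coupled n F (card \<Delta>)"
      unfolding coupled_def using F(1,2) \<Delta>(1,2) card_mono[OF fin \<Delta>(1)] by simp
    then show ?thesis by blast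
  qed
  then obtain F d where "\<forall>n. coupled n (F n) (d n)" by metis
  then have F: "g \<in> \<Gamma> n \<Longrightarrow> u < card (\<Gamma> (Suc n)) \<Longrightarrow> F n g u \<in> \<Gamma> (Suc n)"
    and F_card: "y \<in> \<Gamma> (Suc n) \<Longrightarrow> card {(g, u) \<in> \<Gamma> n \<times> {..<card (\<Gamma> (Suc n))}. F n g u = y} = card (\<Gamma> n)"
    and d: "\<kappa> n \<le> real (d n) / real (card (\<Gamma> (Suc n)))" "d n \<le> card (\<Gamma> (Suc n))"
    and F_dist: "g \<in> \<Gamma> n \<Longrightarrow> u < d n \<Longrightarrow> dist (F n g u) g < \<gamma> n" for n g u y
    unfolding coupled_def by simp_all
  define q where "q n = card (\<Gamma> (Suc n))" for n
  define Q where "Q = rec_nat (card (\<Gamma> 0)) (\<lambda>n Q. Q * q n)"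
  obtain h0 where h0: "bij_betw h0 {..<card (\<Gamma> 0)} (\<Gamma> 0)"
    using ex_bij_betw_nat_finite[OF fin[of 0]] by (auto simp: lessThan_atLeast0)
  define H where "H = rec_nat h0 (\<lambda>n H k. F n (H (k div q n)) (k mod q n))"
  have Q_0: "Q 0 = card (\<Gamma> 0)" and Q_Suc: "Q (Suc n) = Q n * q n" for n unfolding Q_def by simp_all
  have H_0: "H 0 = h0" and H_Suc: "H (Suc n) k = F n (H n (k div q n)) (k mod q n)" for n k
    unfolding H_def by simp_all
  have q: "q n > 0" for n unfolding q_def by (rule card_pos)
  have Q: "Q n > 0" for n by (induction n) (simp_all add: Q_0 Q_Suc card_pos q)
  have H: "H n k \<in> \<Gamma> n" if "k < Q n" for n k
    using that
  proof (induction n arbitrary: k)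
    case 0
    then show ?case using bij_betwE[OF h0] unfolding Q_0 H_0 by simp
  next
    case (Suc n)
    have "k div q n < Q n" using Suc.prems unfolding Q_Suc by (rule less_mult_imp_div_less)
    moreover have "k mod q n < q n" using q by simp
    ultimately show ?case unfolding H_Suc using Suc.IH F unfolding q_def by blast
  qed
  \<comment> \<open>Uniformity in the form that survives the induction: every point labels the same
    number \<open>e\<close> of indices, and at level \<open>Suc n\<close> this number is
    \<open>Q n\<close>.\<close>
  have fibres: "\<exists>e>0. e * card (\<Gamma> n) = Q n \<and> (\<forall>y\<in>\<Gamma> n. card {k\<in>{..<Q n}. H n k = y} = e)" for n
  proof (induction n)
    case 0
    have "card {k\<in>{..<card (\<Gamma> 0)}. h0 k = y} = 1" if "y \<in> \<Gamma> 0" for y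
      using bij_betw_same_card[OF bij_betw_preimage[OF h0, of "{y}"]] that by simp
    then show ?case unfolding Q_0 H_0 by (intro exI[of _ 1]) simp
  next
    case (Suc n)
    then obtain e where e: "e > 0" "e * card (\<Gamma> n) = Q n" "\<And>y. y \<in> \<Gamma> n \<Longrightarrow> card {k\<in>{..<Q n}. H n k = y} = e"
      by blast
    have "card {k\<in>{..<Q (Suc n)}. H (Suc n) k = y} = Q n" if "y \<in> \<Gamma> (Suc n)" for y
      unfolding Q_Suc H_Suc
      by (rule coupling_fibres[where \<Gamma>' = "\<Gamma> (Suc n)", OF F_card[folded q_def] H e(3,2,1) q that])
    then show ?case using Q[of n] unfolding Q_Suc q_def by (intro exI[of _ "Q n"]) simp
  qed
  have avg: "(\<Sum>k<Q n. f (H n k)) / real (Q n) = (\<Sum>y\<in>\<Gamma> n. f y) / real (card (\<Gamma> n))" for n and f :: "'a \<Rightarrow> real"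
  proof -
    obtain e where e: "e > 0" "e * card (\<Gamma> n) = Q n" "\<forall>y\<in>\<Gamma> n. card {k\<in>{..<Q n}. H n k = y} = e"
      using fibres[of n] by blast
    have "(\<Sum>k<Q n. f (H n k)) = (\<Sum>y\<in>\<Gamma> n. \<Sum>k\<in>{k\<in>{..<Q n}. H n k = y}. f (H n k))"
      by (rule sum.group[symmetric]) (use fin H in auto)
    also have "\<dots> = (\<Sum>y\<in>\<Gamma> n. real e * f y)"
      using e(3) by (intro sum.cong) simp_all
    also have "\<dots> = real e * (\<Sum>y\<in>\<Gamma> n. f y)" by (simp add: sum_distrib_left)
    finally show ?thesis using e(1) unfolding e(2)[symmetric] by simp
  qed
  have far: "real (card {k\<in>{..<Q (Suc n)}. \<gamma> n \<le> dist (H (Suc n) k) (H n (k div q n))}) \<le> (1 - \<kappa> n) * real (Q (Suc n))" for n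
  proof -
    let ?B = "{k\<in>{..<Q (Suc n)}. \<gamma> n \<le> dist (H (Suc n) k) (H n (k div q n))}"
    have "card ?B \<le> card ({..<Q n} \<times> {d n..<q n})"
    proof (rule card_inj_on_le)
      show "inj_on (\<lambda>k. (k div q n, k mod q n)) ?B"
        by (rule inj_onI) (metis div_mult_mod_eq prod.inject)
      show "(\<lambda>k. (k div q n, k mod q n)) ` ?B \<subseteq> {..<Q n} \<times> {d n..<q n}"
      proof (rule image_subsetI)
        fix k assume k: "k \<in> ?B"
        then have 1: "k div q n < Q n" unfolding Q_Suc by (simp add: less_mult_imp_div_less)
        have "\<not> k mod q n < d n"
        proof
          assume "k mod q n < d n"
          from F_dist[OF H[OF 1] this] k show False unfolding H_Suc by simp
        qed
        then show "(k div q n, k mod q n) \<in> {..<Q n} \<times> {d n..<q n}" using 1 q by simp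
      qed
    qed simp
    also have "\<dots> = Q n * (q n - d n)" by simp
    finally have "real (card ?B) \<le> real (Q n * (q n - d n))" by (rule of_nat_mono)
    also have "\<dots> = real (Q n) * (real (q n) - real (d n))" using d(2)[of n] unfolding q_def by (simp add: of_nat_diff)
    also have "\<dots> \<le> real (Q n) * (real (q n) - \<kappa> n * real (q n))"
    proof -
      have "\<kappa> n * real (q n) \<le> real (d n)" using d(1)[of n] q[of n] unfolding q_def by (simp add: pos_le_divide_eq)
      then show ?thesis by (intro mult_left_mono) auto
    qed
    finally show ?thesis unfolding Q_Suc by (simp add: algebra_simps)
  qed
  show ?thesis using Q q Q_Suc avg far by (intro exI[of _ Q] exI[of _ q] exI[of _ H]) simp
qed

text \<open>Makes the indices read off from one real number consistent: the index at the coarser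
  level is the parent of the one at the finer level.\<close>

lemma nat_floor_mult_div:
  assumes "q > 0"
  shows "nat \<lfloor>a * real q\<rfloor> div q = nat \<lfloor>a\<rfloor>"
proof -
  have "\<lfloor>a * real q\<rfloor> div int q = \<lfloor>a * real q / real_of_int (int q)\<rfloor>"
    by (rule floor_divide_real_eq_div[symmetric]) simp
  also have "a * real q / real_of_int (int q) = a" using assms by simp
  finally have "nat (\<lfloor>a * real q\<rfloor> div int q) = nat \<lfloor>a\<rfloor>" by simp
  then show ?thesis by (simp add: nat_div_distrib')
qed

text \<open>Choosing points of \<open>\<Gamma> n\<close> at random so that consecutive ones are usually \<open>\<gamma> n\<close>-close, almost
  every random sequence converges by the Borel--Cantelli lemma; the law of its limit is the weak
  limit of the orbit measures.\<close>
lemma GIKN_weak_limit: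
  fixes T :: "'a::metric_space \<Rightarrow> 'a"
  assumes compact: "compact (UNIV :: 'a set)" and "GIKN_sequence T \<Gamma>"
  shows "\<exists>\<mu>. borel_prob \<mu> \<and> weak_star_tendsto (\<lambda>n. orbit_measure (\<Gamma> n)) \<mu>"
proof -
  obtain \<gamma> \<kappa> where orbit: "\<And>n. periodic_orbit T (\<Gamma> n)"
    and "incseq (\<lambda>n. card (\<Gamma> n))" "filterlim (\<lambda>n. card (\<Gamma> n)) at_top sequentially"
    and \<gamma>: "\<And>n. 0 < \<gamma> n" and \<kappa>: "\<And>n. 0 < \<kappa> n" "\<And>n. \<kappa> n \<le> 1"
    and good: "\<And>n. good_approximation T (\<gamma> n) (\<kappa> n) (\<Gamma> (Suc n)) (\<Gamma> n)"
    and sum_\<gamma>: "summable \<gamma>" and "convergent_prod \<kappa>"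
    using assms(2) by (rule GIKN_sequenceE) blast
  have sum_\<kappa>: "summable (\<lambda>n. 1 - \<kappa> n)" using \<kappa> \<open>convergent_prod \<kappa>\<close> by (rule prod_tails(1))
  obtain Q q :: "nat \<Rightarrow> nat" and H :: "nat \<Rightarrow> nat \<Rightarrow> 'a" where coupling:
    "\<forall>n. Q n > 0" "\<forall>n. q n > 0" "\<forall>n. Q (Suc n) = Q n * q n"
    "\<forall>n (f :: 'a \<Rightarrow> real). (\<Sum>k<Q n. f (H n k)) / real (Q n) = (\<Sum>y\<in>\<Gamma> n. f y) / real (card (\<Gamma> n))"
    "\<forall>n. real (card {k\<in>{..<Q (Suc n)}. \<gamma> n \<le> dist (H (Suc n) k) (H n (k div q n))}) \<le> (1 - \<kappa> n) * real (Q (Suc n))"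
    using GIKN_coupling[of T \<Gamma> \<gamma> \<kappa>, OF orbit good] by (elim exE conjE)
  note Q = coupling(1)[rule_format] and q = coupling(2)[rule_format] and Q_Suc = coupling(3)[rule_format]
    and avg = coupling(4)[rule_format] and far = coupling(5)[rule_format]
  define M where "M = uniform_measure lborel {0..<1::real}"
  have "prob_space M" unfolding M_def by (rule prob_space_uniform_measure) simp_all
  then interpret M: prob_space M .
  \<comment> \<open>A single uniform \<omega> selects the index on every level, and hence a branch
    of the tree.\<close>
  define K where "K n \<omega> = nat \<lfloor>\<omega> * real (Q n)\<rfloor>" for n and \<omega> :: real
  have K_meas: "K n \<in> measurable M (count_space UNIV)" for n
    unfolding K_def M_def by measurable
  have K_distr: "distr M (count_space UNIV) (K n) = measure_pmf (pmf_of_set {..<Q n})" for n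
    unfolding M_def K_def[abs_def] by (rule distr_floor_lborel[OF Q])
  have K_div: "K (Suc n) \<omega> div q n = K n \<omega>" for n \<omega>
    using nat_floor_mult_div[OF q, of "\<omega> * real (Q n)" n] unfolding K_def Q_Suc by (simp add: mult.assoc)
  define Y where "Y n \<omega> = H n (K n \<omega>)" for n \<omega>
  have Y_meas: "Y n \<in> measurable M N" if "space N = UNIV" for n and N :: "'a measure"
    unfolding Y_def[abs_def] using K_meas by (rule measurable_compose) (simp add: that)
  have Y_int: "integral\<^sup>L M (\<lambda>\<omega>. f (Y n \<omega>)) = integral\<^sup>L (orbit_measure (\<Gamma> n)) f"
    if f: "continuous_on UNIV f" for f :: "'a \<Rightarrow> real" and n
  proof -
    have "integral\<^sup>L M (\<lambda>\<omega>. f (Y n \<omega>)) = integral\<^sup>L (distr M (count_space UNIV) (K n)) (\<lambda>k. f (H n k))"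
      unfolding Y_def by (rule integral_distr[OF K_meas, symmetric]) simp
    also have "\<dots> = (\<Sum>k<Q n. f (H n k)) / real (Q n)"
      unfolding K_distr using Q[of n] by (subst integral_pmf_of_set) (auto simp: lessThan_empty_iff)
    also have "\<dots> = integral\<^sup>L (orbit_measure (\<Gamma> n)) f"
      unfolding avg using periodic_orbit_finite[OF orbit] f
      by (simp add: integral_orbit_measure continuous_borel_measurable)
    finally show ?thesis .
  qed
  define A where "A n = {\<omega>. \<gamma> n \<le> dist (Y (Suc n) \<omega>) (Y n \<omega>)}" for n
  have A_eq: "A n = K (Suc n) -` {k. \<gamma> n \<le> dist (H (Suc n) k) (H n (k div q n))} \<inter> space M" for n
    unfolding A_def Y_def M_def by (auto simp: K_div)
  have A_sets: "A n \<in> sets M" for n unfolding A_eq using K_meas by (rule measurable_sets) simp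
  have A_le: "measure M (A n) \<le> 1 - \<kappa> n" for n
  proof -
    let ?B = "{k. \<gamma> n \<le> dist (H (Suc n) k) (H n (k div q n))}"
    have "measure M (A n) = measure (distr M (count_space UNIV) (K (Suc n))) ?B"
      unfolding A_eq by (rule measure_distr[OF K_meas, symmetric]) simp
    also have "\<dots> = real (card ({..<Q (Suc n)} \<inter> ?B)) / real (Q (Suc n))"
      unfolding K_distr using Q[of "Suc n"] by (subst measure_pmf_of_set) (auto simp: lessThan_empty_iff)
    also have "{..<Q (Suc n)} \<inter> ?B = {k\<in>{..<Q (Suc n)}. \<gamma> n \<le> dist (H (Suc n) k) (H n (k div q n))}" by auto
    also have "real (card \<dots>) / real (Q (Suc n)) \<le> 1 - \<kappa> n"
      using far[of n] Q[of "Suc n"] by (simp add: pos_divide_le_eq)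
    finally show ?thesis .
  qed
  have "summable (\<lambda>n. measure M (A n))"
    using sum_\<kappa> by (rule summable_comparison_test'[where N = 0]) (simp add: A_le)
  then have AE: "AE \<omega> in M. \<forall>\<^sub>F n in sequentially. \<omega> \<in> space M - A n"
    by (intro borel_cantelli_AE1 A_sets) (simp_all add: M.emeasure_eq_measure)
  \<comment> \<open>Here only finitely many of the large displacements \<open>A n\<close> occur, so
    the displacements are eventually dominated by the summable sequence \<gamma> and the points form
    a Cauchy sequence.\<close>
  define G where "G = {\<omega>. \<exists>m. \<forall>n\<ge>m. \<omega> \<notin> A n}"
  have G_sets: "G \<in> sets M"
  proof -
    have "G = (\<Union>m. \<Inter>n\<in>{m..}. space M - A n)" unfolding G_def M_def by auto
    also have "\<dots> \<in> sets M" using A_sets by (intro sets.countable_UN sets.countable_INT' sets.Diff) auto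
    finally show ?thesis .
  qed
  have AE_G: "AE \<omega> in M. \<omega> \<in> G"
    using AE by eventually_elim (auto simp: G_def eventually_sequentially)
  have conv: "convergent (\<lambda>n. Y n \<omega>)" if \<omega>: "\<omega> \<in> G" for \<omega>
  proof -
    obtain m where "\<forall>n\<ge>m. \<omega> \<notin> A n" using \<omega> unfolding G_def by blast
    then have m: "dist (Y (Suc n) \<omega>) (Y n \<omega>) < \<gamma> n" if "n \<ge> m" for n
      using that unfolding A_def by (simp add: not_le)
    have step: "dist (Y (n + k) \<omega>) (Y n \<omega>) \<le> sum \<gamma> {n..<n + k}" if "n \<ge> m" for n k
    proof (induction k)
      case (Suc k)
      have "dist (Y (n + Suc k) \<omega>) (Y n \<omega>) \<le> dist (Y (Suc (n + k)) \<omega>) (Y (n + k) \<omega>) + dist (Y (n + k) \<omega>) (Y n \<omega>)"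
        using dist_triangle[of "Y (Suc (n + k)) \<omega>" "Y n \<omega>" "Y (n + k) \<omega>"] by simp
      also have "\<dots> \<le> \<gamma> (n + k) + sum \<gamma> {n..<n + k}" using Suc m[of "n + k"] that by simp
      finally show ?case by simp
    qed simp
    have "Cauchy (\<lambda>n. Y n \<omega>)"
    proof (rule metric_CauchyI)
      fix e :: real assume "e > 0"
      then obtain N where N: "\<And>n k. n \<ge> N \<Longrightarrow> norm (sum \<gamma> {n..<k}) < e / 2"
        using sum_\<gamma> unfolding summable_Cauchy by (metis half_gt_zero)
      have "dist (Y i \<omega>) (Y (max m N) \<omega>) < e / 2" if "i \<ge> max m N" for i
        using step[of "max m N" "i - max m N"] N[of "max m N" i] that by simp
      then show "\<exists>N. \<forall>i\<ge>N. \<forall>j\<ge>N. dist (Y i \<omega>) (Y j \<omega>) < e"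
        by (intro exI[of _ "max m N"] allI impI) (rule dist_triangle_half_l[of _ "Y (max m N) \<omega>"])
    qed
    then show ?thesis
      using compact_imp_complete[OF compact] unfolding complete_def convergent_def by blast
  qed
  define y0 where "y0 = (undefined :: 'a)"
  \<comment> \<open>A constant value on the null set outside \<open>G\<close> makes the sequence
    converge everywhere, so that its limit \<open>Z\<close> is measurable.\<close>
  define Y' where "Y' n \<omega> = (if \<omega> \<in> G then Y n \<omega> else y0)" for n \<omega>
  define Z where "Z \<omega> = lim (\<lambda>n. Y' n \<omega>)" for \<omega>
  have Y'_lim: "(\<lambda>n. Y' n \<omega>) \<longlonglongrightarrow> Z \<omega>" for \<omega>
  proof -
    have "convergent (\<lambda>n. Y' n \<omega>)" unfolding Y'_def using conv by (cases "\<omega> \<in> G") (simp_all add: convergent_const)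
    then show ?thesis unfolding Z_def by (simp add: convergent_LIMSEQ_iff)
  qed
  have Y'_meas: "Y' n \<in> borel_measurable M" for n
    unfolding Y'_def[abs_def] using G_sets Y_meas[of borel n]
    by (intro measurable_If_set) (simp_all add: M_def)
  have Z_meas: "Z \<in> borel_measurable M"
    using Y'_meas Y'_lim by (rule borel_measurable_LIMSEQ_metric)
  define \<mu> where "\<mu> = distr M borel Z"
  have "borel_prob \<mu>" unfolding borel_prob_def \<mu>_def using Z_meas by (simp add: M.prob_space_distr)
  moreover have "weak_star_tendsto (\<lambda>n. orbit_measure (\<Gamma> n)) \<mu>"
    unfolding weak_star_tendsto_def
  proof (intro allI impI)
    fix f :: "'a \<Rightarrow> real" assume f: "continuous_on UNIV f"
    obtain F where F: "\<And>z. \<bar>f z\<bar> \<le> F" "F \<ge> 0" using compact_bounded_real[OF compact f] by blast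
    have fm: "f \<in> borel_measurable borel" using f by (rule continuous_borel_measurable)
    have "(\<lambda>n. integral\<^sup>L M (\<lambda>\<omega>. f (Y' n \<omega>))) \<longlonglongrightarrow> integral\<^sup>L M (\<lambda>\<omega>. f (Z \<omega>))"
    proof (rule integral_dominated_convergence[where w = "\<lambda>_. F"])
      show "(\<lambda>\<omega>. f (Z \<omega>)) \<in> borel_measurable M" using Z_meas fm by (rule measurable_compose)
      show "(\<lambda>\<omega>. f (Y' n \<omega>)) \<in> borel_measurable M" for n using Y'_meas fm by (rule measurable_compose)
      show "AE \<omega> in M. (\<lambda>n. f (Y' n \<omega>)) \<longlonglongrightarrow> f (Z \<omega>)"
        using continuous_on_tendsto_compose[OF f Y'_lim] by (intro AE_I2) simp
    qed (use F in auto)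
    moreover have "integral\<^sup>L M (\<lambda>\<omega>. f (Y' n \<omega>)) = integral\<^sup>L (orbit_measure (\<Gamma> n)) f" for n
    proof -
      have "integral\<^sup>L M (\<lambda>\<omega>. f (Y' n \<omega>)) = integral\<^sup>L M (\<lambda>\<omega>. f (Y n \<omega>))"
      proof (rule integral_cong_AE)
        show "(\<lambda>\<omega>. f (Y' n \<omega>)) \<in> borel_measurable M" using Y'_meas fm by (rule measurable_compose)
        show "(\<lambda>\<omega>. f (Y n \<omega>)) \<in> borel_measurable M" by (rule measurable_compose[OF _ fm]) (rule Y_meas, simp)
        show "AE \<omega> in M. f (Y' n \<omega>) = f (Y n \<omega>)" using AE_G by eventually_elim (simp add: Y'_def)
      qed
      then show ?thesis unfolding Y_int[OF f] .
    qed
    moreover have "integral\<^sup>L M (\<lambda>\<omega>. f (Z \<omega>)) = integral\<^sup>L \<mu> f"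
      unfolding \<mu>_def by (rule integral_distr[OF Z_meas fm, symmetric])
    ultimately show "(\<lambda>n. integral\<^sup>L (orbit_measure (\<Gamma> n)) f) \<longlonglongrightarrow> integral\<^sup>L \<mu> f" by simp
  qed
  ultimately show ?thesis by blast
qed

theorem theorem6p2:
  fixes T :: "'a::metric_space \<Rightarrow> 'a"
  assumes "compact (UNIV :: 'a set)" and "continuous_on UNIV T"
  shows "(\<forall>\<Gamma>. GIKN_sequence T \<Gamma> \<longrightarrow>
            (\<forall>x. (\<forall>n. x n \<in> \<Gamma> n) \<longrightarrow> fk_Cauchy T x) \<and>
            (\<exists>\<mu>. invariant_measure T \<mu> \<and> fk_converges T (\<lambda>n. orbit_measure (\<Gamma> n)) \<mu>)) \<and>
         (\<forall>\<mu>. royal_measure T \<mu> \<longrightarrow>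
            (\<exists>\<nu>. (\<forall>n. periodic_measure T (\<nu> n)) \<and> fk_limit T \<nu> \<mu>))"
proof (intro conjI allI impI)
  have orbit: "periodic_orbit T (\<Gamma> n)" if "GIKN_sequence T \<Gamma>" for \<Gamma> n
    using that unfolding GIKN_sequence_def by blast
  have points: "\<exists>x. \<forall>n. x n \<in> \<Gamma> n" if "GIKN_sequence T \<Gamma>" for \<Gamma>
    using periodic_orbit_nonempty[OF orbit[OF that]] by (intro choice) blast
  {
    fix \<Gamma> x assume \<Gamma>: "GIKN_sequence T \<Gamma>" and x: "\<forall>n. x n \<in> \<Gamma> n"
    show "fk_Cauchy T x" by (rule GIKN_fk_Cauchy[OF \<Gamma> x[rule_format]])
  next
    fix \<Gamma> assume \<Gamma>: "GIKN_sequence T \<Gamma>"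
    obtain \<mu> where \<mu>: "borel_prob \<mu>" "weak_star_tendsto (\<lambda>n. orbit_measure (\<Gamma> n)) \<mu>"
      using GIKN_weak_limit[OF assms(1) \<Gamma>] by blast
    obtain x where x: "\<And>n. x n \<in> \<Gamma> n" using points[OF \<Gamma>] by blast
    obtain z where "quasi_orbit T z" "(\<lambda>n. fk z (trajectory T (x n))) \<longlonglongrightarrow> 0"
      "\<forall>\<mu>. borel_prob \<mu> \<longrightarrow> weak_star_tendsto (\<lambda>n. orbit_measure (\<Gamma> n)) \<mu> \<longrightarrow> generic z \<mu>"
      using GIKN_concatenation[OF assms(1) \<Gamma> x] by (elim exE conjE)
    note z = this(1,2) this(3)[rule_format, OF \<mu>]
    have inv: "invariant_measure T (orbit_measure (\<Gamma> n))" for n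
      by (rule invariant_orbit_measure[OF assms(2) orbit[OF \<Gamma>]])
    have inv_\<mu>: "invariant_measure T \<mu>" by (rule weak_limit_invariant[OF assms(2) \<mu> inv])
    have "fk_converges T (\<lambda>n. orbit_measure (\<Gamma> n)) \<mu>"
      unfolding fk_converges_def
      using inv inv_\<mu> z quasi_orbit_trajectory generic_orbit[OF assms(1) orbit[OF \<Gamma>] x]
      by (intro conjI allI exI[of _ "\<lambda>n. trajectory T (x n)"] exI[of _ z]) auto
    with inv_\<mu> show "\<exists>\<mu>. invariant_measure T \<mu> \<and> fk_converges T (\<lambda>n. orbit_measure (\<Gamma> n)) \<mu>" by blast
  next
    fix \<mu> assume "royal_measure T \<mu>"
    then obtain \<Gamma> where \<mu>: "borel_prob \<mu>" and \<Gamma>: "GIKN_sequence T \<Gamma>"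
      and lim: "weak_star_tendsto (\<lambda>n. orbit_measure (\<Gamma> n)) \<mu>"
      unfolding royal_measure_def by blast
    obtain x where x: "\<And>n. x n \<in> \<Gamma> n" using points[OF \<Gamma>] by blast
    obtain z where "quasi_orbit T z" "(\<lambda>n. fk z (trajectory T (x n))) \<longlonglongrightarrow> 0"
      "\<forall>\<mu>. borel_prob \<mu> \<longrightarrow> weak_star_tendsto (\<lambda>n. orbit_measure (\<Gamma> n)) \<mu> \<longrightarrow> generic z \<mu>"
      using GIKN_concatenation[OF assms(1) \<Gamma> x] by (elim exE conjE)
    \<comment> \<open>The royal measure is itself a weak limit of the orbit measures, so the
      quasi-orbit glued from the orbits is generic for it.\<close>
    note z = this(1,2) this(3)[rule_format, OF \<mu> lim]
    have "fk_limit T (\<lambda>n. orbit_measure (\<Gamma> n)) \<mu>"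
      unfolding fk_limit_def generic_point_def
      using z GIKN_fk_Cauchy[OF \<Gamma> x] generic_orbit[OF assms(1) orbit[OF \<Gamma>] x]
      by (intro exI[of _ x] exI[of _ z]) auto
    moreover have "periodic_measure T (orbit_measure (\<Gamma> n))" for n
      unfolding periodic_measure_def using orbit[OF \<Gamma>] by blast
    ultimately show "\<exists>\<nu>. (\<forall>n. periodic_measure T (\<nu> n)) \<and> fk_limit T \<nu> \<mu>"
      by (intro exI[of _ "\<lambda>n. orbit_measure (\<Gamma> n)"]) simp
  }
qed

end
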